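(* Let $n\ge 2$ be an integer and let $p$ be a prime number. Then $p$ is a bad prime for $n$ if and only if $p\mid J_T$ for some $T\in\mathcal T$ (equivalently, if and only if $p\mid \operatorname{lcm}(J_T)_{T\in\mathcal T}$).
   Context: Hasse derivatives and Casas--Alvero polynomials. Let $K$ be a field and $f=x^n+a_1x^{n-1}+\dots+a_n\in K[x]$ a monic univariate polynomial of degree $n$; put $a_0=1$. For $i\in\{1,\dots,n-1\}$ the $i$-th Hasse derivative of $f$ is $H_i(f)=\sum_{k=0}^{n-i}\binom{n-k}{i}a_k x^{n-k-i}$. The polynomial $f$ is a Casas--Alvero polynomial if for each $i\in\{1,\dots,n-1\}$ it has a non-constant common factor with $H_i(f)$. For $p$ a prime (or $p=0$), $\mathrm{CA}_{n,p}$ is the statement: for every algebraically closed field $K$ of characteristic $p$, every monic Casas--Alvero polynomial $f\in K[x]$ of degree $n$ is of the form $f(x)=(x-b)^n$ with $b\in K$. A prime number $p$ is a bad prime for $n$ if $\mathrm{CA}_{n,p}$ is false. The polynomials $G_{T,i}$. For $j\in\{1,\dots,n-1\}$ let $\Phi_j$ be the ring endomorphism of $\mathbb Z[x_1,\dots,x_{n-1}]$ with $\Phi_j(x_i)=x_i-x_j$ for $i\ne j$ and $\Phi_j(x_j)=-x_j$; let $\Phi_n$ be the identity map. Let $\sigma_i$ be the $i$-th elementary symmetric polynomial in $x_1,\dots,x_{n-1}$. Let $\mathcal T=\{1,\dots,n\}^{n-1}$. For $T=(j_1,\dots,j_{n-1})\in\mathcal T$ and $i\in\{1,\dots,n-1\}$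 put $G_{T,i}=\Phi_{j_i}(\sigma_i(x_1,\dots,x_{n-1}))$, a homogeneous polynomial of degree $i$ with integer coefficients. The matrix $M_T$ and the integer $J_T$. Let $d=\frac{n^2-3n+4}{2}$ and $C=\binom{\frac{n^2-n}{2}}{n-2}$, which is the number of monomials of degree $d$ in the $n-1$ variables $x_1,\dots,x_{n-1}$. Let $D=\sum_{i=1}^{n-1}\binom{d-i+n-2}{n-2}$; then $D\ge C$. For $\alpha\in\mathbb Z_{\ge0}^{n-1}$ write $x^\alpha=\prod_{k=1}^{n-1}x_k^{\alpha_k}$ and $|\alpha|=\sum_{k=1}^{n-1}\alpha_k$. For $T\in\mathcal T$, $M_T$ is the $D\times C$ integer matrix whose rows are indexed by the pairs $(i,\alpha)$ with $1\le i\le n-1$ and $|\alpha|=d-i$, whose columns are indexed by the monomials of degree $d$ in $x_1,\dots,x_{n-1}$, and whose row $(i,\alpha)$ is the vector of coefficients of the degree-$d$ polynomial $G_{T,i}x^\alpha$. $J_T$ is the greatest common divisor of all the $C\times C$ minors of $M_T$ (with $J_T=0$ if all these minors vanish). *)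

theory Defs
  imports
    "HOL-Algebra.Algebraic_Closure"
    "HOL-Library.Poly_Mapping"
    "HOL-Library.FuncSet"
    "HOL-Computational_Algebra.Primes"
    "Jordan_Normal_Form.DL_Submatrix"
    "Jordan_Normal_Form.Determinant"
begin

section \<open>Hasse derivatives and Casas--Alvero polynomials\<close>

definition ring_char :: "'a ring \<Rightarrow> nat" where
  "ring_char K =
     (if \<exists>m::nat. m > 0 \<and> add_pow K m \<one>\<^bsub>K\<^esub> = \<zero>\<^bsub>K\<^esub>
      then LEAST m::nat. m > 0 \<and> add_pow K m \<one>\<^bsub>K\<^esub> = \<zero>\<^bsub>K\<^esub> else 0)"

definition monic_of_degree :: "'a ring \<Rightarrow> nat \<Rightarrow> 'a list \<Rightarrow> bool" where
  "monic_of_degree K n f \<longleftrightarrow>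
     f \<in> carrier (poly_ring K) \<and> f \<noteq> [] \<and> Polynomials.lead_coeff f = \<one>\<^bsub>K\<^esub> \<and> Polynomials.degree f = n"

text \<open>Polynomials of HOL-Algebra are coefficient lists with the leading coefficient first, so for
  \<open>f = x^n + a\<^sub>1 x^(n-1) + \<dots> + a\<^sub>n\<close> we have \<open>f ! k = a\<^sub>k\<close>.  The leading coefficient of the Hasse
  derivative may vanish in positive characteristic, hence the \<open>normalize\<close>.\<close>

definition hasse :: "'a ring \<Rightarrow> nat \<Rightarrow> 'a list \<Rightarrow> 'a list" where
  "hasse K i f = (let n = Polynomials.degree f in
     ring.normalize K (map (\<lambda>k. add_pow K ((n - k) choose i) (f ! k)) [0..<n - i + 1]))"

definition casas_alvero :: "'a ring \<Rightarrow> 'a list \<Rightarrow> bool" where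
  "casas_alvero K f \<longleftrightarrow>
     (\<forall>i\<in>{1..Polynomials.degree f - 1}. \<exists>g\<in>carrier (poly_ring K).
        Polynomials.degree g \<ge> 1 \<and> g pdivides\<^bsub>K\<^esub> f \<and> g pdivides\<^bsub>K\<^esub> hasse K i f)"

text \<open>HOL cannot quantify over types inside a formula, so the algebraically closed fields range
  over all those whose carrier is a subset of the given type.  Algebraically closed fields are
  infinite, so this is only meaningful (and only used) for infinite types.\<close>

definition CA :: "'a itself \<Rightarrow> nat \<Rightarrow> nat \<Rightarrow> bool" where
  "CA (_ :: 'a itself) n p \<longleftrightarrow>
     (\<forall>K :: 'a ring. algebraically_closed K \<and> ring_char K = p \<longrightarrow>
        (\<forall>f. monic_of_degree K n f \<and> casas_alvero K f \<longrightarrow>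
           (\<exists>b\<in>carrier K. f = [\<one>\<^bsub>K\<^esub>, \<ominus>\<^bsub>K\<^esub> b] [^]\<^bsub>poly_ring K\<^esub> n)))"

definition bad_prime :: "'a itself \<Rightarrow> nat \<Rightarrow> nat \<Rightarrow> bool" where
  "bad_prime U n p \<longleftrightarrow> prime p \<and> \<not> CA U n p"


section \<open>The polynomials \<open>G\<close>\<close>

text \<open>Integer polynomials in the variables \<open>x\<^sub>k\<close> (\<open>k :: nat\<close>) are finitely supported functions from
  exponent vectors to coefficients, with the convolution product.\<close>

type_synonym zpoly = "(nat \<Rightarrow>\<^sub>0 nat) \<Rightarrow>\<^sub>0 int"

definition xvar :: "nat \<Rightarrow> zpoly" where
  "xvar k = Poly_Mapping.single (Poly_Mapping.single k 1) 1"

definition msubst :: "(nat \<Rightarrow> zpoly) \<Rightarrow> zpoly \<Rightarrow> zpoly" where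
  "msubst s P = (\<Sum>m\<in>Poly_Mapping.keys P. Poly_Mapping.single 0 (Poly_Mapping.lookup P m) *
                  (\<Prod>k\<in>Poly_Mapping.keys m. s k ^ Poly_Mapping.lookup m k))"

definition Phi :: "nat \<Rightarrow> nat \<Rightarrow> zpoly \<Rightarrow> zpoly" where
  "Phi n j = (if j = n then id else msubst (\<lambda>i. if i = j then - xvar j else xvar i - xvar j))"

definition esym :: "nat \<Rightarrow> nat \<Rightarrow> zpoly" where
  "esym n i = (\<Sum>S | S \<subseteq> {1..n - 1} \<and> card S = i. \<Prod>k\<in>S. xvar k)"

definition TT :: "nat \<Rightarrow> (nat \<Rightarrow> nat) set" where
  "TT n = {1..n - 1} \<rightarrow>\<^sub>E {1..n}"

definition GT :: "nat \<Rightarrow> (nat \<Rightarrow> nat) \<Rightarrow> nat \<Rightarrow> zpoly" where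
  "GT n T i = Phi n (T i) (esym n i)"


section \<open>The matrix \<open>M\<close> and the integer \<open>J\<close>\<close>

definition dd :: "nat \<Rightarrow> nat" where
  "dd n = (n\<^sup>2 + 4 - 3 * n) div 2"

definition CC :: "nat \<Rightarrow> nat" where
  "CC n = ((n\<^sup>2 - n) div 2) choose (n - 2)"

definition DD :: "nat \<Rightarrow> nat" where
  "DD n = (\<Sum>i = 1..n - 1. (dd n - i + n - 2) choose (n - 2))"

definition exps :: "nat \<Rightarrow> nat \<Rightarrow> (nat \<Rightarrow>\<^sub>0 nat) set" where
  "exps n e = {\<alpha>. Poly_Mapping.keys \<alpha> \<subseteq> {1..n - 1} \<and> (\<Sum>k = 1..n - 1. Poly_Mapping.lookup \<alpha> k) = e}"

text \<open>The gcd of the maximal minors does not depend on how rows and columns are listed; we list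
  monomials in the library's linear order on exponent vectors and rows \<open>(i, \<alpha>)\<close> by increasing \<open>i\<close>.\<close>

definition col_list :: "nat \<Rightarrow> (nat \<Rightarrow>\<^sub>0 nat) list" where
  "col_list n = sorted_list_of_set (exps n (dd n))"

definition row_list :: "nat \<Rightarrow> (nat \<times> (nat \<Rightarrow>\<^sub>0 nat)) list" where
  "row_list n = concat (map (\<lambda>i. map (Pair i) (sorted_list_of_set (exps n (dd n - i)))) [1..<n])"

definition MT :: "nat \<Rightarrow> (nat \<Rightarrow> nat) \<Rightarrow> int mat" where
  "MT n T = mat (DD n) (CC n) (\<lambda>(r, c). case row_list n ! r of (i, \<alpha>) \<Rightarrow>
     Poly_Mapping.lookup (GT n T i * Poly_Mapping.single \<alpha> 1) (col_list n ! c))"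

definition JT :: "nat \<Rightarrow> (nat \<Rightarrow> nat) \<Rightarrow> int" where
  "JT n T = Gcd {det (submatrix (MT n T) I UNIV) | I. I \<subseteq> {..<DD n} \<and> card I = CC n}"


section \<open>Consistency of the encodings\<close>

text \<open>\<open>msubst s\<close> is the ring endomorphism with \<open>x\<^sub>k \<mapsto> s k\<close>.\<close>

definition mpow :: "(nat \<Rightarrow> zpoly) \<Rightarrow> (nat \<Rightarrow>\<^sub>0 nat) \<Rightarrow> zpoly" where
  "mpow s m = (\<Prod>k\<in>Poly_Mapping.keys m. s k ^ Poly_Mapping.lookup m k)"

lemma mpow_superset:
  "finite A \<Longrightarrow> Poly_Mapping.keys m \<subseteq> A \<Longrightarrow> mpow s m = (\<Prod>k\<in>A. s k ^ Poly_Mapping.lookup m k)"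
  unfolding mpow_def by (rule prod.mono_neutral_left) (auto simp: in_keys_iff)

lemma mpow_add: "mpow s (m + m') = mpow s m * mpow s m'"
proof -
  let ?A = "Poly_Mapping.keys m \<union> Poly_Mapping.keys m'"
  have "Poly_Mapping.keys (m + m') \<subseteq> ?A" by (rule keys_add)
  then show ?thesis
    by (simp add: mpow_superset[of ?A] lookup_add power_add prod.distrib)
qed

lemma msubst_superset:
  assumes "finite A" "Poly_Mapping.keys P \<subseteq> A"
  shows "msubst s P = (\<Sum>m\<in>A. Poly_Mapping.single 0 (Poly_Mapping.lookup P m) * mpow s m)"
  unfolding msubst_def mpow_def[symmetric]
  by (rule sum.mono_neutral_left) (use assms in \<open>auto simp: in_keys_iff\<close>)

lemma msubst_add: "msubst s (P + Q) = msubst s P + msubst s Q"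
proof -
  let ?A = "Poly_Mapping.keys P \<union> Poly_Mapping.keys Q"
  have "Poly_Mapping.keys (P + Q) \<subseteq> ?A" by (rule keys_add)
  then show ?thesis
    by (simp add: msubst_superset[of ?A] lookup_add single_add distrib_right sum.distrib)
qed

lemma msubst_single: "msubst s (Poly_Mapping.single m c) = Poly_Mapping.single 0 c * mpow s m"
  by (simp add: msubst_superset[of "{m}"])

lemma msubst_sum: "msubst s (sum f A) = (\<Sum>a\<in>A. msubst s (f a))"
proof -
  have "msubst s 0 = 0" by (simp add: msubst_def)
  then show ?thesis by (induction A rule: infinite_finite_induct) (auto simp: msubst_add)
qed

lemma zpoly_eq_sum:
  "(P :: zpoly) = (\<Sum>m\<in>Poly_Mapping.keys P. Poly_Mapping.single m (Poly_Mapping.lookup P m))"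
  by (rule poly_mapping_eqI) (auto simp: lookup_sum lookup_single when_def in_keys_iff)

lemma msubst_mult: "msubst s (P * Q) = msubst s P * msubst s Q"
proof -
  have single: "msubst s (Poly_Mapping.single m c * Poly_Mapping.single m' c') =
      msubst s (Poly_Mapping.single m c) * msubst s (Poly_Mapping.single m' c')" for m c m' c'
  proof -
    have "Poly_Mapping.single 0 (c * c') = Poly_Mapping.single 0 c * (Poly_Mapping.single 0 c' :: zpoly)"
      by (simp add: mult_single)
    then show ?thesis by (simp add: mult_single msubst_single mpow_add mult_ac)
  qed
  define t where "t R m = Poly_Mapping.single m (Poly_Mapping.lookup R m)" for R :: zpoly and m
  have P: "P = (\<Sum>m\<in>Poly_Mapping.keys P. t P m)" and Q: "Q = (\<Sum>m\<in>Poly_Mapping.keys Q. t Q m)"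
    unfolding t_def by (rule zpoly_eq_sum)+
  have "msubst s (P * Q) =
      msubst s ((\<Sum>m\<in>Poly_Mapping.keys P. t P m) * (\<Sum>m\<in>Poly_Mapping.keys Q. t Q m))"
    using P Q by simp
  also have "\<dots> = msubst s (\<Sum>m\<in>Poly_Mapping.keys P. t P m) * msubst s (\<Sum>m\<in>Poly_Mapping.keys Q. t Q m)"
    by (simp only: sum_product msubst_sum single t_def)
  also have "\<dots> = msubst s P * msubst s Q"
    using P Q by simp
  finally show ?thesis .
qed

lemma msubst_one: "msubst s 1 = 1"
  using msubst_single[of s 0 1] by (simp add: mpow_def)

lemma msubst_xvar: "msubst s (xvar k) = s k"
  by (simp add: xvar_def msubst_single mpow_def)

lemma bij_betw_exps:
  "bij_betw (\<lambda>\<alpha>. map (Poly_Mapping.lookup \<alpha>) [1..<n]) (exps n e)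
     {l :: nat list. length l = n - 1 \<and> sum_list l = e}"
proof (rule bij_betw_byWitness[where f' = "\<lambda>l. Abs_poly_mapping (\<lambda>k. if k \<in> {1..n - 1} then l ! (k - 1) else 0)"])
  have fin: "finite {k. (if k \<in> {1..n - 1} then l ! (k - 1) else 0) \<noteq> (0::nat)}" for l
    by (rule finite_subset[of _ "{1..n - 1}"]) (auto split: if_splits)
  have lk: "Poly_Mapping.lookup (Abs_poly_mapping (\<lambda>k. if k \<in> {1..n - 1} then l ! (k - 1) else 0))
      = (\<lambda>k. if k \<in> {1..n - 1} then l ! (k - 1) else (0::nat))" for l
    using lookup_Abs_poly_mapping[OF fin] .
  have m: "map (\<lambda>k. if k \<in> {1..n - 1} then l ! (k - 1) else (0::nat)) [1..<n] = l"
    if "length l = n - 1" for l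
    by (rule nth_equalityI) (use that in auto)
  have s: "(\<Sum>k = 1..n - 1. h k) = sum_list (map h [1..<n])" for h :: "nat \<Rightarrow> nat"
  proof -
    have "{1..n - 1} = {1..<n}" by auto
    then show ?thesis by (simp add: interv_sum_list_conv_sum_set_nat)
  qed
  show "\<forall>\<alpha>\<in>exps n e. Abs_poly_mapping (\<lambda>k. if k \<in> {1..n - 1}
      then map (Poly_Mapping.lookup \<alpha>) [1..<n] ! (k - 1) else 0) = \<alpha>"
  proof
    fix \<alpha> assume a: "\<alpha> \<in> exps n e"
    have z: "Poly_Mapping.lookup \<alpha> k = 0" if "k \<notin> {1..n - 1}" for k
    proof -
      have "k \<notin> Poly_Mapping.keys \<alpha>" using a that unfolding exps_def by blast
      then show ?thesis by (simp add: in_keys_iff)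
    qed
    have "(if k \<in> {1..n - 1} then map (Poly_Mapping.lookup \<alpha>) [1..<n] ! (k - 1) else 0)
        = Poly_Mapping.lookup \<alpha> k" for k
      using z[of k] by auto
    then show "Abs_poly_mapping (\<lambda>k. if k \<in> {1..n - 1}
      then map (Poly_Mapping.lookup \<alpha>) [1..<n] ! (k - 1) else 0) = \<alpha>"
      by (simp only: lookup_inverse)
  qed
  show "\<forall>l\<in>{l. length l = n - 1 \<and> sum_list l = e}. map (Poly_Mapping.lookup
     (Abs_poly_mapping (\<lambda>k. if k \<in> {1..n - 1} then l ! (k - 1) else 0))) [1..<n] = l"
    using m by (simp only: lk) blast
  show "(\<lambda>\<alpha>. map (Poly_Mapping.lookup \<alpha>) [1..<n]) ` exps n e
      \<subseteq> {l. length l = n - 1 \<and> sum_list l = e}"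
    unfolding exps_def s by auto
  show "(\<lambda>l. Abs_poly_mapping (\<lambda>k. if k \<in> {1..n - 1} then l ! (k - 1) else 0)) `
      {l. length l = n - 1 \<and> sum_list l = e} \<subseteq> exps n e"
  proof (rule image_subsetI)
    fix l :: "nat list" assume l: "l \<in> {l. length l = n - 1 \<and> sum_list l = e}"
    show "Abs_poly_mapping (\<lambda>k. if k \<in> {1..n - 1} then l ! (k - 1) else 0) \<in> exps n e"
      using l m[of l] unfolding exps_def mem_Collect_eq s lk
      by (auto simp: in_keys_iff lk split: if_splits)
  qed
qed

lemma card_exps: "n \<ge> 2 \<Longrightarrow> card (exps n e) = (e + n - 2) choose (n - 2)"
proof -
  assume n: "n \<ge> 2"
  have "card (exps n e) = (e + (n - 1) - 1) choose e"
    using bij_betw_same_card[OF bij_betw_exps[of n e]] card_length_sum_list[of "n - 1" e] by simp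
  also have "\<dots> = (e + n - 2) choose (n - 2)"
    using n binomial_symmetric[of e "e + n - 2"] by (simp add: numeral_2_eq_2)
  finally show ?thesis .
qed

lemma finite_exps: "finite (exps n e)"
proof -
  have "finite {l :: nat list. length l = n - 1 \<and> sum_list l = e}"
  proof (rule finite_subset)
    show "{l :: nat list. length l = n - 1 \<and> sum_list l = e} \<subseteq> {l. set l \<subseteq> {..e} \<and> length l = n - 1}"
      using member_le_sum_list by fastforce
  qed (simp add: finite_lists_length_eq)
  then show ?thesis using bij_betw_finite[OF bij_betw_exps] by blast
qed

lemma two_dd: "2 * int (dd n) = int n ^ 2 - 3 * int n + 4"
proof -
  have le: "3 * n \<le> n\<^sup>2 + 4"
  proof -
    have "0 \<le> (2 * int n - 3)\<^sup>2 + 7" by simp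
    then have "3 * int n \<le> int n ^ 2 + 4" by (simp add: power2_eq_square algebra_simps)
    then have "int (3 * n) \<le> int (n\<^sup>2 + 4)" by simp
    then show ?thesis by linarith
  qed
  moreover have "even (n\<^sup>2 + 4 - 3 * n)"
    using le by (simp add: even_diff_nat)
  then obtain q where q: "n\<^sup>2 + 4 - 3 * n = 2 * q" by (elim evenE)
  ultimately have "n\<^sup>2 + 4 = 2 * q + 3 * n" by linarith
  then have "int (n\<^sup>2 + 4) = int (2 * q + 3 * n)" by (rule arg_cong)
  moreover have "dd n = q" by (simp add: dd_def q)
  ultimately show ?thesis by simp
qed

lemma length_col_list: "n \<ge> 2 \<Longrightarrow> length (col_list n) = CC n"
proof -
  assume n: "n \<ge> 2"
  have "2 * (int (dd n) + int n - 2) = int n ^ 2 - int n"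
    using two_dd[of n] by simp
  then have "2 * int (dd n + n - 2) = int (n\<^sup>2 - n)"
    using n by (simp add: of_nat_diff power2_eq_square)
  then have "dd n + n - 2 = (n\<^sup>2 - n) div 2" by linarith
  then show ?thesis
    using card_exps[OF n] by (simp add: col_list_def CC_def)
qed

lemma length_row_list: "n \<ge> 2 \<Longrightarrow> length (row_list n) = DD n"
proof -
  assume n: "n \<ge> 2"
  have "length (row_list n) = (\<Sum>i\<leftarrow>[1..<n]. (dd n - i + n - 2) choose (n - 2))"
    using card_exps[OF n] by (simp add: row_list_def length_concat comp_def)
  also have "\<dots> = (\<Sum>i\<in>{1..<n}. (dd n - i + n - 2) choose (n - 2))"
    by (simp add: interv_sum_list_conv_sum_set_nat)
  also have "{1..<n} = {1..n - 1}" using n by auto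
  finally show ?thesis by (simp add: DD_def)
qed

lemma set_col_list: "set (col_list n) = exps n (dd n)"
  by (simp add: col_list_def finite_exps)

lemma set_row_list: "set (row_list n) = (SIGMA i:{1..<n}. exps n (dd n - i))"
  by (auto simp: row_list_def finite_exps)

lemma distinct_col_list: "distinct (col_list n)"
  by (simp add: col_list_def)

lemma le_dd: "1 \<le> i \<Longrightarrow> i \<le> n - 1 \<Longrightarrow> i \<le> dd n"
proof -
  assume i: "1 \<le> i" "i \<le> n - 1"
  then have "2 \<le> n" by simp
  then obtain m where n: "n = 2 + m" using le_Suc_ex by blast
  have "2 * int (dd n) = int m * (int m + 1) + 2"
    using two_dd[of n] by (simp add: n power2_eq_square algebra_simps)
  moreover have "2 * int m \<le> int m * (int m + 1)"
  proof (cases m)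
    case (Suc k)
    have "int m * 2 \<le> int m * (int m + 1)" by (rule mult_left_mono) (use Suc in auto)
    then show ?thesis by simp
  qed auto
  ultimately show ?thesis using i n by linarith
qed

end

theory Submission
  imports Defs "HOL-Number_Theory.Cong" "HOL-Algebra.Algebraic_Closure_Type" "HOL-Library.Countable_Set"
begin

text \<open>
  After a translation \<open>f\<close> has the root \<open>0\<close>, so \<open>f = (X + x\<^sub>1) \<cdots> (X + x\<^sub>n)\<close> with \<open>x\<^sub>n = 0\<close>.  The
  \<open>(n - i)\<close>-th Hasse derivative of \<open>f\<close> takes the value \<open>G\<^bsub>T,i\<^esub>(x)\<close> at the root \<open>-x\<^sub>j\<close>, where \<open>j = T i\<close>.
  Hence \<open>p\<close> is bad iff for some \<open>T\<close> these \<open>n - 1\<close> forms of degrees \<open>1, \<dots>, n - 1\<close> in \<open>n - 1\<close> variables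
  have a non-trivial zero in characteristic \<open>p\<close>.

  A non-trivial zero is a kernel vector of \<open>M\<^sub>T\<close>, so by the adjugate all maximal minors vanish.
  Conversely, let \<open>I\<close> be the ideal of \<open>\<int>[x]\<close> generated by \<open>p\<close> and the \<open>G\<^bsub>T,i\<^esub>\<close>.  If no power of some \<open>x\<^sub>k\<close> is
  in \<open>I\<close>, then \<open>I + (x\<^sub>k - 1)\<close> is proper and the algebraic closure of a residue field, which is
  countable, contains a non-trivial zero.  Otherwise \<open>x\<^sub>k^N \<in> I\<close> for all \<open>k\<close>, say \<open>x\<^sub>k^N = \<Sum>\<^sub>i A\<^sub>k\<^sub>i G\<^bsub>T,i\<^esub>\<close> modulo
  \<open>p\<close>, with \<open>det A\<close> homogeneous.  Multiplication by \<open>det A\<close> from the ring modulo \<open>I\<close> to the ring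
  modulo \<open>p\<close> and the \<open>x\<^sub>k^N\<close> is injective (Wiebe).  Comparing degrees, \<open>I\<close> contains all monomials of
  degree \<open>\<Sum>\<^sub>i (i - 1) + 1 = d\<close>, and by Cauchy--Binet some maximal minor is prime to \<open>p\<close>.
\<close>

section \<open>Regular sequences and determinants\<close>

text \<open>The forms \<open>GT n T i\<close> are never shown to be a regular sequence, and reducing
  modulo p literally would need a second polynomial type. So p stays a generator beside the others,
  everything happens in integer polynomials, and regularity is only checked for the powers x_k^N,
  where it can be read off the coefficients; the matrix A carries it over to the forms. The degrees
  fit as follows: modulo the powers the top degree is (n - 1)(N - 1), while det A has degree
  \<Sum>(N - i). Hence a form of degree e > \<Sum>(i - 1) is killed by det A and lies in I, and d is
  the least such e. Both matrix arguments are run over the integers: one shows that a minor times a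
  monomial lies in the ideal of the forms, the other that M_T has a left inverse modulo p.
  Countability of the residue field matters because the fields have their carriers in an arbitrary
  infinite type: a countable field can be copied along an injection into that type.\<close>

interpretation gen: Modules.module "(*) :: 'a::comm_ring_1 \<Rightarrow> 'a \<Rightarrow> 'a"
  by unfold_locales (simp_all add: algebra_simps)

declare gen.scale_scale [simp del] \<comment> \<open>loops with \<open>mult.assoc\<close>\<close>

text \<open>Ideals are handled as submodules of the ring over itself. The linear algebra library
  then provides \<open>span_breakdown_eq\<close>, x \<in> (insert a S) iff x - k a \<in> (S) for
  some k, by which generators are split off one at a time below.\<close>

abbreviation ideal_span :: "'a::comm_ring_1 set \<Rightarrow> 'a set" where
  "ideal_span \<equiv> gen.span"

abbreviation is_ideal :: "'a::comm_ring_1 set \<Rightarrow> bool" where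
  "is_ideal \<equiv> gen.subspace"

lemma ideal_mult_left: "is_ideal J \<Longrightarrow> x \<in> J \<Longrightarrow> c * x \<in> J"
  by (rule gen.subspace_scale)

lemma ideal_mult_right: "is_ideal J \<Longrightarrow> x \<in> J \<Longrightarrow> x * c \<in> J"
  by (metis gen.subspace_scale mult.commute)

text \<open>McCoy's argument: induct on the degree of \<open>F\<close> modulo \<open>J\<close>, and for its leading coefficient
  descend through the coefficients of \<open>H\<close> from the top.\<close>

lemma coeffs_mult_in_ideal_cancel:
  fixes H F :: "'a::comm_ring_1 poly"
  assumes J: "is_ideal J"
    and nzd: "\<And>c. (\<forall>l. coeff H l * c \<in> J) \<Longrightarrow> c \<in> J"
    and HF: "\<forall>i. coeff (H * F) i \<in> J"
  shows "coeff F i \<in> J"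
proof -
  have "(\<forall>i\<ge>r. coeff F i \<in> J) \<Longrightarrow> (\<forall>i. coeff (H * F) i \<in> J) \<Longrightarrow> \<forall>i. coeff F i \<in> J" for r F
  proof (induction r arbitrary: F)
    case 0
    then show ?case by simp
  next
    case (Suc r)
    have "\<forall>i. coeff H l * coeff F i \<in> J" for l
    proof (induction "degree H + 1 - l" arbitrary: l rule: less_induct)
      case less
      show ?case
      proof (cases "l > degree H")
        case True
        then show ?thesis using gen.subspace_0[OF J] by (simp add: coeff_eq_0)
      next
        case False
        have above: "coeff H k * coeff F i \<in> J" if "k > l" for k i
          using less[of k] that False by auto
        have "coeff (H * F) (l + r) = (\<Sum>k\<le>l + r. coeff H k * coeff F (l + r - k))"
          by (simp add: coeff_mult)
        also have "\<dots> = coeff H l * coeff F r + (\<Sum>k\<in>{..l + r} - {l}. coeff H k * coeff F (l + r - k))"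
          by (subst sum.remove[of _ l]) auto
        \<comment> \<open>Terms with k > l lie in J by the inner induction; those with k < l involve
          coefficients of F of index above r.\<close>
        finally have "coeff H l * coeff F r =
            coeff (H * F) (l + r) - (\<Sum>k\<in>{..l + r} - {l}. coeff H k * coeff F (l + r - k))"
          by simp
        also have "\<dots> \<in> J"
        proof (intro gen.subspace_diff[OF J] gen.subspace_sum[OF J])
          show "coeff (H * F) (l + r) \<in> J" using Suc.prems by blast
          fix k assume k: "k \<in> {..l + r} - {l}"
          show "coeff H k * coeff F (l + r - k) \<in> J"
          proof (cases "k > l")
            case False
            with k have "l + r - k \<ge> Suc r" by auto
            then show ?thesis using Suc.prems(1) ideal_mult_left[OF J] by blast
          qed (rule above)
        qed
        finally have "coeff H l * coeff F r \<in> J" .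
        \<comment> \<open>Scaling by \<open>coeff H l\<close> puts coefficient r into J too, so the
          outer induction hypothesis applies to the scaled polynomial.\<close>
        then have "\<forall>i\<ge>r. coeff (smult (coeff H l) F) i \<in> J"
          using Suc.prems(1) ideal_mult_left[OF J] by (metis coeff_smult le_eq_less_or_eq Suc_leI)
        moreover have "\<forall>i. coeff (H * smult (coeff H l) F) i \<in> J"
          using Suc.prems(2) ideal_mult_left[OF J] by simp
        ultimately have "\<forall>i. coeff (smult (coeff H l) F) i \<in> J" by (rule Suc.IH)
        then show ?thesis by simp
      qed
    qed
    then show ?case using nzd by blast
  qed
  from this[of "Suc (degree F)" F] show ?thesis
    using HF gen.subspace_0[OF J] by (simp add: coeff_eq_0)
qed

text \<open>A weakly regular sequence modulo the ideal of \<open>B\<close>: the quotient may be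
  zero, so no properness has to be carried through the induction.\<close>

definition regular_mod :: "'a::comm_ring_1 set \<Rightarrow> (nat \<Rightarrow> 'a) \<Rightarrow> nat \<Rightarrow> bool" where
  "regular_mod B a m \<longleftrightarrow> (\<forall>i<m. \<forall>f. a i * f \<in> ideal_span (B \<union> a ` {..<i}) \<longrightarrow>
     f \<in> ideal_span (B \<union> a ` {..<i}))"

lemma regular_modD:
  "regular_mod B a m \<Longrightarrow> i < m \<Longrightarrow> a i * f \<in> ideal_span (B \<union> a ` {..<i}) \<Longrightarrow>
    f \<in> ideal_span (B \<union> a ` {..<i})"
  unfolding regular_mod_def by blast

text \<open>Moves h to the front of the sequence. If a_i f = w h modulo the earlier generators, then
  h w vanishes modulo a_0, ..., a_i, hence w = w' a_i by regularity of h; cancelling a_i gives f =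
  w' h.\<close>

lemma regular_mod_insert:
  assumes reg: "regular_mod B a (Suc m)"
    and h: "\<And>i f. i \<le> m \<Longrightarrow> h * f \<in> ideal_span (B \<union> a ` {..<i}) \<Longrightarrow> f \<in> ideal_span (B \<union> a ` {..<i})"
  shows "regular_mod (insert h B) a m"
  unfolding regular_mod_def
proof (intro allI impI)
  fix i f assume i: "i < m"
  let ?I = "\<lambda>i. ideal_span (B \<union> a ` {..<i})"
  have ins: "insert h B \<union> a ` {..<i} = insert h (B \<union> a ` {..<i})"
    and suc: "B \<union> a ` {..<Suc i} = insert (a i) (B \<union> a ` {..<i})"
    by (auto simp: lessThan_Suc)
  assume "a i * f \<in> ideal_span (insert h B \<union> a ` {..<i})"
  then obtain w where w: "a i * f - w * h \<in> ?I i"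
    unfolding ins gen.span_breakdown_eq by blast
  then have "- (a i * f - w * h) \<in> ?I i" by (rule gen.span_neg)
  then have "h * w - f * a i \<in> ?I i" by (simp add: algebra_simps)
  then have "h * w \<in> ?I (Suc i)"
    unfolding suc gen.span_breakdown_eq by blast
  then have "w \<in> ?I (Suc i)" by (rule h[OF Suc_leI[OF i]])
  then obtain w' where w': "w - w' * a i \<in> ?I i"
    unfolding suc gen.span_breakdown_eq by blast
  have "a i * (f - w' * h) = (a i * f - w * h) + h * (w - w' * a i)"
    by (simp add: algebra_simps)
  also have "\<dots> \<in> ?I i" by (rule gen.span_add[OF w gen.span_scale[OF w']])
  finally have "f - w' * h \<in> ?I i" by (rule regular_modD[OF reg less_SucI[OF i]])
  then show "f \<in> ideal_span (insert h B \<union> a ` {..<i})"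
    unfolding ins gen.span_breakdown_eq by blast
qed

text \<open>Cramer's rule. With the last row of A replaced by r, the matrix M sends g to a vector
  whose entries are in J except the last, which is the sum of the r_j g_j; multiplying by the
  adjugate of M isolates det M g_k.\<close>

lemma cofactor_expansion_mult:
  fixes A :: "'a::comm_ring_1 mat"
  assumes A: "A \<in> carrier_mat (Suc m) (Suc m)" and J: "is_ideal J"
    and rows: "\<And>i. i < m \<Longrightarrow> (\<Sum>j<Suc m. A $$ (i, j) * g j) \<in> J"
    and k: "k < Suc m"
  shows "(\<Sum>j<Suc m. r j * cofactor A m j) * g k - cofactor A m k * (\<Sum>j<Suc m. r j * g j) \<in> J"
proof -
  define M where "M = mat (Suc m) (Suc m) (\<lambda>(i, j). if i = m then r j else A $$ (i, j))"
  have M: "M \<in> carrier_mat (Suc m) (Suc m)" by (simp add: M_def)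
  have del: "mat_delete M m j = mat_delete A m j" for j
    by (rule eq_matI) (use A in \<open>auto simp: mat_delete_def M_def\<close>)
  then have cof: "cofactor M m j = cofactor A m j" for j by (simp add: cofactor_def)
  have det: "det M = (\<Sum>j<Suc m. r j * cofactor A m j)"
    unfolding laplace_expansion_row[OF M lessI] by (intro sum.cong refl) (simp add: cof, simp add: M_def)
  have adj: "(\<Sum>i<Suc m. cofactor M i k * M $$ (i, j)) = (if k = j then det M else 0)"
    if j: "j < Suc m" for j
  proof -
    have "(adj_mat M * M) $$ (k, j) = (\<Sum>i<Suc m. cofactor M i k * M $$ (i, j))"
      using M k j by (simp add: adj_mat_def scalar_prod_def atLeast0LessThan del: sum.lessThan_Suc)
    then show ?thesis using adj_mat(3)[OF M] k j by (simp del: sum.lessThan_Suc split: if_splits)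
  qed
  have "det M * g k = (\<Sum>j<Suc m. (if k = j then det M else 0) * g j)"
    using k by (simp add: if_distrib[where f = "\<lambda>x. x * _"] sum.delta del: sum.lessThan_Suc cong: if_cong)
  also have "\<dots> = (\<Sum>j<Suc m. (\<Sum>i<Suc m. cofactor M i k * M $$ (i, j)) * g j)"
    by (intro sum.cong refl) (simp only: adj lessThan_iff)
  also have "\<dots> = (\<Sum>j<Suc m. \<Sum>i<Suc m. cofactor M i k * (M $$ (i, j) * g j))"
    by (simp only: sum_distrib_right mult.assoc)
  also have "\<dots> = (\<Sum>i<Suc m. cofactor M i k * (\<Sum>j<Suc m. M $$ (i, j) * g j))"
    by (subst sum.swap) (simp only: sum_distrib_left)
  also have "\<dots> = (\<Sum>i<m. cofactor M i k * (\<Sum>j<Suc m. M $$ (i, j) * g j))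
      + cofactor M m k * (\<Sum>j<Suc m. M $$ (m, j) * g j)"
    by (rule sum.lessThan_Suc)
  also have "(\<Sum>j<Suc m. M $$ (m, j) * g j) = (\<Sum>j<Suc m. r j * g j)"
    by (intro sum.cong refl) (simp add: M_def)
  finally have "det M * g k - cofactor A m k * (\<Sum>j<Suc m. r j * g j)
      = (\<Sum>i<m. cofactor M i k * (\<Sum>j<Suc m. M $$ (i, j) * g j))"
    by (simp only: cof) simp
  also have "\<dots> \<in> J"
  proof (rule gen.subspace_sum[OF J], rule ideal_mult_left[OF J])
    fix i assume "i \<in> {..<m}"
    then have "(\<Sum>j<Suc m. M $$ (i, j) * g j) = (\<Sum>j<Suc m. A $$ (i, j) * g j)"
      by (intro sum.cong refl) (simp add: M_def)
    then show "(\<Sum>j<Suc m. M $$ (i, j) * g j) \<in> J" using rows \<open>i \<in> {..<m}\<close> by simp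
  qed
  finally show ?thesis by (simp only: det)
qed

text \<open>Cramer's rule summed with weights s_k: modulo J, the determinants with last rows r and s
  are in the same ratio as the two combinations of g. This exchanges the last row of A for another
  one.\<close>

lemma cofactor_expansion_swap:
  fixes A :: "'a::comm_ring_1 mat"
  assumes A: "A \<in> carrier_mat (Suc m) (Suc m)" and J: "is_ideal J"
    and rows: "\<And>i. i < m \<Longrightarrow> (\<Sum>j<Suc m. A $$ (i, j) * g j) \<in> J"
  shows "(\<Sum>j<Suc m. r j * cofactor A m j) * (\<Sum>j<Suc m. s j * g j)
    - (\<Sum>j<Suc m. s j * cofactor A m j) * (\<Sum>j<Suc m. r j * g j) \<in> J"
proof -
  have expand: "D * (\<Sum>j<Suc m. s j * g j) - (\<Sum>j<Suc m. s j * cofactor A m j) * G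
      = (\<Sum>k<Suc m. s k * (D * g k - cofactor A m k * G))" for D G
    by (simp add: sum_distrib_left sum_distrib_right sum_subtractf algebra_simps del: sum.lessThan_Suc)
  have "(\<Sum>j<Suc m. r j * cofactor A m j) * (\<Sum>j<Suc m. s j * g j)
      - (\<Sum>j<Suc m. s j * cofactor A m j) * (\<Sum>j<Suc m. r j * g j)
    = (\<Sum>k<Suc m. s k * ((\<Sum>j<Suc m. r j * cofactor A m j) * g k
        - cofactor A m k * (\<Sum>j<Suc m. r j * g j)))"
    by (rule expand)
  also have "\<dots> \<in> J"
    by (intro gen.subspace_sum[OF J] ideal_mult_left[OF J] cofactor_expansion_mult[OF A J rows]) auto
  finally show ?thesis .
qed

text \<open>The pivot r_m = 1 clears the rest of the new last row by column operations, and
  expansion along that row leaves an m by m determinant.\<close>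

lemma cofactor_expansion_eliminate:
  fixes A :: "'a::comm_ring_1 mat"
  assumes A: "A \<in> carrier_mat (Suc m) (Suc m)" and r: "r m = 1"
  shows "(\<Sum>j<Suc m. r j * cofactor A m j) = det (mat m m (\<lambda>(i, j). A $$ (i, j) - r j * A $$ (i, m)))"
proof -
  define M where "M = mat (Suc m) (Suc m) (\<lambda>(i, j). if i = m then r j else A $$ (i, j))"
  \<comment> \<open>Right multiplication by E subtracts r_j times the last column from column j < m;
    E is unitriangular, so the determinant does not change.\<close>
  define E where "E = mat (Suc m) (Suc m) (\<lambda>(i, j). if i = j then 1 else if i = m then - r j else 0 :: 'a)"
  have M: "M \<in> carrier_mat (Suc m) (Suc m)" and E: "E \<in> carrier_mat (Suc m) (Suc m)"
    by (simp_all add: M_def E_def)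
  have del: "mat_delete M m j = mat_delete A m j" for j
    by (rule eq_matI) (use A in \<open>auto simp: mat_delete_def M_def\<close>)
  have last: "M $$ (m, j) = r j" if "j < Suc m" for j
    using that by (simp add: M_def)
  have entry: "(M * E) $$ (i, j) = (if j = m then M $$ (i, m) else M $$ (i, j) - r j * M $$ (i, m))"
    if "i < Suc m" "j < Suc m" for i j
  proof -
    have "(M * E) $$ (i, j) = (\<Sum>k<Suc m. M $$ (i, k) * E $$ (k, j))"
      using that M E by (simp add: scalar_prod_def atLeast0LessThan del: sum.lessThan_Suc)
    also have "\<dots> = (\<Sum>k<m. if k = j then M $$ (i, k) else 0) + M $$ (i, m) * E $$ (m, j)"
      unfolding sum.lessThan_Suc
      by (intro arg_cong2[of _ _ _ _ "(+)"] sum.cong refl) (use that in \<open>auto simp: E_def\<close>)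
    finally show ?thesis using that by (auto simp: E_def)
  qed
  have "(\<Sum>j<Suc m. r j * cofactor A m j) = det M"
    unfolding laplace_expansion_row[OF M lessI]
    by (intro sum.cong refl) (simp add: cofactor_def del, simp add: M_def)
  also have "\<dots> = det (M * E)"
  proof -
    have "det E = prod_list (diag_mat E)"
      by (rule det_lower_triangular[OF _ E]) (auto simp: E_def)
    also have "diag_mat E = replicate (Suc m) 1"
      by (rule nth_equalityI) (auto simp: diag_mat_def E_def nth_append simp del: replicate_Suc upt_Suc)
    finally show ?thesis by (simp add: det_mult[OF M E])
  qed
  also have "\<dots> = (\<Sum>j<Suc m. (M * E) $$ (m, j) * cofactor (M * E) m j)"
    by (rule laplace_expansion_row) (use M E in auto)
  also have "\<dots> = cofactor (M * E) m m"
  proof -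
    have "(\<Sum>j<m. (M * E) $$ (m, j) * cofactor (M * E) m j) = 0"
      by (intro sum.neutral) (auto simp: entry last r)
    moreover have "(M * E) $$ (m, m) = 1" by (simp add: entry last r)
    ultimately show ?thesis unfolding sum.lessThan_Suc by simp
  qed
  also have "\<dots> = det (mat m m (\<lambda>(i, j). A $$ (i, j) - r j * A $$ (i, m)))"
  proof -
    have "mat_delete (M * E) m m = mat m m (\<lambda>(i, j). A $$ (i, j) - r j * A $$ (i, m))"
      by (rule eq_matI) (use M E in \<open>auto simp: mat_delete_def entry simp del: index_mult_mat(1)\<close>, auto simp: M_def)
    then show ?thesis by (simp add: cofactor_def)
  qed
  finally show ?thesis .
qed

section \<open>Integer polynomials in a fresh variable\<close>

definition vars :: "zpoly \<Rightarrow> nat set" where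
  "vars P = (\<Union>m\<in>Poly_Mapping.keys P. Poly_Mapping.keys m)"

lemma vars_xvar [simp]: "vars (xvar k) = {k}"
  by (simp add: vars_def xvar_def)

lemma vars_add: "vars (P + Q) \<subseteq> vars P \<union> vars Q"
  unfolding vars_def using Poly_Mapping.keys_add by fastforce

lemma vars_mult: "vars (P * Q) \<subseteq> vars P \<union> vars Q"
proof
  fix k assume "k \<in> vars (P * Q)"
  then obtain m where m: "m \<in> Poly_Mapping.keys (P * Q)" "k \<in> Poly_Mapping.keys m"
    by (auto simp: vars_def)
  from m(1) keys_mult obtain a b where "m = a + b" "a \<in> Poly_Mapping.keys P" "b \<in> Poly_Mapping.keys Q"
    by blast
  with m(2) Poly_Mapping.keys_add[of a b] show "k \<in> vars P \<union> vars Q"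
    unfolding vars_def by blast
qed

lemma vars_zero [simp]: "vars 0 = {}" and vars_const [simp]: "vars (Poly_Mapping.single 0 c) = {}"
  and vars_one [simp]: "vars 1 = {}"
  by (auto simp: vars_def)

lemma vars_sum: "vars (sum f I) \<subseteq> (\<Union>i\<in>I. vars (f i))"
proof (induction I rule: infinite_finite_induct)
  case (insert i I)
  then show ?case using vars_add[of "f i" "sum f I"] by auto
qed auto

lemma vars_power: "vars (P ^ e) \<subseteq> vars P"
proof (induction e)
  case (Suc e)
  then show ?case using vars_mult[of P "P ^ e"] by auto
qed auto

lemma finite_vars: "finite (vars P)"
  by (simp add: vars_def)

lemma xvar_power: "xvar k ^ e = Poly_Mapping.single (Poly_Mapping.single k e) 1"
  by (induction e) (simp_all add: xvar_def mult_single single_add[symmetric])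

lemma single_eq_mult_mpow: "(Poly_Mapping.single m c :: zpoly) = Poly_Mapping.single 0 c * mpow xvar m"
proof -
  have prod: "(\<Prod>k\<in>I. Poly_Mapping.single (f k) (1::int)) = Poly_Mapping.single (\<Sum>k\<in>I. f k) 1"
    for f :: "nat \<Rightarrow> nat \<Rightarrow>\<^sub>0 nat" and I
    by (induction I rule: infinite_finite_induct) (simp_all add: mult_single)
  have "(\<Sum>k\<in>Poly_Mapping.keys m. Poly_Mapping.single k (Poly_Mapping.lookup m k)) = m"
    by (rule poly_mapping_eqI) (auto simp: lookup_sum lookup_single when_def in_keys_iff)
  then have "mpow xvar m = Poly_Mapping.single m 1"
    by (simp add: mpow_def xvar_power prod)
  then show ?thesis by (simp add: mult_single)
qed

text \<open>Polynomials in the variables V form the subring generated by the constants and these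
  variables, so identities between ring maps may be checked on generators.\<close>

lemma zpoly_vars_induct [consumes 1, case_names const xvar add mult]:
  assumes "vars P \<subseteq> V"
    and const: "\<And>c. Q (Poly_Mapping.single 0 c)"
    and xvar: "\<And>k. k \<in> V \<Longrightarrow> Q (xvar k)"
    and add: "\<And>P P'. Q P \<Longrightarrow> Q P' \<Longrightarrow> Q (P + P')"
    and mult: "\<And>P P'. Q P \<Longrightarrow> Q P' \<Longrightarrow> Q (P * P')"
  shows "Q P"
proof -
  have one: "Q 1" using const[of 1] by simp
  have zero: "Q 0" using const[of 0] by simp
  have pow: "Q (P ^ e)" if "Q P" for P e
    by (induction e) (use one mult that in auto)
  have prod: "Q (prod f I)" if "\<And>i. i \<in> I \<Longrightarrow> Q (f i)" for f and I :: "nat set"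
    using that by (induction I rule: infinite_finite_induct) (use one mult in auto)
  have sum: "Q (sum f I)" if "\<And>i. i \<in> I \<Longrightarrow> Q (f i)" for f and I :: "(nat \<Rightarrow>\<^sub>0 nat) set"
    using that by (induction I rule: infinite_finite_induct) (use zero add in auto)
  have "Q (\<Sum>m\<in>Poly_Mapping.keys P. Poly_Mapping.single m (Poly_Mapping.lookup P m))"
  proof (rule sum)
    fix m assume "m \<in> Poly_Mapping.keys P"
    then have "Poly_Mapping.keys m \<subseteq> V" using assms(1) by (auto simp: vars_def)
    then show "Q (Poly_Mapping.single m (Poly_Mapping.lookup P m))"
      unfolding single_eq_mult_mpow[of m] mpow_def by (intro mult const prod pow xvar) auto
  qed
  then show ?thesis using zpoly_eq_sum[of P] by simp
qed

lemmas zpoly_induct = zpoly_vars_induct[where V = UNIV, OF subset_UNIV, case_names const xvar add mult]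

section \<open>Evaluation, and integer polynomials as univariate polynomials in one variable\<close>

definition zeval :: "(nat \<Rightarrow> 'b::comm_ring_1) \<Rightarrow> zpoly \<Rightarrow> 'b" where
  "zeval s P = (\<Sum>m\<in>Poly_Mapping.keys P. of_int (Poly_Mapping.lookup P m) *
     (\<Prod>k\<in>Poly_Mapping.keys m. s k ^ Poly_Mapping.lookup m k))"

context
  fixes s :: "nat \<Rightarrow> 'b::comm_ring_1"
begin

definition zpow :: "(nat \<Rightarrow>\<^sub>0 nat) \<Rightarrow> 'b" where
  "zpow m = (\<Prod>k\<in>Poly_Mapping.keys m. s k ^ Poly_Mapping.lookup m k)"

lemma zpow_superset:
  "finite A \<Longrightarrow> Poly_Mapping.keys m \<subseteq> A \<Longrightarrow> zpow m = (\<Prod>k\<in>A. s k ^ Poly_Mapping.lookup m k)"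
  unfolding zpow_def by (rule prod.mono_neutral_left) (auto simp: in_keys_iff)

lemma zpow_add: "zpow (m + m') = zpow m * zpow m'"
proof -
  let ?A = "Poly_Mapping.keys m \<union> Poly_Mapping.keys m'"
  have "Poly_Mapping.keys (m + m') \<subseteq> ?A" by (rule Poly_Mapping.keys_add)
  then show ?thesis
    by (simp add: zpow_superset[of ?A] lookup_add power_add prod.distrib)
qed

lemma zeval_superset:
  assumes "finite A" "Poly_Mapping.keys P \<subseteq> A"
  shows "zeval s P = (\<Sum>m\<in>A. of_int (Poly_Mapping.lookup P m) * zpow m)"
  unfolding zeval_def zpow_def[symmetric]
  by (rule sum.mono_neutral_left) (use assms in \<open>auto simp: in_keys_iff\<close>)

lemma zeval_add: "zeval s (P + Q) = zeval s P + zeval s Q"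
proof -
  let ?A = "Poly_Mapping.keys P \<union> Poly_Mapping.keys Q"
  have "Poly_Mapping.keys (P + Q) \<subseteq> ?A" by (rule Poly_Mapping.keys_add)
  then show ?thesis
    by (simp add: zeval_superset[of ?A] lookup_add distrib_right sum.distrib)
qed

lemma zeval_single: "zeval s (Poly_Mapping.single m c) = of_int c * zpow m"
  by (simp add: zeval_superset[of "{m}"])

lemma zeval_sum: "zeval s (sum f A) = (\<Sum>a\<in>A. zeval s (f a))"
proof -
  have "zeval s 0 = 0" by (simp add: zeval_def)
  then show ?thesis by (induction A rule: infinite_finite_induct) (auto simp: zeval_add)
qed

lemma zeval_mult: "zeval s (P * Q) = zeval s P * zeval s Q"
proof -
  define t where "t R m = Poly_Mapping.single m (Poly_Mapping.lookup R m)" for R :: zpoly and m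
  have single: "zeval s (t R m * t R' m') = zeval s (t R m) * zeval s (t R' m')" for R R' m m'
    by (simp add: t_def mult_single zeval_single zpow_add mult_ac)
  have P: "P = (\<Sum>m\<in>Poly_Mapping.keys P. t P m)" and Q: "Q = (\<Sum>m\<in>Poly_Mapping.keys Q. t Q m)"
    unfolding t_def by (rule zpoly_eq_sum)+
  have "zeval s (P * Q) =
      zeval s ((\<Sum>m\<in>Poly_Mapping.keys P. t P m) * (\<Sum>m\<in>Poly_Mapping.keys Q. t Q m))"
    using P Q by simp
  also have "\<dots> = zeval s (\<Sum>m\<in>Poly_Mapping.keys P. t P m) * zeval s (\<Sum>m\<in>Poly_Mapping.keys Q. t Q m)"
    by (simp only: sum_product zeval_sum single)
  also have "\<dots> = zeval s P * zeval s Q"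
    using P Q by simp
  finally show ?thesis .
qed

lemma zeval_const: "zeval s (Poly_Mapping.single 0 c) = of_int c"
  by (simp add: zeval_single zpow_def)

lemma zeval_xvar: "zeval s (xvar k) = s k"
  by (simp add: xvar_def zeval_single zpow_def)

end

lemma of_int_zpoly: "(of_int c :: zpoly) = Poly_Mapping.single 0 c"
proof (induction c)
  case (nonneg n)
  then show ?case by simp
next
  case (neg n)
  then show ?case
    by (simp only: of_int_minus of_int_of_nat_eq single_uminus single_of_nat)
qed

text \<open>Collects P by powers of x_v. The coefficients have type \<open>zpoly\<close> again, and
  nothing in the type says that x_v is absent from them; hence the assumptions on variables in the
  lemmas below.\<close>

definition upoly :: "nat \<Rightarrow> zpoly \<Rightarrow> zpoly poly" where
  "upoly v = zeval (\<lambda>k. if k = v then [:0, 1:] else [:xvar k:])"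

lemma of_int_poly_const: "(of_int c :: 'a::comm_ring_1 poly) = [:of_int c:]"
  by (simp add: of_int_poly)

lemma poly_upoly: "poly (upoly v P) (xvar v) = P"
proof (induction P rule: zpoly_induct)
  case (const c)
  then show ?case by (simp add: upoly_def zeval_const of_int_poly_const of_int_zpoly)
qed (simp_all add: upoly_def zeval_xvar zeval_add zeval_mult)

lemma upoly_free:
  assumes "vars P \<subseteq> V" "v \<notin> V"
  shows "upoly v P = [:P:]"
  using assms(1)
proof (induction P rule: zpoly_vars_induct)
  case (const c)
  then show ?case by (simp add: upoly_def zeval_const of_int_poly_const of_int_zpoly)
next
  case (xvar k)
  then show ?case using assms(2) by (auto simp: upoly_def zeval_xvar)
qed (simp_all add: upoly_def zeval_add zeval_mult)

lemma upoly_poly: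
  assumes "\<And>l. vars (coeff H l) \<subseteq> V" "v \<notin> V"
  shows "upoly v (poly H (xvar v)) = H"
proof -
  have hom: "upoly v (P + Q) = upoly v P + upoly v Q" "upoly v (P * Q) = upoly v P * upoly v Q" for P Q
    by (simp_all add: upoly_def zeval_add zeval_mult)
  have x: "upoly v (xvar v) = [:0, 1:]" by (simp add: upoly_def zeval_xvar)
  show ?thesis using assms(1)
  proof (induction H)
    case 0
    then show ?case using upoly_free[of 0 "{}" v] by simp
  next
    case (pCons a H)
    have "vars (coeff H l) \<subseteq> V" for l using pCons.prems[of "Suc l"] by simp
    then have "upoly v (poly H (xvar v)) = H" by (rule pCons.IH)
    moreover have "upoly v a = [:a:]" using upoly_free[OF _ assms(2)] pCons.prems[of 0] by simp
    ultimately show ?case by (simp add: hom x)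
  qed
qed

text \<open>Generators free of x_v become constants, so an ideal generated by them is stable under
  taking coefficients with respect to x_v.\<close>

lemma coeff_upoly_in_span:
  assumes "\<And>b. b \<in> B \<Longrightarrow> vars b \<subseteq> V" "v \<notin> V" "F \<in> ideal_span B"
  shows "coeff (upoly v F) i \<in> ideal_span B"
  using assms(3)
proof (induction arbitrary: i rule: gen.span_induct_alt)
  case base
  then show ?case using upoly_free[of 0 "{}" v] gen.span_zero by simp
next
  case (step c b F)
  have "upoly v b = [:b:]" using upoly_free[OF _ assms(2)] assms(1) step by blast
  then have "upoly v (c * b + F) = upoly v c * [:b:] + upoly v F"
    by (simp add: upoly_def zeval_add zeval_mult)
  then have "coeff (upoly v (c * b + F)) i = coeff (upoly v c) i * b + coeff (upoly v F) i"
    by (simp add: mult.commute)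
  then show ?case
    using gen.span_add[OF gen.span_scale[OF gen.span_base[OF step(1)]] step(2)] by simp
qed

lemma poly_in_ideal:
  assumes "is_ideal J" "\<And>i. coeff F i \<in> J"
  shows "poly F x \<in> J"
  unfolding poly_altdef by (intro gen.subspace_sum[OF assms(1)] ideal_mult_right[OF assms(1)] assms(2))

text \<open>Since x_v is fresh for \<open>B\<close> and for H, membership in the ideal is
  coefficientwise in x_v, and H(x_v) behaves like a polynomial over the quotient ring: by McCoy it
  is regular once no nonzero class kills all its coefficients.\<close>

lemma fresh_combination_regular:
  assumes B: "\<And>b. b \<in> B \<Longrightarrow> vars b \<subseteq> V" and v: "v \<notin> V"
    and H: "\<And>l. vars (coeff H l) \<subseteq> V"
    and nzd: "\<And>c. (\<forall>l. coeff H l * c \<in> ideal_span B) \<Longrightarrow> c \<in> ideal_span B"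
    and f: "poly H (xvar v) * f \<in> ideal_span B"
  shows "f \<in> ideal_span B"
proof -
  have "upoly v (poly H (xvar v) * f) = H * upoly v f"
    using upoly_poly[OF H v] by (simp add: upoly_def zeval_mult)
  then have "\<forall>i. coeff (H * upoly v f) i \<in> ideal_span B"
    using coeff_upoly_in_span[OF B v f] by simp
  then have "coeff (upoly v f) i \<in> ideal_span B" for i
    using coeffs_mult_in_ideal_cancel[OF gen.subspace_span nzd] by blast
  then show ?thesis using poly_in_ideal[OF gen.subspace_span] poly_upoly[of v f] by metis
qed

text \<open>The last \<open>a\<close> is traded for a combination \<open>h\<close> of the \<open>g\<close> with powers of a fresh variable as
  coefficients: \<open>h\<close> is again regular by McCoy, and eliminating the last \<open>g\<close> by means of \<open>h\<close> reduces
  the size.\<close>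

lemma det_colon_regular:
  fixes A :: "zpoly mat"
  assumes "finite V" "\<And>b. b \<in> B \<Longrightarrow> vars b \<subseteq> V"
    and "\<And>i. i < m \<Longrightarrow> vars (a i) \<subseteq> V" "\<And>i. i < m \<Longrightarrow> vars (g i) \<subseteq> V"
    and "regular_mod B a m" "A \<in> carrier_mat m m"
    and "\<And>i. i < m \<Longrightarrow> a i - (\<Sum>j<m. A $$ (i, j) * g j) \<in> ideal_span B"
    and "u * det A \<in> ideal_span (B \<union> a ` {..<m})"
  shows "u \<in> ideal_span (B \<union> g ` {..<m})"
  using assms
proof (induction m arbitrary: B V A)
  case 0
  then show ?case by simp
next
  case (Suc m)
  note V = \<open>finite V\<close> and B = Suc.prems(2) and va = Suc.prems(3) and vg = Suc.prems(4)
    and reg = Suc.prems(5) and A = Suc.prems(6) and aA = Suc.prems(7) and u = Suc.prems(8)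
  obtain v where v: "v \<notin> V" using V ex_new_if_finite infinite_UNIV_nat by blast
  \<comment> \<open>The exponents are distinct, so the g_j are exactly the coefficients of h as a
    polynomial in x_v, and r_m = 1 is the pivot for the elimination.\<close>
  define r where "r j = xvar v ^ (m - j)" for j
  define H where "H = (\<Sum>j<Suc m. Polynomial.monom (g j) (m - j))"
  define h where "h = (\<Sum>j<Suc m. r j * g j)"
  define J where "J = ideal_span (B \<union> a ` {..<m})"
  have J: "is_ideal J" by (simp add: J_def)
  have BJ: "x \<in> J" if "x \<in> ideal_span B" for x
    using that gen.span_mono[of B "B \<union> a ` {..<m}"] unfolding J_def by blast
  have h_poly: "h = poly H (xvar v)"
    unfolding h_def H_def r_def poly_sum poly_monom by (simp add: mult.commute)
  have coeff_H: "coeff H l = (if l \<le> m then g (m - l) else 0)" for l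
  proof -
    have "coeff H l = (\<Sum>j<Suc m. if j = m - l \<and> l \<le> m then g j else 0)"
      unfolding H_def coeff_sum by (intro sum.cong refl) auto
    also have "\<dots> = (if l \<le> m then g (m - l) else 0)"
      by (cases "l \<le> m") (auto simp del: sum.lessThan_Suc)
    finally show ?thesis .
  qed
  have h_reg: "f \<in> ideal_span (B \<union> a ` {..<i})" if i: "i \<le> m" and f: "h * f \<in> ideal_span (B \<union> a ` {..<i})"
    for i f
  proof (rule fresh_combination_regular[OF _ v _ _ f[unfolded h_poly]])
    show "vars b \<subseteq> V" if "b \<in> B \<union> a ` {..<i}" for b
      using that
    proof
      assume "b \<in> a ` {..<i}"
      then obtain k where "b = a k" "k < i" by blast
      then show ?thesis using va[of k] i by simp
    qed (rule B)
    show "vars (coeff H l) \<subseteq> V" for l using vg[of "m - l"] by (simp add: coeff_H)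
    fix c assume c: "\<forall>l. coeff H l * c \<in> ideal_span (B \<union> a ` {..<i})"
    have gc: "g j * c \<in> ideal_span (B \<union> a ` {..<i})" if "j < Suc m" for j
      using c[rule_format, of "m - j"] that by (simp add: coeff_H)
    \<comment> \<open>Whatever kills all g_j kills a_i modulo \<open>B\<close> and the earlier a,
      since a_i is a combination of the g_j modulo \<open>B\<close>; regularity of a_i then yields
      McCoy's condition.\<close>
    have "a i * c = c * (a i - (\<Sum>j<Suc m. A $$ (i, j) * g j)) + (\<Sum>j<Suc m. A $$ (i, j) * (g j * c))"
      by (simp add: algebra_simps sum_distrib_left del: sum.lessThan_Suc)
    also have "\<dots> \<in> ideal_span (B \<union> a ` {..<i})"
    proof (rule gen.span_add)
      show "c * (a i - (\<Sum>j<Suc m. A $$ (i, j) * g j)) \<in> ideal_span (B \<union> a ` {..<i})"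
        using aA[of i] i gen.span_mono[of B "B \<union> a ` {..<i}"] by (intro gen.span_scale) auto
      show "(\<Sum>j<Suc m. A $$ (i, j) * (g j * c)) \<in> ideal_span (B \<union> a ` {..<i})"
        by (rule gen.span_sum, rule gen.span_scale) (use gc in auto)
    qed
    finally show "c \<in> ideal_span (B \<union> a ` {..<i})"
      by (rule regular_modD[OF reg le_imp_less_Suc[OF i]])
  qed
  define D where "D q = (\<Sum>j<Suc m. q j * cofactor A m j)" for q
  define G where "G q = (\<Sum>j<Suc m. q j * g j)" for q
  define s where "s j = A $$ (m, j)" for j
  have rows: "(\<Sum>j<Suc m. A $$ (i, j) * g j) \<in> J" if "i < m" for i
  proof -
    have "a i \<in> J" unfolding J_def using that by (intro gen.span_base) auto
    from gen.subspace_diff[OF J this BJ[OF aA[of i]]] that show ?thesis by simp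
  qed
  have "D r * G s - D s * G r \<in> J"
    unfolding D_def G_def by (rule cofactor_expansion_swap[OF A J rows])
  then have swap: "D r * G s - D s * h \<in> J" by (simp add: G_def h_def del: sum.lessThan_Suc)
  have det: "det A = D s" unfolding D_def s_def by (rule laplace_expansion_row[OF A]) simp
  have "B \<union> a ` {..<Suc m} = insert (a m) (B \<union> a ` {..<m})" by (auto simp: lessThan_Suc)
  with u obtain b where b: "u * D s - b * a m \<in> J"
    unfolding det J_def by (metis gen.span_breakdown_eq)
  have am: "a m - G s \<in> J" using BJ[OF aA[of m]] by (simp add: G_def s_def del: sum.lessThan_Suc)
  \<comment> \<open>Modulo J one has a_m = G s and D r G s = D s h, while u D s = b a_m by
    assumption; all three differences appear on the right.\<close>
  have "a m * (u * D r - b * h) = u * D r * (a m - G s) + u * (D r * G s - D s * h) + h * (u * D s - b * a m)"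
    by (simp add: algebra_simps)
  also have "\<dots> \<in> J"
    using am swap b by (intro gen.subspace_add[OF J] ideal_mult_left[OF J])
  finally have "u * D r - b * h \<in> J"
    unfolding J_def by (rule regular_modD[OF reg lessI])
  then have uD: "u * D r \<in> ideal_span (insert h B \<union> a ` {..<m})"
    unfolding J_def Un_insert_left gen.span_breakdown_eq by blast
  define A' where "A' = mat m m (\<lambda>(i, j). A $$ (i, j) - r j * A $$ (i, m))"
  have rm: "r m = 1" by (simp add: r_def)
  have det': "D r = det A'"
    unfolding D_def A'_def by (rule cofactor_expansion_eliminate[where r = r, OF A rm])
  have "u \<in> ideal_span (insert h B \<union> g ` {..<m})"
  proof (rule Suc.IH[where V = "insert v V" and A = A'])
    show "finite (insert v V)" using V by simp
    show "vars b \<subseteq> insert v V" if "b \<in> insert h B" for b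
    proof (cases "b = h")
      case True
      have "vars (r j * g j) \<subseteq> insert v V" if "j < Suc m" for j
        using vars_mult[of "r j" "g j"] vars_power[of "xvar v" "m - j"] vg[OF that]
        unfolding r_def by auto
      then show ?thesis
        using vars_sum[of "\<lambda>j. r j * g j" "{..<Suc m}"] unfolding True h_def by blast
    qed (use that B in auto)
    show "vars (a i) \<subseteq> insert v V" "vars (g i) \<subseteq> insert v V" if "i < m" for i
      using that va[of i] vg[of i] by auto
    show "regular_mod (insert h B) a m" by (rule regular_mod_insert[OF reg h_reg])
    show "A' \<in> carrier_mat m m" by (simp add: A'_def)
    show "a i - (\<Sum>j<m. A' $$ (i, j) * g j) \<in> ideal_span (insert h B)" if i: "i < m" for i
    proof -
      have "(\<Sum>j<m. A' $$ (i, j) * g j) = (\<Sum>j<m. (A $$ (i, j) - r j * A $$ (i, m)) * g j)"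
        using i by (intro sum.cong refl) (simp add: A'_def)
      \<comment> \<open>The summand j = m vanishes because r_m = 1: subtracting A_im h has
        eliminated g_m.\<close>
      also have "\<dots> = (\<Sum>j<Suc m. (A $$ (i, j) - r j * A $$ (i, m)) * g j)"
        by (simp add: rm)
      also have "\<dots> = (\<Sum>j<Suc m. A $$ (i, j) * g j) - A $$ (i, m) * h"
        unfolding h_def by (simp add: algebra_simps sum_subtractf sum_distrib_left del: sum.lessThan_Suc)
      finally have "a i - (\<Sum>j<m. A' $$ (i, j) * g j) - A $$ (i, m) * h
          = a i - (\<Sum>j<Suc m. A $$ (i, j) * g j)"
        by simp
      also have "\<dots> \<in> ideal_span B" using aA[of i] i by simp
      finally show ?thesis unfolding gen.span_breakdown_eq by blast
    qed
    show "u * det A' \<in> ideal_span (insert h B \<union> a ` {..<m})" using uD by (simp add: det')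
  qed
  \<comment> \<open>h is a combination of g_0, ..., g_m, so the ideal reached by the induction is
    contained in the wanted one.\<close>
  moreover have "h \<in> ideal_span (B \<union> g ` {..<Suc m})"
    unfolding h_def by (rule gen.span_sum, rule gen.span_scale, rule gen.span_base) auto
  then have "insert h B \<union> g ` {..<m} \<subseteq> ideal_span (B \<union> g ` {..<Suc m})"
    using gen.span_superset[of "B \<union> g ` {..<Suc m}"] by auto
  then have "ideal_span (insert h B \<union> g ` {..<m}) \<subseteq> ideal_span (B \<union> g ` {..<Suc m})"
    by (rule gen.span_minimal) simp
  ultimately show ?case by blast
qed

section \<open>Gradings and the Macaulay bound\<close>

lemma span_Un_image_lessThan:
  fixes g :: "nat \<Rightarrow> 'a::comm_ring_1"
  assumes "y \<in> ideal_span (B \<union> g ` {..<m})"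
  shows "\<exists>c. y - (\<Sum>j<m. c j * g j) \<in> ideal_span B"
  using assms
proof (induction m arbitrary: y)
  case (Suc m)
  have "B \<union> g ` {..<Suc m} = insert (g m) (B \<union> g ` {..<m})" by (auto simp: lessThan_Suc)
  with Suc.prems obtain k where "y - k * g m \<in> ideal_span (B \<union> g ` {..<m})"
    by (metis gen.span_breakdown_eq)
  then obtain c where "y - k * g m - (\<Sum>j<m. c j * g j) \<in> ideal_span B" using Suc.IH by blast
  then have "y - (\<Sum>j<Suc m. (c(m := k)) j * g j) \<in> ideal_span B" by (simp add: algebra_simps)
  then show ?case by blast
qed simp

section \<open>Homogeneous components with respect to a set of variables\<close>

definition wdeg :: "nat set \<Rightarrow> (nat \<Rightarrow>\<^sub>0 nat) \<Rightarrow> nat" where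
  "wdeg V \<alpha> = (\<Sum>k\<in>V. Poly_Mapping.lookup \<alpha> k)"

definition homog :: "nat set \<Rightarrow> nat \<Rightarrow> zpoly \<Rightarrow> bool" where
  "homog V e P \<longleftrightarrow> (\<forall>\<alpha>\<in>Poly_Mapping.keys P. wdeg V \<alpha> = e)"

definition hpart :: "nat set \<Rightarrow> nat \<Rightarrow> zpoly \<Rightarrow> zpoly" where
  "hpart V e P = (\<Sum>\<alpha> | \<alpha> \<in> Poly_Mapping.keys P \<and> wdeg V \<alpha> = e.
     Poly_Mapping.single \<alpha> (Poly_Mapping.lookup P \<alpha>))"

lemma wdeg_add: "wdeg V (\<alpha> + \<beta>) = wdeg V \<alpha> + wdeg V \<beta>"
  by (simp add: wdeg_def lookup_add sum.distrib)

lemma lookup_hpart: "Poly_Mapping.lookup (hpart V e P) \<alpha> = (if wdeg V \<alpha> = e then Poly_Mapping.lookup P \<alpha> else 0)"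
  by (auto simp: hpart_def lookup_sum lookup_single when_def in_keys_iff)

lemma hpart_add: "hpart V e (P + Q) = hpart V e P + hpart V e Q"
  by (rule poly_mapping_eqI) (simp add: lookup_hpart lookup_add)

lemma hpart_zero [simp]: "hpart V e 0 = 0"
  by (rule poly_mapping_eqI) (simp add: lookup_hpart)

lemma hpart_diff: "hpart V e (P - Q) = hpart V e P - hpart V e Q"
  by (rule poly_mapping_eqI) (simp add: lookup_hpart lookup_minus)

lemma hpart_sum: "hpart V e (sum f I) = (\<Sum>i\<in>I. hpart V e (f i))"
  by (induction I rule: infinite_finite_induct) (simp_all add: hpart_add)

lemma homog_hpart: "homog V e (hpart V e P)"
  by (auto simp: homog_def in_keys_iff lookup_hpart split: if_splits)

lemma hpart_homog: "homog V d P \<Longrightarrow> hpart V e P = (if d = e then P else 0)"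
  by (rule poly_mapping_eqI) (auto simp: lookup_hpart homog_def in_keys_iff)

lemma homog_add: "homog V e P \<Longrightarrow> homog V e Q \<Longrightarrow> homog V e (P + Q)"
  unfolding homog_def using Poly_Mapping.keys_add[of P Q] by blast

lemma homog_zero [simp]: "homog V e 0"
  by (simp add: homog_def)

lemma homog_sum: "(\<And>i. i \<in> I \<Longrightarrow> homog V e (f i)) \<Longrightarrow> homog V e (sum f I)"
  by (induction I rule: infinite_finite_induct) (auto intro: homog_add)

lemma homog_mult: "homog V d P \<Longrightarrow> homog V e Q \<Longrightarrow> homog V (d + e) (P * Q)"
  unfolding homog_def using keys_mult[of P Q] by (fastforce simp: wdeg_add)

lemma homog_const [simp]: "homog V 0 (Poly_Mapping.single 0 c)"
  by (simp add: homog_def wdeg_def)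

lemma homog_one [simp]: "homog V 0 1"
  by (simp add: homog_def wdeg_def)

lemma homog_single: "homog V (wdeg V \<alpha>) (Poly_Mapping.single \<alpha> c)"
  by (simp add: homog_def)

lemma homog_uminus: "homog V e P \<Longrightarrow> homog V e (- P)"
  by (auto simp: homog_def in_keys_iff)

lemma homog_diff: "homog V e P \<Longrightarrow> homog V e Q \<Longrightarrow> homog V e (P - Q)"
  using homog_add[of V e P "- Q"] homog_uminus by simp

lemma homog_xvar: "finite V \<Longrightarrow> k \<in> V \<Longrightarrow> homog V 1 (xvar k)"
  by (simp add: homog_def wdeg_def xvar_def lookup_single when_def)

lemma homog_prod: "finite I \<Longrightarrow> (\<And>i. i \<in> I \<Longrightarrow> homog V (d i) (f i)) \<Longrightarrow> homog V (sum d I) (prod f I)"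
  by (induction I rule: finite_induct) (auto intro: homog_mult)

lemma homog_power: "homog V d P \<Longrightarrow> homog V (e * d) (P ^ e)"
  by (induction e) (auto intro: homog_mult)

lemma hpart_mult_homog:
  assumes G: "homog V d G" and d: "d \<le> e"
  shows "hpart V e (P * G) = hpart V (e - d) P * G"
proof -
  define t where "t \<alpha> = Poly_Mapping.single \<alpha> (Poly_Mapping.lookup P \<alpha>)" for \<alpha>
  have P: "P = sum t (Poly_Mapping.keys P)" unfolding t_def by (rule zpoly_eq_sum)
  have "hpart V e (t \<alpha> * G) = hpart V (e - d) (t \<alpha>) * G" for \<alpha>
  proof -
    have "hpart V e (t \<alpha> * G) = (if wdeg V \<alpha> + d = e then t \<alpha> * G else 0)"
      unfolding t_def by (rule hpart_homog[OF homog_mult[OF homog_single G]])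
    moreover have "hpart V (e - d) (t \<alpha>) = (if wdeg V \<alpha> = e - d then t \<alpha> else 0)"
      unfolding t_def by (rule hpart_homog[OF homog_single])
    ultimately show ?thesis using d by auto
  qed
  then have "hpart V e (sum t (Poly_Mapping.keys P) * G) = hpart V (e - d) (sum t (Poly_Mapping.keys P)) * G"
    by (simp add: sum_distrib_right hpart_sum)
  then show ?thesis using P by simp
qed

lemma lookup_monomial_mult:
  fixes P :: zpoly
  shows "Poly_Mapping.lookup (Poly_Mapping.single \<alpha> c * P) (\<alpha> + \<beta>) = c * Poly_Mapping.lookup P \<beta>"
proof -
  have "Poly_Mapping.lookup (Poly_Mapping.single \<alpha> c * P) (\<alpha> + \<beta>) = Poly_Mapping.lookup
      (Poly_Mapping.single \<alpha> c * (\<Sum>m\<in>Poly_Mapping.keys P. Poly_Mapping.single m (Poly_Mapping.lookup P m))) (\<alpha> + \<beta>)"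
    using zpoly_eq_sum[of P] by simp
  also have "\<dots> = (\<Sum>m\<in>Poly_Mapping.keys P. if m = \<beta> then c * Poly_Mapping.lookup P m else 0)"
    by (simp add: sum_distrib_left lookup_sum mult_single lookup_single when_def)
  also have "\<dots> = c * Poly_Mapping.lookup P \<beta>"
    by (auto simp: in_keys_iff)
  finally show ?thesis .
qed

lemma monomial_factor:
  fixes \<alpha> :: "nat \<Rightarrow>\<^sub>0 nat"
  assumes "N \<le> Poly_Mapping.lookup \<alpha> k"
  shows "\<alpha> = Poly_Mapping.single k N + (\<alpha> - Poly_Mapping.single k N)"
  by (rule poly_mapping_eqI) (use assms in \<open>auto simp: lookup_add lookup_minus lookup_single when_def\<close>)

lemma monomial_in_span_power:
  assumes "N \<le> Poly_Mapping.lookup \<alpha> k" "xvar k ^ N \<in> ideal_span B"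
  shows "Poly_Mapping.single \<alpha> c \<in> ideal_span B"
proof -
  have "Poly_Mapping.single \<alpha> c = Poly_Mapping.single (\<alpha> - Poly_Mapping.single k N) c * xvar k ^ N"
    using monomial_factor[OF assms(1)] by (simp add: xvar_power mult_single add.commute)
  then show ?thesis using gen.span_scale[OF assms(2)] by simp
qed

lemma zpoly_in_ideal:
  fixes P :: zpoly
  assumes "is_ideal J" "\<And>\<alpha>. \<alpha> \<in> Poly_Mapping.keys P \<Longrightarrow> Poly_Mapping.single \<alpha> (Poly_Mapping.lookup P \<alpha>) \<in> J"
  shows "P \<in> J"
proof -
  have "(\<Sum>\<alpha>\<in>Poly_Mapping.keys P. Poly_Mapping.single \<alpha> (Poly_Mapping.lookup P \<alpha>)) \<in> J"
    by (rule gen.subspace_sum[OF assms])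
  then show ?thesis by (simp only: zpoly_eq_sum[symmetric])
qed

abbreviation zconst :: "int \<Rightarrow> zpoly" where "zconst \<equiv> Poly_Mapping.single 0"

lemma lookup_zconst_mult: "Poly_Mapping.lookup (P * zconst q) \<alpha> = q * Poly_Mapping.lookup P \<alpha>"
  using lookup_monomial_mult[of 0 q P \<alpha>] by (simp add: mult.commute)

text \<open>Modulo q all generators are monomials, so the ideal is determined coefficient by
  coefficient: either one of the powers divides the monomial, or q must divide its
  coefficient.\<close>

lemma in_span_const_powers_iff:
  "f \<in> ideal_span ({zconst q} \<union> (\<lambda>k. xvar (Suc k) ^ N) ` {..<i}) \<longleftrightarrow>
     (\<forall>\<alpha>. (\<exists>k<i. N \<le> Poly_Mapping.lookup \<alpha> (Suc k)) \<or> q dvd Poly_Mapping.lookup f \<alpha>)"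
  (is "_ \<in> ideal_span ?B \<longleftrightarrow> _")
proof
  assume "f \<in> ideal_span ?B"
  then show "\<forall>\<alpha>. (\<exists>k<i. N \<le> Poly_Mapping.lookup \<alpha> (Suc k)) \<or> q dvd Poly_Mapping.lookup f \<alpha>"
  proof (induction rule: gen.span_induct_alt)
    case (step c b f)
    have "(\<exists>k<i. N \<le> Poly_Mapping.lookup \<alpha> (Suc k)) \<or> q dvd Poly_Mapping.lookup (c * b) \<alpha>" for \<alpha>
      using step(1)
    proof
      assume "b \<in> {zconst q}"
      then show ?thesis by (simp add: lookup_zconst_mult)
    next
      assume "b \<in> (\<lambda>k. xvar (Suc k) ^ N) ` {..<i}"
      then obtain k where k: "k < i" "b = xvar (Suc k) ^ N" by blast
      show ?thesis
      proof (cases "Poly_Mapping.lookup (c * b) \<alpha> = 0")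
        case False
        then have "\<alpha> \<in> Poly_Mapping.keys (c * b)" by (simp add: in_keys_iff)
        then obtain \<beta> \<gamma> where "\<alpha> = \<beta> + \<gamma>" "\<gamma> \<in> Poly_Mapping.keys b" using keys_mult[of c b] by blast
        then have "N \<le> Poly_Mapping.lookup \<alpha> (Suc k)"
          by (simp add: k(2) xvar_power lookup_add split: if_splits)
        then show ?thesis using k(1) by blast
      qed simp
    qed
    then show ?case using step(2) by (metis dvd_add lookup_add)
  qed simp
next
  assume *: "\<forall>\<alpha>. (\<exists>k<i. N \<le> Poly_Mapping.lookup \<alpha> (Suc k)) \<or> q dvd Poly_Mapping.lookup f \<alpha>"
  show "f \<in> ideal_span ?B"
  proof (rule zpoly_in_ideal)
    fix \<alpha>
    consider k where "k < i" "N \<le> Poly_Mapping.lookup \<alpha> (Suc k)" | c where "Poly_Mapping.lookup f \<alpha> = q * c"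
      using * by (meson dvdE)
    then show "Poly_Mapping.single \<alpha> (Poly_Mapping.lookup f \<alpha>) \<in> ideal_span ?B"
    proof cases
      case 1
      then show ?thesis by (intro monomial_in_span_power[OF 1(2)] gen.span_base) auto
    next
      case 2
      then have "Poly_Mapping.single \<alpha> (Poly_Mapping.lookup f \<alpha>) = Poly_Mapping.single \<alpha> c * zconst q"
        by (simp add: mult_single mult.commute)
      then show ?thesis using gen.span_scale[OF gen.span_base, of "zconst q" ?B] by simp
    qed
  qed simp
qed

text \<open>Multiplication by a power of the next variable only shifts an exponent that the earlier
  powers do not involve.\<close>

lemma regular_mod_powers: "regular_mod {zconst q} (\<lambda>k. xvar (Suc k) ^ N) m"
  unfolding regular_mod_def in_span_const_powers_iff
proof (intro allI impI)
  fix i f \<alpha>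
  assume *: "\<forall>\<alpha>. (\<exists>k<i. N \<le> Poly_Mapping.lookup \<alpha> (Suc k)) \<or>
    q dvd Poly_Mapping.lookup (xvar (Suc i) ^ N * f) \<alpha>"
  have "Poly_Mapping.lookup (xvar (Suc i) ^ N * f) (Poly_Mapping.single (Suc i) N + \<alpha>) = Poly_Mapping.lookup f \<alpha>"
    unfolding xvar_power by (simp add: lookup_monomial_mult)
  moreover have "Poly_Mapping.lookup (Poly_Mapping.single (Suc i) N + \<alpha>) (Suc k) = Poly_Mapping.lookup \<alpha> (Suc k)"
    if "k < i" for k
    using that by (simp add: lookup_add lookup_single)
  ultimately show "(\<exists>k<i. N \<le> Poly_Mapping.lookup \<alpha> (Suc k)) \<or> q dvd Poly_Mapping.lookup f \<alpha>"
    using *[rule_format, of "Poly_Mapping.single (Suc i) N + \<alpha>"] by metis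
qed

text \<open>The degree of an entry depends on its column alone, and every Leibniz term meets each
  column once.\<close>

lemma homog_det:
  assumes A: "A \<in> carrier_mat m m"
    and hom: "\<And>i j. i < m \<Longrightarrow> j < m \<Longrightarrow> homog V (d j) (A $$ (i, j))"
  shows "homog V (\<Sum>j<m. d j) (det A)"
  unfolding det_def'[OF A]
proof (rule homog_sum)
  fix \<pi> assume "\<pi> \<in> {\<pi>. \<pi> permutes {0..<m}}"
  then have \<pi>: "\<pi> permutes {..<m}" by (simp add: atLeast0LessThan)
  have "homog V (\<Sum>i<m. d (\<pi> i)) (\<Prod>i<m. A $$ (i, \<pi> i))"
    by (rule homog_prod) (use hom permutes_in_image[OF \<pi>] in auto)
  moreover have "(\<Sum>i<m. d (\<pi> i)) = (\<Sum>j<m. d j)"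
    using sum.permute[OF \<pi>, of d] by (simp add: o_def)
  ultimately have "homog V (\<Sum>j<m. d j) (\<Prod>i = 0..<m. A $$ (i, \<pi> i))"
    by (simp add: atLeast0LessThan)
  then show "homog V (\<Sum>j<m. d j) (signof \<pi> * (\<Prod>i = 0..<m. A $$ (i, \<pi> i)))"
    by (auto simp: sign_def intro: homog_uminus)
qed

text \<open>The degree of u det A exceeds m (N - 1), so each of its monomials has an exponent at
  least N and u det A lies in the ideal of q and the powers; \<open>det_colon_regular\<close> then
  cancels det A. This is Macaulay's bound on the degrees in which the quotient by the forms can be
  nonzero.\<close>

lemma macaulay_bound:
  fixes g :: "nat \<Rightarrow> zpoly"
  assumes hom: "\<And>j. j < m \<Longrightarrow> homog {1..m} (d j) (g j)"
    and nil: "\<And>k. k \<in> {1..m} \<Longrightarrow> \<exists>N. xvar k ^ N \<in> ideal_span ({zconst q} \<union> g ` {..<m})"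
    and u: "homog {1..m} e u" and e: "(\<Sum>j<m. d j) < e + m"
  shows "u \<in> ideal_span ({zconst q} \<union> g ` {..<m})"
proof -
  let ?X = "{1..m}"
  let ?I = "ideal_span ({zconst q} \<union> g ` {..<m})"
  obtain N0 where N0: "xvar k ^ N0 k \<in> ?I" if "k \<in> ?X" for k
    using nil by metis
  \<comment> \<open>One exponent for all k, at least every d_j so that N - d_j is no truncated
    difference, and at least 1 for the bound m (N - 1).\<close>
  define N where "N = (\<Sum>k\<in>?X. N0 k) + (\<Sum>j<m. d j) + 1"
  have dN: "d j \<le> N" if "j < m" for j
    using member_le_sum[of j "{..<m}" d] that by (simp add: N_def)
  define a where "a i = xvar (Suc i) ^ N" for i
  have a_in: "a i \<in> ?I" if "i < m" for i
  proof -
    have "N0 (Suc i) \<le> N"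
      using member_le_sum[of "Suc i" ?X N0] that by (simp add: N_def)
    then have "a i = xvar (Suc i) ^ (N - N0 (Suc i)) * xvar (Suc i) ^ N0 (Suc i)"
      by (simp add: a_def power_add[symmetric])
    then show ?thesis using gen.span_scale[OF N0[of "Suc i"]] that by simp
  qed
  have "\<exists>c. \<forall>i<m. a i - (\<Sum>j<m. c i j * g j) \<in> ideal_span {zconst q}"
    using span_Un_image_lessThan[OF a_in] by metis
  then obtain c where c: "\<And>i. i < m \<Longrightarrow> a i - (\<Sum>j<m. c i j * g j) \<in> ideal_span {zconst q}"
    by blast
  \<comment> \<open>Only the component of degree N - d_j of each multiplier matters, since x_k^N is
    homogeneous of degree N and the constant q of degree 0; this makes det A homogeneous.\<close>
  define A where "A = mat m m (\<lambda>(i, j). hpart ?X (N - d j) (c i j))"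
  have A: "A \<in> carrier_mat m m" by (simp add: A_def)
  have aA: "a i - (\<Sum>j<m. A $$ (i, j) * g j) \<in> ideal_span {zconst q}" if i: "i < m" for i
  proof -
    obtain b where b: "a i - (\<Sum>j<m. c i j * g j) = b * zconst q"
      using c[OF i] unfolding gen.span_singleton by blast
    have "homog ?X N (a i)"
      using homog_power[OF homog_xvar[of ?X "Suc i"], of N] i by (simp add: a_def)
    then have "hpart ?X N (a i) = a i" by (simp add: hpart_homog)
    moreover have "hpart ?X N (\<Sum>j<m. c i j * g j) = (\<Sum>j<m. A $$ (i, j) * g j)"
      unfolding hpart_sum
    proof (intro sum.cong refl)
      fix j assume "j \<in> {..<m}"
      then have "hpart ?X N (c i j * g j) = hpart ?X (N - d j) (c i j) * g j"
        by (intro hpart_mult_homog hom dN) auto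
      then show "hpart ?X N (c i j * g j) = A $$ (i, j) * g j"
        using i \<open>j \<in> {..<m}\<close> by (simp add: A_def)
    qed
    ultimately have "a i - (\<Sum>j<m. A $$ (i, j) * g j) = hpart ?X N (b * zconst q)"
      using arg_cong[OF b, of "hpart ?X N"] by (simp add: hpart_diff)
    also have "\<dots> = hpart ?X N b * zconst q"
      using hpart_mult_homog[OF homog_const, of N] by simp
    finally show ?thesis unfolding gen.span_singleton by blast
  qed
  have "homog ?X (\<Sum>j<m. N - d j) (det A)"
    by (rule homog_det[OF A]) (simp add: A_def homog_hpart)
  then have hud: "homog ?X (e + (\<Sum>j<m. N - d j)) (u * det A)" by (rule homog_mult[OF u])
  have deg: "m * (N - 1) < e + (\<Sum>j<m. N - d j)"
  proof -
    have "(\<Sum>j<m. N - d j) + (\<Sum>j<m. d j) = (\<Sum>j<m. N)"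
      unfolding sum.distrib[symmetric] by (intro sum.cong refl) (use dN in auto)
    also have "\<dots> = m * (N - 1) + m" by (simp add: N_def algebra_simps)
    finally show ?thesis using e by linarith
  qed
  have uA: "u * det A \<in> ideal_span ({zconst q} \<union> a ` {..<m})"
    unfolding a_def in_span_const_powers_iff
  proof
    fix \<alpha>
    have "\<exists>k<m. N \<le> Poly_Mapping.lookup \<alpha> (Suc k)" if "Poly_Mapping.lookup (u * det A) \<alpha> \<noteq> 0"
    proof (rule ccontr)
      assume small: "\<not> (\<exists>k<m. N \<le> Poly_Mapping.lookup \<alpha> (Suc k))"
      have "Poly_Mapping.lookup \<alpha> k \<le> N - 1" if "k \<in> ?X" for k
      proof -
        from that have "k - 1 < m" "Suc (k - 1) = k" by auto
        with small have "\<not> N \<le> Poly_Mapping.lookup \<alpha> k" by metis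
        then show ?thesis by linarith
      qed
      then have "wdeg ?X \<alpha> \<le> (\<Sum>k\<in>?X. N - 1)" unfolding wdeg_def by (rule sum_mono)
      moreover have "wdeg ?X \<alpha> = e + (\<Sum>j<m. N - d j)"
        using hud that by (simp add: homog_def in_keys_iff)
      ultimately show False using deg by simp
    qed
    then show "(\<exists>k<m. N \<le> Poly_Mapping.lookup \<alpha> (Suc k)) \<or> q dvd Poly_Mapping.lookup (u * det A) \<alpha>"
      using dvd_0_right by metis
  qed
  show ?thesis
  proof (rule det_colon_regular)
    show "finite (\<Union>i<m. vars (a i) \<union> vars (g i))" by (simp add: finite_vars)
    show "vars b \<subseteq> (\<Union>i<m. vars (a i) \<union> vars (g i))" if "b \<in> {zconst q}" for b
      using that by simp
    show "vars (a i) \<subseteq> (\<Union>i<m. vars (a i) \<union> vars (g i))"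
      "vars (g i) \<subseteq> (\<Union>i<m. vars (a i) \<union> vars (g i))" if "i < m" for i
      using that by blast+
    show "regular_mod {zconst q} a m" unfolding a_def by (rule regular_mod_powers)
    show "A \<in> carrier_mat m m" by (rule A)
    show "a i - (\<Sum>j<m. A $$ (i, j) * g j) \<in> ideal_span {zconst q}" if "i < m" for i
      using that by (rule aA)
    show "u * det A \<in> ideal_span ({zconst q} \<union> a ` {..<m})" by (rule uA)
  qed
qed

section \<open>The polynomials \<open>G\<close> and the minors of \<open>M\<close>\<close>

lemma coeff_prod_linear:
  fixes z :: "'b \<Rightarrow> 'a::comm_ring_1"
  assumes A: "finite A" and i: "i \<le> card A"
  shows "coeff (\<Prod>k\<in>A. [:z k, 1:]) (card A - i) = (\<Sum>S | S \<subseteq> A \<and> card S = i. \<Prod>k\<in>S. z k)"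
proof -
  have const: "(\<Prod>k\<in>S. [:z k:]) = [:\<Prod>k\<in>S. z k:]" for S
    by (induction S rule: infinite_finite_induct) (simp_all add: one_pCons)
  have "(\<Prod>k\<in>A. [:z k, 1:]) = (\<Prod>k\<in>A. [:z k:] + [:0, 1:])" by simp
  also have "\<dots> = (\<Sum>S\<in>Pow A. (\<Prod>k\<in>S. [:z k:]) * (\<Prod>k\<in>A - S. [:0, 1:]))"
    by (rule prod_add[OF A])
  also have "\<dots> = (\<Sum>S\<in>Pow A. Polynomial.monom (\<Prod>k\<in>S. z k) (card (A - S)))"
    by (simp add: const monom_altdef)
  finally have "coeff (\<Prod>k\<in>A. [:z k, 1:]) (card A - i) =
      (\<Sum>S\<in>Pow A. if card (A - S) = card A - i then \<Prod>k\<in>S. z k else 0)"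
    by (simp add: coeff_sum)
  also have "\<dots> = (\<Sum>S\<in>Pow A. if card S = i then \<Prod>k\<in>S. z k else 0)"
  proof (intro sum.cong refl if_cong)
    fix S assume "S \<in> Pow A"
    then have "card (A - S) = card A - card S" "card S \<le> card A"
      using A by (auto simp: card_Diff_subset finite_subset card_mono)
    with i show "(card (A - S) = card A - i) = (card S = i)" by auto
  qed
  also have "\<dots> = (\<Sum>S | S \<subseteq> A \<and> card S = i. \<Prod>k\<in>S. z k)"
    using A by (simp add: sum.If_cases Int_def Pow_def)
  finally show ?thesis .
qed

text \<open>The right-hand side is the i-th Hasse derivative of F at c: Hasse derivatives are the
  coefficients of the Taylor expansion, in any characteristic.\<close>

lemma coeff_pcompose_shift:
  fixes F :: "'a::comm_ring_1 poly"
  assumes "degree F \<le> n"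
  shows "coeff (pcompose F [:c, 1:]) i = (\<Sum>k\<le>n. of_nat (k choose i) * (coeff F k * c ^ (k - i)))"
proof -
  have "F = (\<Sum>k\<le>n. Polynomial.monom (coeff F k) k)"
    using poly_as_sum_of_monoms'[OF assms] by simp
  then have "pcompose F [:c, 1:] = (\<Sum>k\<le>n. pcompose (Polynomial.monom (coeff F k) k) [:c, 1:])"
    by (metis pcompose_sum)
  also have "\<dots> = (\<Sum>k\<le>n. smult (coeff F k) ([:c, 1:] ^ k))"
  proof (intro sum.cong refl)
    fix k
    have "pcompose ([:0, 1:] ^ k) [:c, 1:] = ([:c, 1:] ^ k :: 'a poly)"
      by (induction k) (simp_all add: pcompose_mult pcompose_pCons pcompose_1)
    then show "pcompose (Polynomial.monom (coeff F k) k) [:c, 1:] = smult (coeff F k) ([:c, 1:] ^ k)"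
      by (simp add: monom_altdef pcompose_smult)
  qed
  finally have "coeff (pcompose F [:c, 1:]) i = (\<Sum>k\<le>n. coeff F k * coeff ([:c, 1:] ^ k) i)"
    by (simp add: coeff_sum)
  also have "\<dots> = (\<Sum>k\<le>n. of_nat (k choose i) * (coeff F k * c ^ (k - i)))"
  proof (intro sum.cong refl)
    fix k
    show "coeff F k * coeff ([:c, 1:] ^ k) i = of_nat (k choose i) * (coeff F k * c ^ (k - i))"
    proof (cases "i \<le> k")
      case True
      then show ?thesis by (simp add: coeff_linear_poly_power mult_ac)
    next
      case False
      moreover have "degree ([:c, 1:] ^ k) \<le> 1 * k"
        by (rule order_trans[OF degree_power_le]) simp
      ultimately show ?thesis by (simp add: coeff_eq_0 binomial_eq_0)
    qed
  qed
  finally show ?thesis .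
qed

text \<open>Putting \<open>x\<^sub>n = 0\<close> makes \<open>\<Phi>\<^sub>j\<close> the shift by \<open>x\<^sub>j\<close> for all \<open>j\<close>, including \<open>j = n\<close>.\<close>

definition yvar :: "nat \<Rightarrow> nat \<Rightarrow> zpoly" where
  "yvar n k = (if k = n then 0 else xvar k)"

lemma msubst_prod: "msubst s (prod f I) = (\<Prod>i\<in>I. msubst s (f i))"
  by (induction I rule: infinite_finite_induct) (simp_all add: msubst_one msubst_mult)

text \<open>The n differences y_k - y_j are the images of the n - 1 variables together with one 0,
  which contributes the factor X and moves the coefficient index from n - 1 - i to n - i. For j
  \<noteq> n the index n supplies -x_j, the image of x_j, and the index j supplies the 0.\<close>

lemma GT_eq_coeff:
  assumes i: "i \<in> {1..n - 1}" and j: "T i \<in> {1..n}"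
  shows "GT n T i = coeff (\<Prod>k=1..n. [:yvar n k - yvar n (T i), 1:]) (n - i)"
proof -
  define j where "j = T i"
  define s where "s k = (if j = n then xvar k else if k = j then - xvar j else xvar k - xvar j)" for k
  from i have n: "n = Suc (n - 1)" "{1..n} = insert n {1..n - 1}" by auto
  have "GT n T i = (\<Sum>S | S \<subseteq> {1..n - 1} \<and> card S = i. \<Prod>k\<in>S. s k)"
    by (simp add: GT_def Phi_def esym_def msubst_sum msubst_prod msubst_xvar s_def flip: j_def)
  also have "\<dots> = coeff (\<Prod>k=1..n - 1. [:s k, 1:]) (n - 1 - i)"
    using coeff_prod_linear[of "{1..n - 1}" i s] i by simp
  also have "\<dots> = coeff ([:0, 1:] * (\<Prod>k=1..n - 1. [:s k, 1:])) (n - i)"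
  proof -
    have "n - i = Suc (n - 1 - i)" using i by auto
    then show ?thesis by simp
  qed
  also have "[:0, 1:] * (\<Prod>k=1..n - 1. [:s k, 1:]) = (\<Prod>k=1..n. [:yvar n k - yvar n j, 1:])"
  proof (cases "j = n")
    case True
    then have "(\<Prod>k=1..n - 1. [:yvar n k - yvar n j, 1:]) = (\<Prod>k=1..n - 1. [:s k, 1:])"
      using n by (intro prod.cong) (auto simp: s_def yvar_def)
    then show ?thesis unfolding n(2) using True n(1) by simp
  next
    case False
    let ?A = "{1..n - 1} - {j}"
    have j: "j \<in> {1..n - 1}" using False assms(2) by (auto simp: j_def)
    have "(\<Prod>k\<in>?A. [:yvar n k - yvar n j, 1:]) = (\<Prod>k\<in>?A. [:s k, 1:])"
      using False by (intro prod.cong) (auto simp: s_def yvar_def)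
    then have "(\<Prod>k=1..n. [:yvar n k - yvar n j, 1:]) =
        [:yvar n n - yvar n j, 1:] * ([:yvar n j - yvar n j, 1:] * (\<Prod>k\<in>?A. [:s k, 1:]))"
      unfolding n(2) using n(1) j by (subst prod.insert) (auto simp: prod.remove[of _ j])
    also have "\<dots> = [:0, 1:] * ([:s j, 1:] * (\<Prod>k\<in>?A. [:s k, 1:]))"
      using False by (simp add: s_def yvar_def mult_ac)
    also have "[:s j, 1:] * (\<Prod>k\<in>?A. [:s k, 1:]) = (\<Prod>k=1..n - 1. [:s k, 1:])"
      using j by (simp add: prod.remove[of _ j])
    finally show ?thesis by simp
  qed
  finally show ?thesis unfolding j_def .
qed

lemma GT_eq_sum:
  assumes i: "i \<in> {1..n - 1}" and j: "T i \<in> {1..n}"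
  shows "GT n T i = (\<Sum>S | S \<subseteq> {1..n} \<and> card S = i. \<Prod>k\<in>S. yvar n k - yvar n (T i))"
  unfolding GT_eq_coeff[where T = T, OF assms]
  using coeff_prod_linear[of "{1..n}" i "\<lambda>k. yvar n k - yvar n (T i)"] i by auto

lemma homog_yvar: "k \<in> {1..n} \<Longrightarrow> homog {1..n - 1} 1 (yvar n k)"
  using homog_xvar[of "{1..n - 1}" k] by (auto simp: yvar_def)

lemma homog_GT:
  assumes i: "i \<in> {1..n - 1}" and j: "T i \<in> {1..n}"
  shows "homog {1..n - 1} i (GT n T i)"
  unfolding GT_eq_sum[where T = T, OF assms]
proof (rule homog_sum)
  fix S assume S: "S \<in> {S. S \<subseteq> {1..n} \<and> card S = i}"
  then have "finite S" using finite_subset by auto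
  then have "homog {1..n - 1} (\<Sum>k\<in>S. 1) (\<Prod>k\<in>S. yvar n k - yvar n (T i))"
    using S by (intro homog_prod homog_diff homog_yvar j) auto
  then show "homog {1..n - 1} i (\<Prod>k\<in>S. yvar n k - yvar n (T i))" using S by simp
qed

lemma vars_diff: "vars (P - Q) \<subseteq> vars P \<union> vars Q"
  unfolding vars_def using keys_diff[of P Q] by blast

lemma vars_prod: "vars (prod f I) \<subseteq> (\<Union>i\<in>I. vars (f i))"
proof (induction I rule: infinite_finite_induct)
  case (insert i I)
  then show ?case using vars_mult[of "f i" "prod f I"] by auto
qed auto

lemma vars_GT:
  assumes i: "i \<in> {1..n - 1}" and j: "T i \<in> {1..n}"
  shows "vars (GT n T i) \<subseteq> {1..n - 1}"
proof -
  have y: "vars (yvar n k) \<subseteq> {1..n - 1}" if "k \<in> {1..n}" for k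
    using that by (auto simp: yvar_def)
  have "vars (\<Prod>k\<in>S. yvar n k - yvar n (T i)) \<subseteq> {1..n - 1}" if "S \<subseteq> {1..n}" for S
  proof (rule order_trans[OF vars_prod UN_least])
    fix k assume "k \<in> S"
    then have "k \<in> {1..n}" using that by blast
    then show "vars (yvar n k - yvar n (T i)) \<subseteq> {1..n - 1}"
      using vars_diff[of "yvar n k" "yvar n (T i)"] y[of k] y[OF j] by blast
  qed
  then show ?thesis
    unfolding GT_eq_sum[where T = T, OF assms] by (intro order_trans[OF vars_sum UN_least]) auto
qed

definition GT_ideal :: "nat \<Rightarrow> (nat \<Rightarrow> nat) \<Rightarrow> int \<Rightarrow> zpoly set" where
  "GT_ideal n T q = ideal_span ({zconst q} \<union> GT n T ` {1..n - 1})"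

text \<open>The sides differ by exactly 1, so \<open>dd n\<close> is the least degree for which
  \<open>macaulay_bound\<close> applies to forms of degrees 1, ..., n - 1.\<close>

lemma dd_bound:
  assumes "n \<ge> 2"
  shows "(\<Sum>j<n - 1. Suc j) < dd n + (n - 1)"
proof -
  define S where "S = (\<Sum>j<n - 1. Suc j)"
  have "2 * (\<Sum>j<m. Suc j) = m * (m + 1)" for m :: nat
    by (induction m) auto
  from this[of "n - 1"] have "2 * S = (n - 1) * n"
    using assms by (simp add: S_def)
  then have "2 * int S = int ((n - 1) * n)" by linarith
  also have "\<dots> = int n ^ 2 - int n"
    using assms by (simp add: of_nat_diff power2_eq_square algebra_simps)
  finally show ?thesis using two_dd[of n] assms unfolding S_def[symmetric] by linarith
qed

lemma monomials_in_GT_ideal: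
  assumes n: "n \<ge> 2" and T: "T \<in> TT n"
    and nil: "\<And>k. k \<in> {1..n - 1} \<Longrightarrow> \<exists>N. xvar k ^ N \<in> GT_ideal n T q"
    and \<beta>: "\<beta> \<in> exps n (dd n)"
  shows "Poly_Mapping.single \<beta> 1 \<in> GT_ideal n T q"
proof -
  have im: "GT n T ` {1..n - 1} = (\<lambda>j. GT n T (Suc j)) ` {..<n - 1}"
    using image_Suc_lessThan[of "n - 1"] by (metis image_image)
  have "wdeg {1..n - 1} \<beta> = dd n" using \<beta> by (simp add: exps_def wdeg_def)
  then have "homog {1..n - 1} (dd n) (Poly_Mapping.single \<beta> 1)"
    using homog_single by metis
  moreover have "homog {1..n - 1} (Suc j) (GT n T (Suc j))" if "j < n - 1" for j
    using that T by (intro homog_GT) (auto simp: TT_def)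
  ultimately show ?thesis
    using macaulay_bound[of "n - 1" Suc "\<lambda>j. GT n T (Suc j)" q "dd n"] nil dd_bound[OF n]
    unfolding GT_ideal_def im by blast
qed

section \<open>Maximal minors of integer matrices\<close>

lemma submatrix_rows:
  assumes M: "M \<in> carrier_mat nr nc" and I: "I \<subseteq> {..<nr}" and card: "card I = m"
  shows "submatrix M I UNIV \<in> carrier_mat m nc"
    and "r < m \<Longrightarrow> c < nc \<Longrightarrow> submatrix M I UNIV $$ (r, c) = M $$ (pick I r, c)"
    and "r < m \<Longrightarrow> pick I r \<in> I"
proof -
  have rows: "{i. i < dim_row M \<and> i \<in> I} = I" "{i. i < nr \<and> i \<in> I} = I" using M I by auto
  show carrier: "submatrix M I UNIV \<in> carrier_mat m nc"
    using M by (intro carrier_matI) (simp_all add: dim_submatrix rows card)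
  show "submatrix M I UNIV $$ (r, c) = M $$ (pick I r, c)" if "r < m" "c < nc"
    using that M by (subst submatrix_index) (simp_all add: rows card pick_UNIV)
  show "pick I r \<in> I" if "r < m"
    using pick_in_set_le[of r I] that card by simp
qed

text \<open>Minors are indexed by sets of rows, Cauchy--Binet by functions f. A repeated row gives
  determinant 0; otherwise the chosen rows are a rearrangement of a submatrix, and writing this as a
  matrix product avoids computing the sign.\<close>

lemma dvd_det_selected_rows:
  fixes M :: "int mat"
  assumes M: "M \<in> carrier_mat nr nc" and f: "\<And>i. i < nc \<Longrightarrow> f i < nr"
    and minors: "\<And>I. I \<subseteq> {..<nr} \<Longrightarrow> card I = nc \<Longrightarrow> q dvd det (submatrix M I UNIV)"
  shows "q dvd det (mat\<^sub>r nc nc (\<lambda>i. row M (f i)))"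
proof (cases "inj_on f {..<nc}")
  case False
  then obtain i j where ij: "i < nc" "j < nc" "i \<noteq> j" "f i = f j" by (auto simp: inj_on_def)
  have "det (mat\<^sub>r nc nc (\<lambda>i. row M (f i))) = 0"
    by (rule det_identical_rows[OF _ ij(3,1,2)]) (use ij M f in auto)
  then show ?thesis by simp
next
  case True
  define I where "I = f ` {..<nc}"
  have I: "I \<subseteq> {..<nr}" "card I = nc" using f True by (auto simp: I_def card_image)
  define B where "B = submatrix M I UNIV"
  note B = submatrix_rows[OF M I, folded B_def]
  define Q where "Q = mat nc nc (\<lambda>(i, l). if f i = pick I l then 1 else 0 :: int)"
  have Q: "Q \<in> carrier_mat nc nc" by (simp add: Q_def)
  have "mat\<^sub>r nc nc (\<lambda>i. row M (f i)) = Q * B"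
  proof (rule eq_matI)
    fix i c assume "i < dim_row (Q * B)" "c < dim_col (Q * B)"
    then have i: "i < nc" and c: "c < nc" using Q B(1) by auto
    \<comment> \<open>The position of row f i in the increasing enumeration of I.\<close>
    define l where "l = card {a\<in>I. a < f i}"
    have fi: "f i \<in> I" using i by (simp add: I_def)
    have "{a\<in>I. a < f i} \<subset> I" using fi by auto
    then have l: "l < nc" using I psubset_card_mono[of I] finite_subset[OF I(1)] by (auto simp: l_def)
    have pl: "pick I l = f i" unfolding l_def by (rule pick_card_in_set[OF fi])
    have uniq: "(f i = pick I k) = (k = l)" if "k < nc" for k
      using pick_mono_le[of l I k] pick_mono_le[of k I l] that l I(2) pl
      by (metis less_irrefl linorder_neqE_nat)
    have "(Q * B) $$ (i, c) = (\<Sum>k<nc. (if f i = pick I k then 1 else 0) * B $$ (k, c))"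
      using i c Q B(1) by (simp add: scalar_prod_def atLeast0LessThan Q_def)
    also have "\<dots> = (\<Sum>k<nc. if k = l then B $$ (k, c) else 0)"
      by (intro sum.cong refl) (simp add: uniq)
    also have "\<dots> = M $$ (f i, c)" using l c by (simp add: B(2) pl)
    finally show "mat\<^sub>r nc nc (\<lambda>i. row M (f i)) $$ (i, c) = (Q * B) $$ (i, c)"
      using i c M f by simp
  qed (use Q B(1) in auto)
  then have "det (mat\<^sub>r nc nc (\<lambda>i. row M (f i))) = det Q * det B"
    using det_mult[OF Q B(1)] by simp
  then show ?thesis using minors[OF I] by (simp add: B_def)
qed

text \<open>The Cauchy--Binet argument: \<open>det (X M)\<close> is a linear combination of maximal minors of \<open>M\<close>.\<close>

lemma exists_minor_not_dvd:
  fixes M :: "int mat"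
  assumes M: "M \<in> carrier_mat nr nc" and Q: "Q \<in> carrier_mat nc nr" and q: "\<not> q dvd 1"
    and inv: "\<And>i j. i < nc \<Longrightarrow> j < nc \<Longrightarrow> [(Q * M) $$ (i, j) = (if i = j then 1 else 0)] (mod q)"
  shows "\<exists>I. I \<subseteq> {..<nr} \<and> card I = nc \<and> \<not> q dvd det (submatrix M I UNIV)"
proof (rule ccontr)
  assume "\<not> ?thesis"
  then have minors: "q dvd det (submatrix M I UNIV)" if "I \<subseteq> {..<nr}" "card I = nc" for I
    using that by blast
  \<comment> \<open>Each f chooses one row of M for every row of the product; being the identity
    outside the index range makes the choice functions a finite set.\<close>
  let ?F = "{f. (\<forall>i\<in>{0..<nc}. f i \<in> {0..<nr}) \<and> (\<forall>i. i \<notin> {0..<nc} \<longrightarrow> f i = i)}"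
  have "det (Q * M) = (\<Sum>f\<in>?F. det (mat\<^sub>r nc nc (\<lambda>i. Q $$ (i, f i) \<cdot>\<^sub>v row M (f i))))"
    unfolding mat_mul_finsum_alt[OF Q M] by (rule det_linear_rows_sum) (use M in auto)
  also have "q dvd \<dots>"
  proof (rule dvd_sum)
    fix f assume f: "f \<in> ?F"
    have "det (mat\<^sub>r nc nc (\<lambda>i. Q $$ (i, f i) \<cdot>\<^sub>v row M (f i)))
        = (\<Prod>i = 0..<nc. Q $$ (i, f i)) * det (mat\<^sub>r nc nc (\<lambda>i. row M (f i)))"
      by (rule det_rows_mul) (use f M in auto)
    moreover have "q dvd det (mat\<^sub>r nc nc (\<lambda>i. row M (f i)))"
      by (rule dvd_det_selected_rows[OF M _ minors]) (use f in auto)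
    ultimately show "q dvd det (mat\<^sub>r nc nc (\<lambda>i. Q $$ (i, f i) \<cdot>\<^sub>v row M (f i)))" by simp
  qed
  finally have 1: "[det (Q * M) = 0] (mod q)" by (simp add: cong_0_iff)
  \<comment> \<open>The determinant is a polynomial in the entries, hence respects the congruence to
    the identity matrix; q would then divide 1.\<close>
  have "[det (Q * M) = det (1\<^sub>m nc)] (mod q)"
    unfolding det_def'[OF mult_carrier_mat[OF Q M]] det_def'[OF one_carrier_mat]
    by (intro cong_sum cong_scalar_left cong_prod)
      (use inv permutes_in_image in \<open>fastforce\<close>)
  then have "[det (Q * M) = 1] (mod q)" by simp
  with 1 have "[1 = 0] (mod q)" using cong_sym cong_trans by blast
  then show False using q by (simp add: cong_0_iff)
qed

section \<open>The matrix M_T in terms of polynomials\<close>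

lemma MT_carrier: "MT n T \<in> carrier_mat (DD n) (CC n)"
  by (simp add: MT_def)

lemma keys_GT_monomial:
  assumes T: "T \<in> TT n" and ia: "(i, \<alpha>) \<in> set (row_list n)"
  shows "Poly_Mapping.keys (GT n T i * Poly_Mapping.single \<alpha> 1) \<subseteq> exps n (dd n)"
proof
  fix \<gamma> assume \<gamma>: "\<gamma> \<in> Poly_Mapping.keys (GT n T i * Poly_Mapping.single \<alpha> 1)"
  from ia have i: "i \<in> {1..n - 1}" and \<alpha>: "\<alpha> \<in> exps n (dd n - i)"
    by (auto simp: set_row_list)
  from i T have Ti: "T i \<in> {1..n}" by (auto simp: TT_def)
  obtain \<beta> where \<beta>: "\<gamma> = \<beta> + \<alpha>" "\<beta> \<in> Poly_Mapping.keys (GT n T i)"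
    using \<gamma> keys_mult[of "GT n T i" "Poly_Mapping.single \<alpha> 1"] by auto
  have "wdeg {1..n - 1} \<beta> = i"
    using homog_GT[where T = T, OF i Ti] \<beta>(2) by (simp add: homog_def)
  moreover have "wdeg {1..n - 1} \<alpha> = dd n - i" using \<alpha> by (simp add: exps_def wdeg_def)
  moreover have "i \<le> dd n" using le_dd i by simp
  ultimately have "wdeg {1..n - 1} \<gamma> = dd n" by (simp add: \<beta>(1) wdeg_add)
  moreover have "Poly_Mapping.keys \<beta> \<subseteq> {1..n - 1}"
    using vars_GT[where T = T, OF i Ti] \<beta>(2) by (auto simp: vars_def)
  moreover have "Poly_Mapping.keys \<alpha> \<subseteq> {1..n - 1}" using \<alpha> by (simp add: exps_def)
  moreover have "Poly_Mapping.keys \<gamma> \<subseteq> Poly_Mapping.keys \<beta> \<union> Poly_Mapping.keys \<alpha>"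
    unfolding \<beta>(1) by (rule Poly_Mapping.keys_add)
  ultimately show "\<gamma> \<in> exps n (dd n)" by (auto simp: exps_def wdeg_def)
qed

text \<open>All exponents of the product are among the columns, so no coefficient is lost and a row
  of M_T can be read back as a polynomial.\<close>

lemma MT_row_expansion:
  assumes n: "n \<ge> 2" and T: "T \<in> TT n" and r: "r < DD n" and ia: "row_list n ! r = (i, \<alpha>)"
  shows "(\<Sum>c<CC n. Poly_Mapping.single (col_list n ! c) (MT n T $$ (r, c)))
    = GT n T i * Poly_Mapping.single \<alpha> 1"
proof -
  let ?P = "GT n T i * Poly_Mapping.single \<alpha> 1"
  have "(i, \<alpha>) \<in> set (row_list n)" using r ia length_row_list[OF n] nth_mem by metis
  then have keys: "Poly_Mapping.keys ?P \<subseteq> exps n (dd n)" by (rule keys_GT_monomial[OF T])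
  have bij: "bij_betw ((!) (col_list n)) {..<CC n} (exps n (dd n))"
    using bij_betw_nth[OF distinct_col_list, of "{..<CC n}" n "set (col_list n)"]
    by (simp add: length_col_list[OF n] set_col_list)
  have "(\<Sum>c<CC n. Poly_Mapping.single (col_list n ! c) (MT n T $$ (r, c)))
      = (\<Sum>c<CC n. Poly_Mapping.single (col_list n ! c) (Poly_Mapping.lookup ?P (col_list n ! c)))"
    using r ia by (intro sum.cong refl) (simp add: MT_def)
  also have "\<dots> = (\<Sum>\<gamma>\<in>exps n (dd n). Poly_Mapping.single \<gamma> (Poly_Mapping.lookup ?P \<gamma>))"
    by (rule sum.reindex_bij_betw[OF bij])
  also have "\<dots> = (\<Sum>\<gamma>\<in>Poly_Mapping.keys ?P. Poly_Mapping.single \<gamma> (Poly_Mapping.lookup ?P \<gamma>))"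
    using keys by (intro sum.mono_neutral_right finite_exps) (auto simp: in_keys_iff)
  also have "\<dots> = ?P" by (rule zpoly_eq_sum[symmetric])
  finally show ?thesis .
qed

text \<open>Let B be the submatrix and v the vector of all monomials of degree d. The entries of B v
  are multiples of the forms, and det B times v is the adjugate of B applied to B v. Evaluation at a
  zero turns this into the kernel vector argument.\<close>

lemma minor_times_monomial:
  assumes n: "n \<ge> 2" and T: "T \<in> TT n" and I: "I \<subseteq> {..<DD n}" "card I = CC n"
    and \<beta>: "\<beta> \<in> exps n (dd n)"
  shows "Poly_Mapping.single \<beta> (det (submatrix (MT n T) I UNIV)) \<in> ideal_span (GT n T ` {1..n - 1})"
proof -
  define B where "B = submatrix (MT n T) I UNIV"
  note B = submatrix_rows[OF MT_carrier[of n T] I, folded B_def]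
  obtain c0 where c0: "c0 < CC n" "\<beta> = col_list n ! c0"
    using \<beta> by (metis in_set_conv_nth length_col_list[OF n] set_col_list)
  have adj: "(\<Sum>r<CC n. cofactor B r c0 * B $$ (r, c)) = (if c0 = c then det B else 0)"
    if c: "c < CC n" for c
  proof -
    have "(adj_mat B * B) $$ (c0, c) = (\<Sum>r<CC n. cofactor B r c0 * B $$ (r, c))"
      using B(1) c0 c by (simp add: adj_mat_def scalar_prod_def atLeast0LessThan)
    then show ?thesis using adj_mat(3)[OF B(1)] c0 c by (simp split: if_splits)
  qed
  have row: "(\<Sum>c<CC n. Poly_Mapping.single (col_list n ! c) (B $$ (r, c))) \<in> ideal_span (GT n T ` {1..n - 1})"
    if r: "r < CC n" for r
  proof -
    have p: "pick I r < DD n" using B(3)[OF r] I by auto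
    obtain i \<alpha> where ia: "row_list n ! pick I r = (i, \<alpha>)" by fastforce
    have "(i, \<alpha>) \<in> set (row_list n)" using p ia length_row_list[OF n] nth_mem by metis
    then have i: "i \<in> {1..n - 1}" by (auto simp: set_row_list)
    have "(\<Sum>c<CC n. Poly_Mapping.single (col_list n ! c) (B $$ (r, c)))
        = Poly_Mapping.single \<alpha> 1 * GT n T i"
      using MT_row_expansion[OF n T p ia] B(2)[OF r] by (simp add: mult.commute)
    then show ?thesis using i by (simp add: gen.span_scale gen.span_base)
  qed
  have "Poly_Mapping.single \<beta> (det B) = (\<Sum>c<CC n. if c = c0 then Poly_Mapping.single (col_list n ! c) (det B) else 0)"
    using c0 by simp
  also have "\<dots> = (\<Sum>c<CC n. Poly_Mapping.single (col_list n ! c) (\<Sum>r<CC n. cofactor B r c0 * B $$ (r, c)))"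
    by (intro sum.cong refl) (simp add: adj)
  also have "\<dots> = (\<Sum>c<CC n. \<Sum>r<CC n. zconst (cofactor B r c0) * Poly_Mapping.single (col_list n ! c) (B $$ (r, c)))"
  proof (intro sum.cong refl)
    fix c
    show "Poly_Mapping.single (col_list n ! c) (\<Sum>r<CC n. cofactor B r c0 * B $$ (r, c)) =
        (\<Sum>r<CC n. zconst (cofactor B r c0) * Poly_Mapping.single (col_list n ! c) (B $$ (r, c)))"
      by (rule poly_mapping_eqI) (simp add: mult_single lookup_sum lookup_single when_def)
  qed
  also have "\<dots> = (\<Sum>r<CC n. zconst (cofactor B r c0) * (\<Sum>c<CC n. Poly_Mapping.single (col_list n ! c) (B $$ (r, c))))"
    by (subst sum.swap) (simp add: sum_distrib_left)
  also have "\<dots> \<in> ideal_span (GT n T ` {1..n - 1})"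
    by (rule gen.span_sum, rule gen.span_scale) (use row in auto)
  finally show ?thesis by (simp only: B_def)
qed

lemma sum_row_list:
  assumes n: "n \<ge> 2"
  shows "(\<Sum>r<DD n. h (row_list n ! r)) = (\<Sum>i\<in>{1..n - 1}. \<Sum>\<alpha>\<in>exps n (dd n - i). h (i, \<alpha>) :: int)"
proof -
  have "(\<Sum>r<DD n. h (row_list n ! r)) = sum_list (map h (row_list n))"
    by (simp add: sum_list_sum_nth length_row_list[OF n] atLeast0LessThan)
  also have "\<dots> = (\<Sum>i\<leftarrow>[1..<n]. \<Sum>\<alpha>\<leftarrow>sorted_list_of_set (exps n (dd n - i)). h (i, \<alpha>))"
  proof -
    have "sum_list (map h (concat (map (\<lambda>i. map (Pair i) (l i)) xs))) = (\<Sum>i\<leftarrow>xs. \<Sum>\<alpha>\<leftarrow>l i. h (i, \<alpha>))"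
      for l and xs :: "nat list"
      by (induction xs) (simp_all add: o_def)
    then show ?thesis by (simp only: row_list_def)
  qed
  also have "\<dots> = (\<Sum>i\<leftarrow>[1..<n]. \<Sum>\<alpha>\<in>exps n (dd n - i). h (i, \<alpha>))"
    by (simp add: sum_list_distinct_conv_sum_set finite_exps)
  also have "\<dots> = (\<Sum>i\<in>{1..<n}. \<Sum>\<alpha>\<in>exps n (dd n - i). h (i, \<alpha>))"
    by (simp add: sum_list_distinct_conv_sum_set)
  also have "{1..<n} = {1..n - 1}" using n by auto
  finally show ?thesis .
qed

text \<open>Only exponents of degree d - i in P can reach \<gamma>, because the form is homogeneous
  of degree i. So multipliers may be cut down to the row indices of M_T without being made
  homogeneous first.\<close>

lemma lookup_mult_GT:
  assumes T: "T \<in> TT n" and i: "i \<in> {1..n - 1}" and \<gamma>: "\<gamma> \<in> exps n (dd n)"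
  shows "Poly_Mapping.lookup (P * GT n T i) \<gamma> = (\<Sum>\<alpha>\<in>exps n (dd n - i).
    Poly_Mapping.lookup P \<alpha> * Poly_Mapping.lookup (GT n T i * Poly_Mapping.single \<alpha> 1) \<gamma>)"
proof -
  let ?G = "GT n T i"
  let ?h = "\<lambda>\<alpha>. Poly_Mapping.lookup P \<alpha> * Poly_Mapping.lookup (?G * Poly_Mapping.single \<alpha> 1) \<gamma>"
  from i T have Ti: "T i \<in> {1..n}" by (auto simp: TT_def)
  have "P * ?G = (\<Sum>\<alpha>\<in>Poly_Mapping.keys P. Poly_Mapping.single \<alpha> (Poly_Mapping.lookup P \<alpha>)) * ?G"
    using zpoly_eq_sum[of P] by simp
  also have "\<dots> = (\<Sum>\<alpha>\<in>Poly_Mapping.keys P. (?G * Poly_Mapping.single \<alpha> 1) * zconst (Poly_Mapping.lookup P \<alpha>))"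
    by (simp add: sum_distrib_right mult.assoc mult_single) (simp add: mult.commute)
  finally have "Poly_Mapping.lookup (P * ?G) \<gamma> = (\<Sum>\<alpha>\<in>Poly_Mapping.keys P. ?h \<alpha>)"
    by (simp only: lookup_sum lookup_zconst_mult)
  also have "\<dots> = (\<Sum>\<alpha>\<in>Poly_Mapping.keys P \<union> exps n (dd n - i). ?h \<alpha>)"
    by (rule sum.mono_neutral_left) (auto simp: finite_exps in_keys_iff)
  also have "\<dots> = (\<Sum>\<alpha>\<in>exps n (dd n - i). ?h \<alpha>)"
  proof (rule sum.mono_neutral_right)
    show "\<forall>\<alpha>\<in>Poly_Mapping.keys P \<union> exps n (dd n - i) - exps n (dd n - i). ?h \<alpha> = 0"
    proof
      fix \<alpha> assume \<alpha>: "\<alpha> \<in> Poly_Mapping.keys P \<union> exps n (dd n - i) - exps n (dd n - i)"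
      have "\<gamma> \<notin> Poly_Mapping.keys (?G * Poly_Mapping.single \<alpha> 1)"
      proof
        assume "\<gamma> \<in> Poly_Mapping.keys (?G * Poly_Mapping.single \<alpha> 1)"
        then obtain \<beta> where \<beta>: "\<gamma> = \<beta> + \<alpha>" "\<beta> \<in> Poly_Mapping.keys ?G"
          using keys_mult[of ?G "Poly_Mapping.single \<alpha> 1"] by auto
        have "wdeg {1..n - 1} \<beta> = i"
          using homog_GT[where T = T, OF i Ti] \<beta>(2) by (simp add: homog_def)
        moreover have "wdeg {1..n - 1} \<gamma> = dd n" using \<gamma> by (simp add: exps_def wdeg_def)
        ultimately have "wdeg {1..n - 1} \<alpha> = dd n - i" by (simp add: \<beta>(1) wdeg_add)
        moreover have "Poly_Mapping.keys \<alpha> \<subseteq> Poly_Mapping.keys \<gamma>"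
          by (auto simp: \<beta>(1) in_keys_iff lookup_add)
        ultimately have "\<alpha> \<in> exps n (dd n - i)" using \<gamma> by (auto simp: exps_def wdeg_def)
        then show False using \<alpha> by blast
      qed
      then show "?h \<alpha> = 0" by (simp add: in_keys_iff)
    qed
  qed (auto simp: finite_exps)
  finally show ?thesis .
qed

text \<open>The coefficients of the multipliers that express each monomial of degree d by the forms
  are a left inverse of M_T modulo q.\<close>

lemma exists_minor_not_dvd_MT:
  assumes n: "n \<ge> 2" and T: "T \<in> TT n" and q: "\<not> q dvd 1"
    and mono: "\<And>\<beta>. \<beta> \<in> exps n (dd n) \<Longrightarrow> Poly_Mapping.single \<beta> 1 \<in> GT_ideal n T q"
  shows "\<exists>I. I \<subseteq> {..<DD n} \<and> card I = CC n \<and> \<not> q dvd det (submatrix (MT n T) I UNIV)"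
proof -
  have im: "GT n T ` {1..n - 1} = (\<lambda>j. GT n T (Suc j)) ` {..<n - 1}"
    using image_Suc_lessThan[of "n - 1"] by (metis image_image)
  have "\<exists>c. \<forall>\<beta>\<in>exps n (dd n). Poly_Mapping.single \<beta> 1 - (\<Sum>j<n - 1. c \<beta> j * GT n T (Suc j)) \<in> ideal_span {zconst q}"
    using span_Un_image_lessThan[OF mono[unfolded GT_ideal_def im]] by (intro bchoice) blast
  then obtain c where c: "\<And>\<beta>. \<beta> \<in> exps n (dd n) \<Longrightarrow>
      Poly_Mapping.single \<beta> 1 - (\<Sum>j<n - 1. c \<beta> j * GT n T (Suc j)) \<in> ideal_span {zconst q}"
    by blast
  \<comment> \<open>Rows carry i \<ge> 1 while the multipliers are numbered from 0:
    \<open>c \<beta> j\<close> belongs to \<open>GT n T (Suc j)\<close>.\<close>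
  define Q where "Q = mat (CC n) (DD n) (\<lambda>(k, r). case row_list n ! r of (i, \<alpha>) \<Rightarrow>
    Poly_Mapping.lookup (c (col_list n ! k) (i - 1)) \<alpha>)"
  have Q: "Q \<in> carrier_mat (CC n) (DD n)" by (simp add: Q_def)
  show ?thesis
  proof (rule exists_minor_not_dvd[OF MT_carrier Q q])
    fix k l assume k: "k < CC n" and l: "l < CC n"
    let ?\<beta> = "col_list n ! k" and ?\<gamma> = "col_list n ! l"
    have \<beta>: "?\<beta> \<in> exps n (dd n)" and \<gamma>: "?\<gamma> \<in> exps n (dd n)"
      using k l by (metis length_col_list[OF n] nth_mem set_col_list)+
    define h where "h = (\<lambda>(i, \<alpha>). Poly_Mapping.lookup (c ?\<beta> (i - 1)) \<alpha> *
      Poly_Mapping.lookup (GT n T i * Poly_Mapping.single \<alpha> 1) ?\<gamma>)"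
    have "(Q * MT n T) $$ (k, l) = (\<Sum>r<DD n. Q $$ (k, r) * MT n T $$ (r, l))"
      using k l Q MT_carrier[of n T] by (simp add: scalar_prod_def atLeast0LessThan)
    also have "\<dots> = (\<Sum>r<DD n. h (row_list n ! r))"
      using k l by (intro sum.cong refl) (simp add: Q_def MT_def h_def split: prod.splits)
    also have "\<dots> = (\<Sum>i\<in>{1..n - 1}. \<Sum>\<alpha>\<in>exps n (dd n - i). h (i, \<alpha>))"
      by (rule sum_row_list[OF n])
    also have "\<dots> = (\<Sum>i\<in>{1..n - 1}. Poly_Mapping.lookup (c ?\<beta> (i - 1) * GT n T i) ?\<gamma>)"
      by (intro sum.cong refl) (simp add: h_def lookup_mult_GT[OF T _ \<gamma>])
    also have "\<dots> = (\<Sum>j<n - 1. Poly_Mapping.lookup (c ?\<beta> j * GT n T (Suc j)) ?\<gamma>)"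
    proof -
      have "{1..n - 1} = Suc ` {..<n - 1}" by (simp add: image_Suc_lessThan)
      then show ?thesis by (simp add: sum.reindex)
    qed
    also have "\<dots> = Poly_Mapping.lookup (\<Sum>j<n - 1. c ?\<beta> j * GT n T (Suc j)) ?\<gamma>"
      by (simp add: lookup_sum)
    finally have QM: "(Q * MT n T) $$ (k, l) = Poly_Mapping.lookup (\<Sum>j<n - 1. c ?\<beta> j * GT n T (Suc j)) ?\<gamma>" .
    obtain b where "Poly_Mapping.single ?\<beta> 1 - (\<Sum>j<n - 1. c ?\<beta> j * GT n T (Suc j)) = b * zconst q"
      using c[OF \<beta>] unfolding gen.span_singleton by blast
    from arg_cong[OF this, of "\<lambda>P. Poly_Mapping.lookup P ?\<gamma>"]
    have "(1 when ?\<beta> = ?\<gamma>) - (Q * MT n T) $$ (k, l) = q * Poly_Mapping.lookup b ?\<gamma>"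
      by (auto simp: QM lookup_minus lookup_single lookup_zconst_mult when_def)
    then have "q dvd (1 when ?\<beta> = ?\<gamma>) - (Q * MT n T) $$ (k, l)" by simp
    moreover have "(?\<beta> = ?\<gamma>) = (k = l)"
      using nth_eq_iff_index_eq[OF distinct_col_list] k l length_col_list[OF n] by simp
    ultimately show "[(Q * MT n T) $$ (k, l) = (if k = l then 1 else 0)] (mod q)"
      by (simp add: cong_iff_dvd_diff dvd_diff_commute when_def)
  qed
qed

lemma dvd_JT_iff:
  "q dvd JT n T \<longleftrightarrow> (\<forall>I. I \<subseteq> {..<DD n} \<and> card I = CC n \<longrightarrow> q dvd det (submatrix (MT n T) I UNIV))"
  unfolding JT_def dvd_Gcd_iff by blast

section \<open>Non-trivial zeros in an algebraically closed field\<close>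

text \<open>The fields of the theorem are ring records, so the type of integer polynomials is turned
  into a record as well; points over K are ring homomorphisms from it.\<close>

abbreviation ZX :: "zpoly ring" where "ZX \<equiv> ring_of_type_algebra"

lemma ZX_simps [simp]:
  "carrier ZX = UNIV" "x \<otimes>\<^bsub>ZX\<^esub> y = x * y" "x \<oplus>\<^bsub>ZX\<^esub> y = x + y" "\<one>\<^bsub>ZX\<^esub> = 1" "\<zero>\<^bsub>ZX\<^esub> = 0"
  by (simp_all add: ring_of_type_algebra_def)

lemma ZX_cring: "cring ZX" and ZX_ring: "ring ZX"
  by (rule cring_from_type_algebra ring_from_type_algebra)+

lemma ideal_ZX_iff: "ideal J ZX \<longleftrightarrow> is_ideal J"
proof
  assume "ideal J ZX"
  then interpret ideal J ZX .
  show "is_ideal J"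
  proof (rule gen.subspaceI)
    show "0 \<in> J" using a_closed additive_subgroup.zero_closed[OF additive_subgroup_axioms] by simp
    show "x + y \<in> J" if "x \<in> J" "y \<in> J" for x y
      using additive_subgroup.a_closed[OF additive_subgroup_axioms that] by simp
    show "c * x \<in> J" if "x \<in> J" for c x
      using I_l_closed[OF that, of c] by simp
  qed
next
  assume J: "is_ideal J"
  interpret cring ZX by (rule ZX_cring)
  show "ideal J ZX"
  proof (rule idealI[OF ZX_ring])
    have minus: "\<ominus>\<^bsub>ZX\<^esub> x = - x" for x
      by (rule minus_equality) simp_all
    show "subgroup J (add_monoid ZX)"
      by (rule add.subgroupI)
        (use gen.subspace_0[OF J] gen.subspace_neg[OF J] gen.subspace_add[OF J] in \<open>auto simp: minus simp flip: a_inv_def\<close>)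
  qed (use ideal_mult_left[OF J] ideal_mult_right[OF J] in auto)
qed

lemma exists_maximal_ideal:
  assumes J: "is_ideal J" and one: "1 \<notin> J"
  shows "\<exists>M. J \<subseteq> M \<and> maximalideal M ZX"
proof -
  define \<A> where "\<A> = {I. is_ideal I \<and> J \<subseteq> I \<and> 1 \<notin> I}"
  have "\<exists>M\<in>\<A>. \<forall>I\<in>\<A>. M \<subseteq> I \<longrightarrow> I = M"
  proof (rule subset_Zorn_nonempty)
    show "\<A> \<noteq> {}" using assms by (auto simp: \<A>_def)
    fix C assume C: "C \<noteq> {}" "subset.chain \<A> C"
    have mem: "is_ideal I" "J \<subseteq> I" "1 \<notin> I" if "I \<in> C" for I
      using C(2) that by (auto simp: \<A>_def subset.chain_def)
    have "is_ideal (\<Union>C)"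
    proof (rule gen.subspaceI)
      show "0 \<in> \<Union>C" using C(1) mem gen.subspace_0 by blast
      show "c * x \<in> \<Union>C" if "x \<in> \<Union>C" for c x using that mem ideal_mult_left by blast
      fix x y assume "x \<in> \<Union>C" "y \<in> \<Union>C"
      then obtain I I' where I: "I \<in> C" "x \<in> I" "I' \<in> C" "y \<in> I'" by blast
      then have "I \<subseteq> I' \<or> I' \<subseteq> I" using C(2) by (auto simp: subset.chain_def)
      then show "x + y \<in> \<Union>C"
        using I mem gen.subspace_add by (metis UnionI subsetD)
    qed
    moreover have "J \<subseteq> \<Union>C" using C(1) mem(2) by blast
    ultimately show "\<Union>C \<in> \<A>" using mem(3) by (auto simp: \<A>_def)
  qed
  then obtain M where M: "is_ideal M" "J \<subseteq> M" "1 \<notin> M" and max: "\<And>I. I \<in> \<A> \<Longrightarrow> M \<subseteq> I \<Longrightarrow> I = M"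
    by (auto simp: \<A>_def)
  have "maximalideal M ZX"
  proof (rule maximalidealI)
    show "ideal M ZX" using M by (simp add: ideal_ZX_iff)
    show "carrier ZX \<noteq> M" using M(3) by auto
    fix I assume I: "ideal I ZX" "M \<subseteq> I"
    show "I = M \<or> I = carrier ZX"
    proof (cases "1 \<in> I")
      case True
      then have "x \<in> I" for x using ideal_mult_left[of I 1 x] I(1) by (simp add: ideal_ZX_iff)
      then show ?thesis by auto
    next
      case False
      then have "I \<in> \<A>" using I M(2) by (auto simp: \<A>_def ideal_ZX_iff)
      then show ?thesis using max I(2) by blast
    qed
  qed
  then show ?thesis using M(2) by blast
qed

text \<open>Surjectivity of h is kept because it makes the residue field countable.\<close>

lemma exists_field_quotient:
  assumes J: "is_ideal J" and one: "1 \<notin> J"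
  shows "\<exists>(F :: zpoly set ring) h. field F \<and> h \<in> Ring.ring_hom ZX F \<and> carrier F = range h \<and> (\<forall>x\<in>J. h x = \<zero>\<^bsub>F\<^esub>)"
proof -
  obtain M where M: "J \<subseteq> M" "maximalideal M ZX" using exists_maximal_ideal[OF assms] by blast
  interpret maximalideal M ZX by (rule M(2))
  have "field (ZX Quot M)" by (rule quotient_is_field[OF ZX_cring])
  moreover have "(+>\<^bsub>ZX\<^esub>) M \<in> Ring.ring_hom ZX (ZX Quot M)" by (rule rcos_ring_hom)
  moreover have "carrier (ZX Quot M) = range ((+>\<^bsub>ZX\<^esub>) M)"
    unfolding FactRing_def by (auto simp: A_RCOSETS_def')
  moreover have "M +>\<^bsub>ZX\<^esub> x = \<zero>\<^bsub>ZX Quot M\<^esub>" if "x \<in> J" for x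
    using M(1) that a_rcos_const by (auto simp: FactRing_simps)
  ultimately show ?thesis by blast
qed

section \<open>Countability, and copying an algebraic closure into a given type\<close>

lemma countable_poly_mapping:
  assumes "countable (UNIV :: 'b set)" and "countable (UNIV :: 'c::zero set)"
  shows "countable (UNIV :: ('b \<Rightarrow>\<^sub>0 'c) set)"
proof -
  define g where "g P = (\<lambda>k. (k, Poly_Mapping.lookup P k)) ` Poly_Mapping.keys P" for P :: "'b \<Rightarrow>\<^sub>0 'c"
  have "inj g"
  proof (rule injI)
    fix P Q assume eq: "g P = g Q"
    have lk: "Poly_Mapping.lookup P k = c \<longleftrightarrow> (k, c) \<in> g P" if "c \<noteq> 0" for P k c
      using that by (auto simp: g_def in_keys_iff)
    show "P = Q"
    proof (rule poly_mapping_eqI)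
      fix k show "Poly_Mapping.lookup P k = Poly_Mapping.lookup Q k"
        using lk[of _ P k] lk[of _ Q k] eq by metis
    qed
  qed
  moreover have "countable (range g)"
  proof (rule countable_subset)
    show "range g \<subseteq> {A. finite A \<and> A \<subseteq> UNIV}" by (auto simp: g_def)
    have "countable (UNIV \<times> UNIV :: ('b \<times> 'c) set)" by (intro countable_SIGMA assms)
    then show "countable {A :: ('b \<times> 'c) set. finite A \<and> A \<subseteq> UNIV}"
      by (intro countable_Collect_finite_subset) simp
  qed
  ultimately show ?thesis using countable_image_inj_on by blast
qed

lemma countable_zpoly: "countable (UNIV :: zpoly set)"
  by (intro countable_poly_mapping countableI_type)

text \<open>Every element is a root of one of countably many nonzero polynomials, each with finitely
  many roots.\<close>

lemma countable_algebraic_closure: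
  assumes "algebraic_closure L K" and "countable K"
  shows "countable (carrier L)"
proof -
  interpret algebraic_closure L K by (rule assms(1))
  have sub: "subring K L" using subfieldE(1)[OF subfield_axioms] .
  have sub_roots: "carrier L \<subseteq> (\<Union>p\<in>{p \<in> carrier (K[X]\<^bsub>L\<^esub>). p \<noteq> []}. {x. is_root p x})"
  proof
    fix x assume x: "x \<in> carrier L"
    from algebraicE[OF sub x algebraic_extension[OF x]]
    obtain p where "p \<in> carrier (K[X]\<^bsub>L\<^esub>)" "p \<noteq> []" "eval p x = \<zero>\<^bsub>L\<^esub>" by blast
    then show "x \<in> (\<Union>p\<in>{p \<in> carrier (K[X]\<^bsub>L\<^esub>). p \<noteq> []}. {x. is_root p x})"
      using x by (auto simp: is_root_def)
  qed
  have "countable {p \<in> carrier (K[X]\<^bsub>L\<^esub>). p \<noteq> []}"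
  proof (rule countable_subset)
    show "{p \<in> carrier (K[X]\<^bsub>L\<^esub>). p \<noteq> []} \<subseteq> lists K"
      using polynomial_incl by (auto simp: univ_poly_carrier[symmetric])
    show "countable (lists K)" using assms(2) by (rule countable_lists)
  qed
  moreover have "countable {x. is_root p x}" if "p \<in> carrier (K[X]\<^bsub>L\<^esub>)" for p
    using finite_number_of_roots[OF carrier_polynomial_shell[OF sub that]] by (rule countable_finite)
  ultimately have "countable (\<Union>p\<in>{p \<in> carrier (K[X]\<^bsub>L\<^esub>). p \<noteq> []}. {x. is_root p x})"
    by (intro countable_UN) blast+
  then show ?thesis by (rule countable_subset[OF sub_roots])
qed

lemma (in algebraically_closed) exists_root_of_degree_pos:
  assumes "p \<in> carrier (poly_ring L)" "Polynomials.degree p > 0"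
  shows "\<exists>x\<in>carrier L. eval p x = \<zero>"
proof -
  have "roots p \<noteq> {#}"
    using roots_over_carrier[OF assms(1)] assms(2) by (auto simp: splitted_def)
  then obtain a where "a \<in># roots p" by blast
  then show ?thesis using roots_mem_iff_is_root[OF assms(1)] by (auto simp: is_root_def)
qed

lemma algebraically_closed_iso:
  assumes "algebraically_closed L" and "field K" and f: "f \<in> ring_iso L K"
  shows "algebraically_closed K"
proof -
  interpret L: algebraically_closed L by (rule assms(1))
  interpret K: field K by (rule assms(2))
  define g where "g = inv_into (carrier L) f"
  have g: "g \<in> ring_iso K L" unfolding g_def by (rule ring_iso_set_sym[OF L.is_ring f])
  interpret F: ring_hom_ring L K f
    using f by (intro ring_hom_ringI2 L.is_ring K.is_ring) (simp add: ring_iso_def)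
  interpret G: ring_hom_ring K L g
    using g by (intro ring_hom_ringI2 L.is_ring K.is_ring) (simp add: ring_iso_def)
  have fg: "f (g y) = y" if "y \<in> carrier K" for y
    using f that unfolding g_def by (intro f_inv_into_f) (auto simp: ring_iso_def bij_betw_def)
  show ?thesis
  proof (rule K.algebraically_closedI)
    fix p assume p: "p \<in> carrier (poly_ring K)" "Polynomials.degree p > 1"
    then have pc: "set p \<subseteq> carrier K" "p \<noteq> []" and lead: "Polynomials.lead_coeff p \<noteq> \<zero>\<^bsub>K\<^esub>"
      by (auto simp: univ_poly_carrier[symmetric] polynomial_def)
    have fgp: "map f (map g p) = p" unfolding map_map by (rule map_idI) (use fg pc(1) in auto)
    have "g (Polynomials.lead_coeff p) \<noteq> \<zero>\<^bsub>L\<^esub>"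
      using fg[of "Polynomials.lead_coeff p"] pc lead by (metis F.hom_zero hd_in_set subsetD)
    then have "map g p \<in> carrier (poly_ring L)"
      using pc by (auto simp: univ_poly_carrier[symmetric] polynomial_def hd_map)
    moreover have "Polynomials.degree (map g p) > 0" using p(2) by simp
    ultimately obtain x where x: "x \<in> carrier L" "L.eval (map g p) x = \<zero>\<^bsub>L\<^esub>"
      using L.exists_root_of_degree_pos by blast
    have "set (map g p) \<subseteq> carrier L" using pc(1) by auto
    from F.eval_hom'[OF x(1) this] have "K.eval p (f x) = \<zero>\<^bsub>K\<^esub>" by (simp only: fgp x(2) F.hom_zero)
    then show "\<exists>y\<in>carrier K. K.eval p y = \<zero>\<^bsub>K\<^esub>" using x(1) F.hom_closed by blast
  qed
qed

text \<open>The algebraic closure comes with a type of its own. Its carrier is countable, so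
  numbering it and embedding the numbers into \<open>'a\<close> is injective, and the ring structure
  moves along.\<close>

lemma exists_algebraically_closed_extension:
  fixes F :: "'b ring"
  assumes "infinite (UNIV :: 'a set)" "field F" "countable (carrier F)"
  shows "\<exists>(K :: 'a ring) h. algebraically_closed K \<and> h \<in> Ring.ring_hom F K"
proof -
  interpret F: field F by (rule assms(2))
  obtain L :: "(('b list \<times> nat) multiset \<Rightarrow> 'b) ring"
    where L: "algebraic_closure L (F.indexed_const ` carrier F)"
    and emb: "F.indexed_const \<in> Ring.ring_hom F L"
    by (rule F.exists_closure)
  interpret L: algebraic_closure L "F.indexed_const ` carrier F" by (rule L)
  have cnt: "countable (carrier L)"
    by (rule countable_algebraic_closure[OF L]) (use assms(3) in simp)
  obtain e :: "nat \<Rightarrow> 'a" where e: "inj e"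
    using infinite_countable_subset[OF assms(1)] by blast
  define f where "f = e \<circ> to_nat_on (carrier L)"
  have inj: "inj_on f (carrier L)"
    unfolding f_def using cnt e by (intro comp_inj_on inj_on_to_nat_on) (auto intro: inj_on_subset)
  have iso: "f \<in> ring_iso L (image_ring f L)" by (rule inj_imp_image_ring_iso[OF inj])
  have "algebraically_closed (image_ring f L)"
    by (rule algebraically_closed_iso[OF L.algebraically_closed_axioms L.inj_imp_image_ring_is_field[OF inj] iso])
  moreover have "f \<circ> F.indexed_const \<in> Ring.ring_hom F (image_ring f L)"
    using iso emb by (intro ring_hom_trans) (auto simp: ring_iso_def)
  ultimately show ?thesis by blast
qed

section \<open>Points with x_k = 1 in characteristic p\<close>

lemma hpart_mult_homog_small:
  assumes G: "homog V d G" and d: "e < d"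
  shows "hpart V e (P * G) = 0"
proof (rule poly_mapping_eqI)
  fix \<gamma>
  have "\<gamma> \<notin> Poly_Mapping.keys (P * G)" if "wdeg V \<gamma> = e"
    using that keys_mult[of P G] G d by (fastforce simp: homog_def wdeg_add)
  then show "Poly_Mapping.lookup (hpart V e (P * G)) \<gamma> = Poly_Mapping.lookup 0 \<gamma>"
    by (auto simp: lookup_hpart in_keys_iff)
qed

text \<open>For homogeneous b, a component of c b is 0 or a component of c times b.\<close>

lemma hpart_in_homog_ideal:
  assumes B: "\<And>b. b \<in> B \<Longrightarrow> \<exists>d. homog V d b" and y: "y \<in> ideal_span B"
  shows "hpart V e y \<in> ideal_span B"
  using y
proof (induction rule: gen.span_induct_alt)
  case base
  then show ?case by (simp add: gen.span_zero)
next
  case (step c b y)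
  obtain d where d: "homog V d b" using B step(1) by blast
  have "hpart V e (c * b) \<in> ideal_span B"
  proof (cases "d \<le> e")
    case True
    then show ?thesis using hpart_mult_homog[OF d] gen.span_scale[OF gen.span_base[OF step(1)]] by simp
  next
    case False
    then show ?thesis using hpart_mult_homog_small[OF d] by (simp add: gen.span_zero)
  qed
  then show ?case unfolding hpart_add by (rule gen.span_add) (rule step(2))
qed

text \<open>Homogenising with respect to \<open>x\<^sub>k\<close> turns \<open>1 = y + c (x\<^sub>k - 1)\<close> into \<open>x\<^sub>k^N \<in> (B)\<close>.\<close>

lemma one_notin_dehomogenised:
  assumes V: "finite V" "k \<in> V"
    and B: "\<And>b. b \<in> B \<Longrightarrow> \<exists>d. homog V d b"
    and nil: "\<And>N. xvar k ^ N \<notin> ideal_span B"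
  shows "1 \<notin> ideal_span (insert (xvar k - 1) B)"
proof
  assume "1 \<in> ideal_span (insert (xvar k - 1) B)"
  then obtain c where y: "1 - c * (xvar k - 1) \<in> ideal_span B"
    unfolding gen.span_breakdown_eq by blast
  define N where "N = Suc (\<Sum>\<alpha>\<in>Poly_Mapping.keys c. wdeg V \<alpha>)"
  have cN: "hpart V N c = 0"
  proof (rule poly_mapping_eqI)
    fix \<alpha>
    have "wdeg V \<alpha> < N" if "\<alpha> \<in> Poly_Mapping.keys c"
      using member_le_sum[of \<alpha> "Poly_Mapping.keys c" "wdeg V"] that by (simp add: N_def)
    then show "Poly_Mapping.lookup (hpart V N c) \<alpha> = Poly_Mapping.lookup 0 \<alpha>"
      by (auto simp: lookup_hpart in_keys_iff)
  qed
  \<comment> \<open>Homogenisation to degree N, with x_k as the homogenising variable: it sends 1 to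
    x_k^N, takes the same value on c x_k and c because c has no component of degree N, and preserves
    the ideal of \<open>B\<close>.\<close>
  let ?\<theta> = "\<lambda>P. \<Sum>e\<le>N. xvar k ^ (N - e) * hpart V e P"
  have x: "homog V 1 (xvar k)" by (rule homog_xvar[OF V])
  have "?\<theta> 1 = xvar k ^ N"
  proof -
    have "?\<theta> 1 = (\<Sum>e\<le>N. if e = 0 then xvar k ^ N else 0)"
      by (intro sum.cong refl) (simp add: hpart_homog[OF homog_one])
    then show ?thesis by simp
  qed
  moreover have "?\<theta> (c * xvar k) = ?\<theta> c"
  proof -
    have "?\<theta> (c * xvar k) = (\<Sum>e\<le>N. if e = 0 then 0 else xvar k ^ (N - (e - 1)) * hpart V (e - 1) c)"
    proof (intro sum.cong refl)
      fix e assume e: "e \<in> {..N}"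
      show "xvar k ^ (N - e) * hpart V e (c * xvar k) =
          (if e = 0 then 0 else xvar k ^ (N - (e - 1)) * hpart V (e - 1) c)"
      proof (cases e)
        case 0
        then show ?thesis using hpart_mult_homog_small[OF x] by simp
      next
        case (Suc e')
        then have "N - e' = Suc (N - e)" using e by auto
        then show ?thesis using hpart_mult_homog[OF x, of e c] Suc by (simp add: mult_ac)
      qed
    qed
    also have "\<dots> = (\<Sum>e<N. xvar k ^ (N - e) * hpart V e c)"
      unfolding sum.atMost_shift by simp
    also have "\<dots> = ?\<theta> c" by (simp add: cN flip: lessThan_Suc_atMost)
    finally show ?thesis .
  qed
  moreover have "?\<theta> (1 - c * (xvar k - 1)) = ?\<theta> 1 - (?\<theta> (c * xvar k) - ?\<theta> c)"
    by (simp add: hpart_diff algebra_simps sum.distrib sum_subtractf hpart_add)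
  ultimately have "xvar k ^ N = ?\<theta> (1 - c * (xvar k - 1))" by simp
  also have "\<dots> \<in> ideal_span B"
    by (intro gen.span_sum gen.span_scale) (rule hpart_in_homog_ideal[OF B y])
  finally show False using nil by blast
qed

text \<open>The integers mapped to 0 form an ideal that does not contain 1; once it contains the
  prime p, Bezout shows that it is the set of multiples of p.\<close>

lemma
  assumes K: "field K" and \<Phi>: "\<Phi> \<in> Ring.ring_hom ZX K" and p: "prime p"
  shows ring_char_eqI: "\<Phi> (zconst (int p)) = \<zero>\<^bsub>K\<^esub> \<Longrightarrow> ring_char K = p"
    and ring_hom_ZX_zconst_dvd: "ring_char K = p \<Longrightarrow> \<Phi> (zconst c) = \<zero>\<^bsub>K\<^esub> \<Longrightarrow> int p dvd c"
proof -
  interpret K: field K by (rule K)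
  interpret H: ring_hom_ring ZX K \<Phi> by (rule ring_hom_ringI2[OF ZX_ring K.is_ring \<Phi>])
  have add: "\<Phi> (x + y) = \<Phi> x \<oplus>\<^bsub>K\<^esub> \<Phi> y" and mult: "\<Phi> (x * y) = \<Phi> x \<otimes>\<^bsub>K\<^esub> \<Phi> y" for x y
    using H.hom_add[of x y] H.hom_mult[of x y] by simp_all
  have one: "\<Phi> 1 = \<one>\<^bsub>K\<^esub>" and zero: "\<Phi> 0 = \<zero>\<^bsub>K\<^esub>" using H.hom_one H.hom_zero by simp_all
  have clos: "\<Phi> x \<in> carrier K" for x using H.hom_closed by simp
  have nat: "\<Phi> (of_nat m) = add_pow K m \<one>\<^bsub>K\<^esub>" for m
    by (induction m) (simp_all add: zero one add K.a_comm clos)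
  have cop: "int p dvd c" if c: "\<Phi> (zconst c) = \<zero>\<^bsub>K\<^esub>" and pz: "\<Phi> (zconst (int p)) = \<zero>\<^bsub>K\<^esub>" for c
  proof (rule ccontr)
    assume "\<not> int p dvd c"
    then have "coprime (int p) c" using p by (simp add: prime_imp_coprime)
    then obtain u v where "u * int p + v * c = 1" using bezout_int[of "int p" c] by (auto simp: coprime_iff_gcd_eq_1)
    moreover have "zconst u * zconst (int p) + zconst v * zconst c = zconst (u * int p + v * c)"
      by (simp only: mult_single single_add add_0)
    ultimately have "zconst u * zconst (int p) + zconst v * zconst c = 1" by simp
    then have "\<Phi> u' \<otimes>\<^bsub>K\<^esub> \<zero>\<^bsub>K\<^esub> \<oplus>\<^bsub>K\<^esub> \<Phi> (zconst v) \<otimes>\<^bsub>K\<^esub> \<zero>\<^bsub>K\<^esub> = \<one>\<^bsub>K\<^esub>" if "u' = zconst u" for u'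
      using that by (metis add mult one c pz)
    then show False using clos K.one_not_zero by simp
  qed
  have zc: "zconst (int m) = of_nat m" for m by simp
  show "ring_char K = p" if "\<Phi> (zconst (int p)) = \<zero>\<^bsub>K\<^esub>"
  proof -
    have p0: "p > 0 \<and> add_pow K p \<one>\<^bsub>K\<^esub> = \<zero>\<^bsub>K\<^esub>"
      using that nat[of p] p prime_gt_0_nat by (simp only: zc)
    have "(LEAST m::nat. m > 0 \<and> add_pow K m \<one>\<^bsub>K\<^esub> = \<zero>\<^bsub>K\<^esub>) = p"
    proof (rule Least_equality)
      show "p > 0 \<and> add_pow K p \<one>\<^bsub>K\<^esub> = \<zero>\<^bsub>K\<^esub>" by (rule p0)
      fix m :: nat assume m: "m > 0 \<and> add_pow K m \<one>\<^bsub>K\<^esub> = \<zero>\<^bsub>K\<^esub>"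
      then have "\<Phi> (zconst (int m)) = \<zero>\<^bsub>K\<^esub>" by (simp only: zc nat)
      then have "int p dvd int m" using cop that by blast
      then show "p \<le> m" using m by (simp add: dvd_imp_le)
    qed
    then show ?thesis using p0 unfolding ring_char_def by auto
  qed
  have pz: "\<Phi> (zconst (int p)) = \<zero>\<^bsub>K\<^esub>" if "ring_char K = p"
  proof -
    have ex: "\<exists>m::nat. m > 0 \<and> add_pow K m \<one>\<^bsub>K\<^esub> = \<zero>\<^bsub>K\<^esub>"
      using that p prime_gt_0_nat[of p] unfolding ring_char_def by (metis less_irrefl)
    have "add_pow K p \<one>\<^bsub>K\<^esub> = \<zero>\<^bsub>K\<^esub>"
      using LeastI_ex[OF ex] ex that unfolding ring_char_def by auto
    then show ?thesis by (simp only: zc nat)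
  qed
  show "int p dvd c" if "ring_char K = p" "\<Phi> (zconst c) = \<zero>\<^bsub>K\<^esub>"
    using cop pz that by blast
qed

text \<open>Forcing x_k = 1 keeps the zero away from the origin, and the generator p fixes the
  characteristic of the residue field.\<close>

lemma exists_nontrivial_zero:
  assumes inf: "infinite (UNIV :: 'a set)" and p: "prime p" and T: "T \<in> TT n" and k: "k \<in> {1..n - 1}"
    and nil: "\<And>N. xvar k ^ N \<notin> GT_ideal n T (int p)"
  shows "\<exists>(K :: 'a ring) \<Phi>. algebraically_closed K \<and> ring_char K = p \<and> \<Phi> \<in> Ring.ring_hom ZX K \<and>
    (\<forall>i\<in>{1..n - 1}. \<Phi> (GT n T i) = \<zero>\<^bsub>K\<^esub>) \<and> \<Phi> (xvar k) = \<one>\<^bsub>K\<^esub>"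
proof -
  let ?B = "{zconst (int p)} \<union> GT n T ` {1..n - 1}"
  let ?J = "ideal_span (insert (xvar k - 1) ?B)"
  have "1 \<notin> ?J"
  proof (rule one_notin_dehomogenised[where V = "{1..n - 1}"])
    show "\<exists>d. homog {1..n - 1} d b" if "b \<in> ?B" for b
      using that
    proof
      assume "b \<in> GT n T ` {1..n - 1}"
      then obtain i where i: "i \<in> {1..n - 1}" "b = GT n T i" by blast
      then have "T i \<in> {1..n}" using T by (auto simp: TT_def)
      then show ?thesis using homog_GT[where T = T, OF i(1)] i(2) by blast
    next
      assume "b \<in> {zconst (int p)}"
      then have "b = zconst (int p)" by blast
      then show ?thesis using homog_const by metis
    qed
    show "xvar k ^ N \<notin> ideal_span ?B" for N using nil[of N] unfolding GT_ideal_def .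
    show "finite {1..n - 1}" "k \<in> {1..n - 1}" using k by simp_all
  qed
  from exists_field_quotient[OF gen.subspace_span this]
  obtain F :: "zpoly set ring" and h where F: "field F" "h \<in> Ring.ring_hom ZX F" "carrier F = range h"
    and h0: "\<forall>x\<in>?J. h x = \<zero>\<^bsub>F\<^esub>"
    by (elim exE conjE)
  have "countable (carrier F)" unfolding F(3) by (rule countable_image[OF countable_zpoly])
  then obtain K :: "'a ring" and g where K: "algebraically_closed K" and g: "g \<in> Ring.ring_hom F K"
    using exists_algebraically_closed_extension[OF inf F(1)] by blast
  interpret K: algebraically_closed K by (rule K)
  interpret F: field F by (rule F(1))
  interpret g: ring_hom_ring F K g by (rule ring_hom_ringI2[OF F.is_ring K.is_ring g])
  have \<Phi>: "g \<circ> h \<in> Ring.ring_hom ZX K" using F(2) g by (rule ring_hom_trans)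
  then interpret H: ring_hom_ring ZX K "g \<circ> h" by (rule ring_hom_ringI2[OF ZX_ring K.is_ring])
  have zero: "(g \<circ> h) b = \<zero>\<^bsub>K\<^esub>" if "b \<in> insert (xvar k - 1) ?B" for b
    using bspec[OF h0 gen.span_base[OF that]] by simp
  have "ring_char K = p"
    by (rule ring_char_eqI[OF K.field_axioms \<Phi> p], rule zero) blast
  moreover have "(g \<circ> h) (xvar k) = \<one>\<^bsub>K\<^esub>"
    using H.hom_add[of "xvar k - 1" 1] zero[of "xvar k - 1"] H.hom_one by simp
  ultimately show ?thesis using K \<Phi> zero by blast
qed

section \<open>Casas--Alvero polynomials from zeros and conversely\<close>

text \<open>\<open>zeval\<close> takes values in type class rings only; evaluation in a ring record
  is assembled from \<open>finprod\<close>, \<open>finsum\<close> and integer multiples.\<close>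

definition (in cring) zx_monom :: "(nat \<Rightarrow> 'a) \<Rightarrow> (nat \<Rightarrow>\<^sub>0 nat) \<Rightarrow> 'a" where
  "zx_monom x m = (\<Otimes>k\<in>Poly_Mapping.keys m. x k [^] Poly_Mapping.lookup m k)"

definition (in cring) zx_eval :: "(nat \<Rightarrow> 'a) \<Rightarrow> zpoly \<Rightarrow> 'a" where
  "zx_eval x P = (\<Oplus>m\<in>Poly_Mapping.keys P. [Poly_Mapping.lookup P m] \<cdot> zx_monom x m)"

lemma zpoly_single_induct:
  assumes "\<And>m c. Q (Poly_Mapping.single m c)" and "\<And>P P' :: zpoly. Q P \<Longrightarrow> Q P' \<Longrightarrow> Q (P + P')"
  shows "Q (P :: zpoly)"
proof -
  have zero: "Q 0" using assms(1)[of 0 0] by simp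
  have sum: "Q (sum f I)" if "\<And>i. Q (f i)" for f and I :: "(nat \<Rightarrow>\<^sub>0 nat) set"
    using zero
  proof (induction I rule: infinite_finite_induct)
    case (insert i I)
    then show ?case using assms(2)[OF that[of i]] by simp
  qed simp_all
  have "Q (\<Sum>m\<in>Poly_Mapping.keys P. Poly_Mapping.single m (Poly_Mapping.lookup P m))"
    by (rule sum, rule assms(1))
  then show ?thesis using zpoly_eq_sum[of P] by simp
qed

context cring
begin

context
  fixes x :: "nat \<Rightarrow> 'a"
  assumes x: "\<And>k. x k \<in> carrier R"
begin

lemma zx_monom_closed: "zx_monom x m \<in> carrier R"
  unfolding zx_monom_def by (intro finprod_closed) (use x in auto)

lemma zx_monom_superset:
  "finite A \<Longrightarrow> Poly_Mapping.keys m \<subseteq> A \<Longrightarrow> zx_monom x m = (\<Otimes>k\<in>A. x k [^] Poly_Mapping.lookup m k)"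
  unfolding zx_monom_def
  by (rule finprod_mono_neutral_cong_left) (use x in \<open>auto simp: in_keys_iff\<close>)

lemma zx_monom_add: "zx_monom x (m + m') = zx_monom x m \<otimes> zx_monom x m'"
proof -
  let ?A = "Poly_Mapping.keys m \<union> Poly_Mapping.keys m'"
  have sup: "zx_monom x q = (\<Otimes>k\<in>?A. x k [^] Poly_Mapping.lookup q k)"
    if "Poly_Mapping.keys q \<subseteq> ?A" for q
    using that by (intro zx_monom_superset) auto
  have "zx_monom x (m + m') = (\<Otimes>k\<in>?A. x k [^] (Poly_Mapping.lookup m k + Poly_Mapping.lookup m' k))"
    using Poly_Mapping.keys_add[of m m'] by (simp add: sup lookup_add)
  also have "\<dots> = (\<Otimes>k\<in>?A. x k [^] Poly_Mapping.lookup m k \<otimes> x k [^] Poly_Mapping.lookup m' k)"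
    by (intro finprod_cong') (use x in \<open>auto simp: nat_pow_mult\<close>)
  also have "\<dots> = zx_monom x m \<otimes> zx_monom x m'"
    using x by (simp add: sup finprod_multf)
  finally show ?thesis .
qed

lemma zx_eval_superset:
  assumes "finite A" "Poly_Mapping.keys P \<subseteq> A"
  shows "zx_eval x P = (\<Oplus>m\<in>A. [Poly_Mapping.lookup P m] \<cdot> zx_monom x m)"
proof -
  have "add_pow R (0 :: int) a = \<zero>" for a by (simp add: add_pow_def int_pow_def)
  then show ?thesis
    unfolding zx_eval_def
    by (intro add.finprod_mono_neutral_cong_left) (use assms zx_monom_closed in \<open>auto simp: in_keys_iff\<close>)
qed

lemma zx_eval_closed: "zx_eval x P \<in> carrier R"
  unfolding zx_eval_def by (intro finsum_closed) (use zx_monom_closed in auto)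

lemma zx_eval_add: "zx_eval x (P + Q) = zx_eval x P \<oplus> zx_eval x Q"
proof -
  let ?A = "Poly_Mapping.keys P \<union> Poly_Mapping.keys Q"
  have sup: "zx_eval x q = (\<Oplus>m\<in>?A. [Poly_Mapping.lookup q m] \<cdot> zx_monom x m)"
    if "Poly_Mapping.keys q \<subseteq> ?A" for q
    using that by (intro zx_eval_superset) auto
  have "zx_eval x (P + Q) =
      (\<Oplus>m\<in>?A. [Poly_Mapping.lookup P m] \<cdot> zx_monom x m \<oplus> [Poly_Mapping.lookup Q m] \<cdot> zx_monom x m)"
    using Poly_Mapping.keys_add[of P Q] by (simp add: sup lookup_add add.int_pow_mult zx_monom_closed)
  also have "\<dots> = zx_eval x P \<oplus> zx_eval x Q"
    using zx_monom_closed by (simp add: sup finsum_addf)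
  finally show ?thesis .
qed

lemma zx_eval_single: "zx_eval x (Poly_Mapping.single m c) = [c] \<cdot> zx_monom x m"
proof -
  have "zx_eval x (Poly_Mapping.single m c) = (\<Oplus>m'\<in>{m}. [Poly_Mapping.lookup (Poly_Mapping.single m c) m'] \<cdot> zx_monom x m')"
    by (rule zx_eval_superset) auto
  then show ?thesis using zx_monom_closed by simp
qed

lemma zx_eval_mult: "zx_eval x (P * Q) = zx_eval x P \<otimes> zx_eval x Q"
proof (induction P rule: zpoly_single_induct)
  case (1 m c)
  show ?case
  proof (induction Q rule: zpoly_single_induct)
    case (1 m' c')
    have "add_pow R (c * c') (zx_monom x m \<otimes> zx_monom x m') = ([c] \<cdot> zx_monom x m) \<otimes> ([c'] \<cdot> zx_monom x m')"
      using zx_monom_closed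
      by (simp add: add_pow_ldistr_int add_pow_rdistr_int add.int_pow_pow mult.commute)
    then show ?case by (simp add: mult_single zx_eval_single zx_monom_add)
  qed (simp add: distrib_left zx_eval_add r_distr zx_eval_closed)
qed (simp add: distrib_right zx_eval_add l_distr zx_eval_closed)

lemma zx_eval_hom: "zx_eval x \<in> Ring.ring_hom ZX R"
proof (rule ring_hom_memI)
  have "zx_eval x 1 = add_pow R (1::int) (zx_monom x 0)"
    using zx_eval_single[of 0 1] by simp
  also have "\<dots> = \<one>" by (simp add: zx_monom_def)
  finally show "zx_eval x \<one>\<^bsub>ZX\<^esub> = \<one>" by simp
qed (simp_all add: zx_eval_closed zx_eval_add zx_eval_mult)

lemma zx_eval_xvar: "zx_eval x (xvar k) = x k"
  using x by (simp add: xvar_def zx_eval_single zx_monom_def)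

end

end

section \<open>Coefficient lists over a field as images of integer polynomials\<close>

lemma ZX_nat_pow: "b [^]\<^bsub>ZX\<^esub> (m::nat) = b ^ m"
proof -
  interpret cring ZX by (rule ZX_cring)
  show ?thesis by (induction m) (simp_all add: mult.commute)
qed

lemma ZX_eval: "ring.eval ZX xs b = (\<Sum>k<length xs. xs ! k * b ^ (length xs - 1 - k))"
proof -
  interpret cring ZX by (rule ZX_cring)
  show ?thesis
  proof (induction xs)
    case (Cons a xs)
    have "(\<Sum>k<length (a # xs). (a # xs) ! k * b ^ (length (a # xs) - 1 - k)) =
        a * b ^ length xs + (\<Sum>k<length xs. xs ! k * b ^ (length xs - 1 - k))"
      unfolding length_Cons sum.lessThan_Suc_shift by simp
    then show ?case using Cons by (simp add: ZX_nat_pow)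
  qed simp
qed

text \<open>\<Phi> stands for the point with coordinates \<Phi>(x_k). Computations with roots and
  derivatives are done for generic polynomials with coefficients in \<open>zpoly\<close>, using the
  type class library, and then mapped to K.\<close>

locale zx_hom = field K for K :: "'a ring" (structure) +
  fixes \<Phi> :: "zpoly \<Rightarrow> 'a"
  assumes hom: "\<Phi> \<in> Ring.ring_hom ZX K"
begin

sublocale H: ring_hom_ring ZX K \<Phi>
  by (rule ring_hom_ringI2[OF ZX_ring is_ring hom])

lemma \<Phi>_simps [simp]:
  "\<Phi> (P + Q) = \<Phi> P \<oplus> \<Phi> Q" "\<Phi> (P * Q) = \<Phi> P \<otimes> \<Phi> Q" "\<Phi> 1 = \<one>" "\<Phi> 0 = \<zero>" "\<Phi> P \<in> carrier K"
  using H.hom_add[of P Q] H.hom_mult[of P Q] H.hom_one H.hom_zero H.hom_closed[of P] by simp_all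

lemma \<Phi>_uminus [simp]: "\<Phi> (- P) = \<ominus> \<Phi> P"
proof -
  have "\<Phi> (- P) \<oplus> \<Phi> P = \<zero>" by (simp flip: \<Phi>_simps(1))
  then show ?thesis using minus_equality by simp
qed

lemma \<Phi>_diff [simp]: "\<Phi> (P - Q) = \<Phi> P \<ominus> \<Phi> Q"
  using \<Phi>_simps(1)[of P "- Q"] by (simp add: a_minus_def)

lemma \<Phi>_power [simp]: "\<Phi> (P ^ m) = \<Phi> P [^] m"
  by (induction m) (simp_all add: m_comm)

lemma \<Phi>_of_nat_mult: "\<Phi> (of_nat m * P) = [m] \<cdot> \<Phi> P"
  by (induction m) (simp_all add: distrib_right a_comm)

lemma \<Phi>_span_zero:
  assumes "\<And>b. b \<in> B \<Longrightarrow> \<Phi> b = \<zero>" "P \<in> ideal_span B"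
  shows "\<Phi> P = \<zero>"
  using assms(2) by (induction rule: gen.span_induct_alt) (simp_all add: assms(1))

lemma eval_map:
  "eval (map \<Phi> xs) (\<Phi> b) = \<Phi> (\<Sum>k<length xs. xs ! k * b ^ (length xs - 1 - k))"
  using H.eval_hom'[of b xs] by (simp add: ZX_eval)

text \<open>The length is n + 1 whatever the degree of F; the list is a valid polynomial if the
  coefficient of X^n has nonzero image, in particular for monic F of degree n.\<close>

definition image_list :: "nat \<Rightarrow> zpoly poly \<Rightarrow> 'a list" where
  "image_list n F = map (\<lambda>k. \<Phi> (Polynomial.coeff F (n - k))) [0..<Suc n]"

lemma eval_image_list:
  assumes "Polynomial.degree F \<le> n"
  shows "eval (image_list n F) (\<Phi> b) = \<Phi> (poly F b)"
proof -
  have "image_list n F = map \<Phi> (map (\<lambda>k. Polynomial.coeff F (n - k)) [0..<Suc n])"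
    by (simp add: image_list_def)
  then have "eval (image_list n F) (\<Phi> b) =
      \<Phi> (\<Sum>k<Suc n. map (\<lambda>k. Polynomial.coeff F (n - k)) [0..<Suc n] ! k * b ^ (n - k))"
    by (simp only: eval_map) simp
  also have "(\<Sum>k<Suc n. map (\<lambda>k. Polynomial.coeff F (n - k)) [0..<Suc n] ! k * b ^ (n - k)) =
      (\<Sum>k<Suc n. Polynomial.coeff F (n - k) * b ^ (n - k))"
    by (intro sum.cong refl) (simp del: upt_Suc)
  also have "\<dots> = (\<Sum>k\<le>n. Polynomial.coeff F k * b ^ k)"
    unfolding lessThan_Suc_atMost
    by (rule sum.reindex_bij_witness[where i = "\<lambda>k. n - k" and j = "\<lambda>k. n - k"]) auto
  also have "\<dots> = poly F b"
    unfolding poly_altdef using assms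
    by (intro sum.mono_neutral_right) (auto simp: Polynomial.coeff_eq_0)
  finally show ?thesis .
qed

lemma hasse_image_list:
  assumes "i \<le> n"
  shows "hasse K i (image_list n F) =
    normalize (map \<Phi> (map (\<lambda>k. of_nat ((n - k) choose i) * Polynomial.coeff F (n - k)) [0..<Suc (n - i)]))"
proof -
  have "add_pow K (((n - k) choose i)) (image_list n F ! k) =
      \<Phi> (of_nat ((n - k) choose i) * Polynomial.coeff F (n - k))" if "k < Suc (n - i)" for k
  proof -
    have "k < Suc n" using that by linarith
    then have "image_list n F ! k = \<Phi> (Polynomial.coeff F (n - k))"
      by (simp add: image_list_def del: upt_Suc)
    then show ?thesis by (simp only: \<Phi>_of_nat_mult)
  qed
  then have "map (\<lambda>k. add_pow K ((n - k) choose i) (image_list n F ! k)) [0..<Suc (n - i)] =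
      map \<Phi> (map (\<lambda>k. of_nat ((n - k) choose i) * Polynomial.coeff F (n - k)) [0..<Suc (n - i)])"
    by (simp del: upt_Suc \<Phi>_simps(2))
  moreover have "length (image_list n F) - 1 = n" by (simp add: image_list_def)
  ultimately show ?thesis by (simp only: hasse_def Let_def Suc_eq_plus1)
qed

lemma hasse_image_list_closed: "i \<le> n \<Longrightarrow> hasse K i (image_list n F) \<in> carrier (poly_ring K)"
  unfolding hasse_image_list univ_poly_carrier[symmetric]
  by (rule normalize_gives_polynomial) auto

text \<open>Stripping leading zeros does not change values, and the binomially weighted sum is the
  Taylor coefficient of \<open>coeff_pcompose_shift\<close>. For the product of the X + y_k and b =
  -y_j this coefficient is one of the forms, by \<open>GT_eq_coeff\<close>.\<close>

lemma eval_hasse_image_list: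
  assumes F: "Polynomial.degree F \<le> n" and i: "i \<le> n"
  shows "eval (hasse K i (image_list n F)) (\<Phi> b) = \<Phi> (Polynomial.coeff (pcompose F [:b, 1:]) i)"
proof -
  let ?c = "\<lambda>k. of_nat ((n - k) choose i) * Polynomial.coeff F (n - k)"
  have "eval (hasse K i (image_list n F)) (\<Phi> b) = eval (map \<Phi> (map ?c [0..<Suc (n - i)])) (\<Phi> b)"
    unfolding hasse_image_list[OF i] by (rule eval_normalize) auto
  also have "\<dots> = \<Phi> (\<Sum>k<Suc (n - i). map ?c [0..<Suc (n - i)] ! k * b ^ (n - i - k))"
    by (simp only: eval_map) simp
  also have "(\<Sum>k<Suc (n - i). map ?c [0..<Suc (n - i)] ! k * b ^ (n - i - k)) =
      (\<Sum>k<Suc (n - i). ?c k * b ^ (n - i - k))"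
    by (intro sum.cong refl) (simp del: upt_Suc)
  also have "\<dots> = (\<Sum>k\<in>{i..n}. of_nat (k choose i) * (Polynomial.coeff F k * b ^ (k - i)))"
    by (rule sum.reindex_bij_witness[where i = "\<lambda>k. n - k" and j = "\<lambda>k. n - k"])
      (use i in \<open>auto simp: mult.assoc add.commute\<close>)
  also have "\<dots> = (\<Sum>k\<le>n. of_nat (k choose i) * (Polynomial.coeff F k * b ^ (k - i)))"
    by (rule sum.mono_neutral_left) (auto simp: binomial_eq_0)
  also have "\<dots> = Polynomial.coeff (pcompose F [:b, 1:]) i"
    by (rule coeff_pcompose_shift[OF F, symmetric])
  finally show ?thesis .
qed

end

lemma degree_prod_linear:
  assumes "finite A"
  shows "Polynomial.degree (\<Prod>k\<in>A. [:z k, 1:]) \<le> card A"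
proof -
  have "Polynomial.degree (\<Prod>k\<in>A. [:z k, 1:]) \<le> (\<Sum>k\<in>A. Polynomial.degree [:z k, 1:])"
    using degree_prod_sum_le[OF assms, of "\<lambda>k. [:z k, 1:]"] by (simp add: o_def)
  also have "\<dots> \<le> (\<Sum>k\<in>A. 1)" by (rule sum_mono) simp
  finally show ?thesis by simp
qed

lemma coeff_prod_linear_top:
  fixes z :: "'b \<Rightarrow> 'a::comm_ring_1"
  assumes "finite A"
  shows "Polynomial.coeff (\<Prod>k\<in>A. [:z k, 1:]) (card A) = 1"
proof -
  have "{S. S \<subseteq> A \<and> card S = 0} = {{}}" using assms finite_subset by fastforce
  then show ?thesis using coeff_prod_linear[OF assms, of 0 z] by simp
qed

lemma pcompose_prod_linear:
  fixes z :: "'b \<Rightarrow> 'a::comm_ring_1"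
  shows
  "pcompose (\<Prod>k\<in>A. [:z k, 1:]) [:- c, 1:] = (\<Prod>k\<in>A. [:z k - c, 1:])"
  unfolding pcompose_prod by (intro prod.cong refl) (simp add: pcompose_pCons)

text \<open>The zero polynomial is covered since a Hasse derivative may vanish identically in
  characteristic p.\<close>

lemma (in domain) root_pdivides:
  assumes "p \<in> carrier (poly_ring R)" "a \<in> carrier R" "eval p a = \<zero>"
  shows "[\<one>, \<ominus> a] pdivides p"
proof (cases "p = []")
  case True
  have "[\<one>, \<ominus> a] \<in> carrier (poly_ring R)"
    using assms(2) by (auto simp: univ_poly_carrier[symmetric] polynomial_def)
  then show ?thesis using True pdivides_zero[OF carrier_is_subring] by simp
next
  case False
  then show ?thesis using assms by (intro is_root_imp_pdivides) (auto simp: is_root_def)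
qed

lemma (in domain) eval_linear_power:
  assumes "a \<in> carrier R" "b \<in> carrier R"
  shows "eval ([\<one>, \<ominus> a] [^]\<^bsub>poly_ring R\<^esub> (m::nat)) b = (b \<ominus> a) [^] m"
proof -
  interpret E: ring_hom_ring "poly_ring R" R "\<lambda>p. eval p b"
    by (rule eval_ring_hom[OF carrier_is_subring assms(2)])
  have "[\<one>, \<ominus> a] \<in> carrier (poly_ring R)"
    using assms(1) by (auto simp: univ_poly_carrier[symmetric] polynomial_def)
  from E.hom_nat_pow[OF this, of m] show ?thesis using assms by (simp add: a_minus_def)
qed

lemma (in domain) nat_pow_eq_zero:
  assumes "a \<in> carrier R" "a [^] (m::nat) = \<zero>"
  shows "a = \<zero>"
  using assms(2)
proof (induction m)
  case (Suc m)
  then show ?case using integral[of "a [^] m" a] assms(1) by auto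
qed simp

text \<open>The polynomial is the image of the product of the X + y_k. A vanishing form exhibits a
  root that it shares with a Hasse derivative, and the roots -x_k and -y_n = 0 have different
  images, so it is no power of a linear polynomial.\<close>

lemma (in zx_hom) casas_alvero_of_zero:
  assumes n: "n \<ge> 2" and T: "T \<in> TT n"
    and G: "\<And>i. i \<in> {1..n - 1} \<Longrightarrow> \<Phi> (GT n T i) = \<zero>"
    and k: "k \<in> {1..n - 1}" "\<Phi> (xvar k) \<noteq> \<zero>"
  shows "\<exists>f. monic_of_degree K n f \<and> casas_alvero K f \<and>
    \<not> (\<exists>b\<in>carrier K. f = [\<one>, \<ominus> b] [^]\<^bsub>poly_ring K\<^esub> n)"
proof -
  define F where "F = (\<Prod>k=1..n. [:yvar n k, 1:])"
  define f where "f = image_list n F"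
  have deg: "Polynomial.degree F \<le> n"
    using degree_prod_linear[of "{1..n}" "yvar n"] by (simp add: F_def)
  have top: "Polynomial.coeff F n = 1"
    using coeff_prod_linear_top[of "{1..n}" "yvar n"] by (simp add: F_def)
  have f_nil: "f \<noteq> []" and f_deg: "length f - 1 = n" by (simp_all add: f_def image_list_def)
  have f_lead: "hd f = \<one>"
    by (simp add: f_def image_list_def top upt_conv_Cons del: upt_Suc)
  have f_poly: "f \<in> carrier (poly_ring K)"
    unfolding univ_poly_carrier[symmetric] polynomial_def
    using f_lead by (auto simp: f_def image_list_def)
  have root: "poly F (- yvar n j) = 0" if "j \<in> {1..n}" for j
    using that by (auto simp: F_def poly_prod intro!: prod_zero)
  have "monic_of_degree K n f"
    using f_poly f_nil f_lead f_deg by (simp add: monic_of_degree_def)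
  moreover have "casas_alvero K f"
    unfolding casas_alvero_def f_deg
  proof
    fix i assume i: "i \<in> {1..n - 1}"
    then have ni: "n - i \<in> {1..n - 1}" by auto
    \<comment> \<open>The form attached to the i-th Hasse derivative is the one of degree n - i, so
      the common root is selected by T (n - i).\<close>
    let ?b = "- yvar n (T (n - i))"
    have Tj: "T (n - i) \<in> {1..n}" using T ni by (auto simp: TT_def)
    have "n - (n - i) = i" and "i \<le> n" using i by auto
    then have "GT n T (n - i) = Polynomial.coeff (pcompose F [:?b, 1:]) i"
      using GT_eq_coeff[where T = T, OF ni Tj] by (simp add: F_def pcompose_prod_linear)
    then have h: "eval (hasse K i f) (\<Phi> ?b) = \<zero>"
      using eval_hasse_image_list[OF deg \<open>i \<le> n\<close>, of ?b] G[OF ni] by (simp add: f_def)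
    have e: "eval f (\<Phi> ?b) = \<zero>"
      using eval_image_list[OF deg, of ?b] root[OF Tj] by (simp add: f_def)
    show "\<exists>g\<in>carrier (poly_ring K). length g - 1 \<ge> 1 \<and> g pdivides f \<and> g pdivides hasse K i f"
    proof (intro bexI conjI)
      show "[\<one>, \<ominus> \<Phi> ?b] pdivides f" by (rule root_pdivides[OF f_poly _ e]) simp
      show "[\<one>, \<ominus> \<Phi> ?b] pdivides hasse K i f"
      proof (rule root_pdivides[OF _ _ h])
        show "hasse K i f \<in> carrier (poly_ring K)"
          unfolding f_def by (rule hasse_image_list_closed[OF \<open>i \<le> n\<close>])
      qed simp
      show "[\<one>, \<ominus> \<Phi> ?b] \<in> carrier (poly_ring K)"
        unfolding univ_poly_carrier[symmetric] polynomial_def by simp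
    qed simp
  qed
  moreover have "f \<noteq> [\<one>, \<ominus> b] [^]\<^bsub>poly_ring K\<^esub> n" if b: "b \<in> carrier K" for b
  proof
    assume f: "f = [\<one>, \<ominus> b] [^]\<^bsub>poly_ring K\<^esub> n"
    have only: "\<Phi> (- yvar n j) = b" if j: "j \<in> {1..n}" for j
    proof -
      have "(\<Phi> (- yvar n j) \<ominus> b) [^] n = eval f (\<Phi> (- yvar n j))"
        unfolding f by (rule eval_linear_power[OF b, symmetric]) simp
      also have "\<dots> = \<zero>"
        using eval_image_list[OF deg, of "- yvar n j"] root[OF j] by (simp add: f_def del: \<Phi>_uminus)
      finally have "\<Phi> (- yvar n j) \<ominus> b = \<zero>"
        by (rule nat_pow_eq_zero[rotated]) (use b in simp)
      then show ?thesis using r_right_minus_eq[OF _ b] by simp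
    qed
    have "k \<in> {1..n}" "k \<noteq> n" using k(1) n by auto
    then have "\<Phi> (- xvar k) = \<Phi> (- yvar n n)"
      using only[of k] only[of n] n by (simp add: yvar_def del: \<Phi>_uminus)
    then have "\<Phi> (xvar k) = \<zero>"
      using minus_minus[of "\<Phi> (xvar k)"] by (simp add: yvar_def)
    then show False using k(2) by blast
  qed
  ultimately show ?thesis by blast
qed

section \<open>Splitting a monic polynomial and choosing the common roots\<close>

primrec linear_product :: "('a, 'b) ring_scheme \<Rightarrow> (nat \<Rightarrow> 'a) \<Rightarrow> nat \<Rightarrow> 'a list" where
  "linear_product K r 0 = \<one>\<^bsub>poly_ring K\<^esub>"
| "linear_product K r (Suc m) = [\<one>\<^bsub>K\<^esub>, \<ominus>\<^bsub>K\<^esub> r (Suc m)] \<otimes>\<^bsub>poly_ring K\<^esub> linear_product K r m"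

context domain
begin

lemma linear_closed: "a \<in> carrier R \<Longrightarrow> [\<one>, \<ominus> a] \<in> carrier (poly_ring R)"
  by (simp add: univ_poly_carrier[symmetric] polynomial_def)

lemma linear_product_closed:
  assumes "\<And>k. r k \<in> carrier R"
  shows "linear_product R r m \<in> carrier (poly_ring R)"
proof -
  interpret UP: domain "poly_ring R" by (rule univ_poly_is_domain[OF carrier_is_subring])
  show ?thesis by (induction m) (use assms linear_closed in auto)
qed

lemma linear_product_cong:
  "(\<And>k. k \<in> {1..m} \<Longrightarrow> r k = s k) \<Longrightarrow> linear_product R r m = linear_product R s m"
  by (induction m) auto

lemma linear_product_const:
  assumes "a \<in> carrier R" and "\<And>k. k \<in> {1..m} \<Longrightarrow> r k = a"
  shows "linear_product R r m = [\<one>, \<ominus> a] [^]\<^bsub>poly_ring R\<^esub> m"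
  using assms(2)
proof (induction m)
  case (Suc m)
  interpret UP: domain "poly_ring R" by (rule univ_poly_is_domain[OF carrier_is_subring])
  show ?case using Suc linear_closed[OF assms(1)] by (simp add: UP.m_comm)
qed simp

lemma eval_linear_product_zero:
  assumes r: "\<And>k. r k \<in> carrier R" and b: "b \<in> carrier R"
    and "eval (linear_product R r m) b = \<zero>"
  shows "\<exists>j\<in>{1..m}. b = r j"
  using assms(3)
proof (induction m)
  case 0
  then show ?case by (simp add: univ_poly_one)
next
  case (Suc m)
  interpret E: ring_hom_ring "poly_ring R" R "\<lambda>p. eval p b"
    by (rule eval_ring_hom[OF carrier_is_subring b])
  have "eval [\<one>, \<ominus> r (Suc m)] b \<otimes> eval (linear_product R r m) b = \<zero>"
    using Suc.prems E.hom_mult[OF linear_closed[OF r] linear_product_closed[OF r]] by (simp del: eval.simps)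
  then have "b \<ominus> r (Suc m) = \<zero> \<or> eval (linear_product R r m) b = \<zero>"
    using integral E.hom_closed[OF linear_product_closed[OF r]] r b by (simp add: a_minus_def)
  then show ?case
  proof
    assume "b \<ominus> r (Suc m) = \<zero>"
    then have "b = r (Suc m)" using r_right_minus_eq[OF b r] by simp
    then show ?thesis by auto
  next
    assume "eval (linear_product R r m) b = \<zero>"
    then show ?thesis using Suc.IH by force
  qed
qed

lemma coeff_linear_mult:
  assumes a: "a \<in> carrier R" and q: "q \<in> carrier (poly_ring R)"
  shows "coeff ([\<one>, a] \<otimes>\<^bsub>poly_ring R\<^esub> q) 0 = a \<otimes> coeff q 0"
    and "coeff ([\<one>, a] \<otimes>\<^bsub>poly_ring R\<^esub> q) (Suc i) = a \<otimes> coeff q (Suc i) \<oplus> coeff q i"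
proof -
  have set_q: "set q \<subseteq> carrier R" using q by (simp add: univ_poly_carrier[symmetric] polynomial_incl)
  have mult: "coeff ([\<one>, a] \<otimes>\<^bsub>poly_ring R\<^esub> q) = (\<lambda>i. \<Oplus>k\<in>{..i}. coeff [\<one>, a] k \<otimes> coeff q (i - k))"
    unfolding univ_poly_mult using a set_q by (intro poly_mult_coeff) auto
  have clos: "coeff q k \<in> carrier R" for k using set_q by simp
  show "coeff ([\<one>, a] \<otimes>\<^bsub>poly_ring R\<^esub> q) 0 = a \<otimes> coeff q 0"
    unfolding mult using a clos by simp
  have "(\<Oplus>k\<in>{..Suc i}. coeff [\<one>, a] k \<otimes> coeff q (Suc i - k)) =
      (\<Oplus>k\<in>{0, 1}. coeff [\<one>, a] k \<otimes> coeff q (Suc i - k))"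
    by (rule add.finprod_mono_neutral_cong_left[symmetric]) (use a clos in auto)
  also have "\<dots> = a \<otimes> coeff q (Suc i) \<oplus> coeff q i"
    using a clos by simp
  finally show "coeff ([\<one>, a] \<otimes>\<^bsub>poly_ring R\<^esub> q) (Suc i) = a \<otimes> coeff q (Suc i) \<oplus> coeff q i"
    unfolding mult .
qed

end

lemma monic_eq_linear_product:
  fixes L :: "'a ring" (structure)
  assumes L: "algebraically_closed L" and "monic_of_degree L m f"
  shows "\<exists>r. (\<forall>k. r k \<in> carrier L) \<and> f = linear_product L r m"
  using assms(2)
proof (induction m arbitrary: f)
  case 0
  then have "f = [\<one>]" by (cases f) (auto simp: monic_of_degree_def)
  moreover have "\<zero> \<in> carrier L"
  proof -
    interpret algebraically_closed L by (rule L)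
    show ?thesis by simp
  qed
  ultimately show ?case by (intro exI[of _ "\<lambda>_. \<zero>"]) (simp add: univ_poly_one)
next
  case (Suc m)
  interpret algebraically_closed L by (rule L)
  interpret UP: domain "poly_ring L" by (rule univ_poly_is_domain[OF carrier_is_subring])
  have f: "f \<in> carrier (poly_ring L)" "f \<noteq> []" "hd f = \<one>" "length f - 1 = Suc m"
    using Suc.prems by (auto simp: monic_of_degree_def)
  have "length f - 1 > 0" using f(4) by simp
  from exists_root_of_degree_pos[OF f(1) this]
  obtain a where a: "a \<in> carrier L" "eval f a = \<zero>" by blast
  obtain q where q: "q \<in> carrier (poly_ring L)" "f = [\<one>, \<ominus> a] \<otimes>\<^bsub>poly_ring L\<^esub> q"
    using root_pdivides[OF f(1) a] unfolding pdivides_def factor_def by auto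
  have q_nil: "q \<noteq> []"
    using q f(2) UP.r_null[OF linear_closed[OF a(1)]] by (auto simp: univ_poly_zero)
  have pol: "polynomial (carrier L) [\<one>, \<ominus> a]" "polynomial (carrier L) q"
    using linear_closed[OF a(1)] q(1) by (simp_all add: univ_poly_carrier)
  have "hd f = \<one> \<otimes> hd q"
    using poly_mult_lead_coeff[OF carrier_is_subring pol] q_nil by (simp add: q(2) univ_poly_mult)
  moreover have "hd q \<in> carrier L"
    using pol(2) q_nil by (auto simp: polynomial_def)
  ultimately have "hd q = \<one>" using f(3) by simp
  moreover have "length q - 1 = m"
    using poly_mult_degree_eq[OF carrier_is_subring pol] q_nil f(4) by (simp add: q(2) univ_poly_mult)
  ultimately have "monic_of_degree L m q" using q(1) q_nil by (simp add: monic_of_degree_def)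
  then obtain r where r: "\<forall>k. r k \<in> carrier L" "q = linear_product L r m" using Suc.IH by blast
  have "linear_product L (r(Suc m := a)) m = linear_product L r m"
    by (rule linear_product_cong) auto
  then have "f = linear_product L (r(Suc m := a)) (Suc m)" using q(2) r(2) by simp
  moreover have "\<forall>k. (r(Suc m := a)) k \<in> carrier L" using r(1) a(1) by simp
  ultimately show ?case by blast
qed

lemma (in zx_hom) coeff_linear_product:
  "coeff (linear_product K (\<lambda>k. \<Phi> (- xvar k)) m) i = \<Phi> (Polynomial.coeff (\<Prod>k=1..m. [:xvar k, 1:]) i)"
proof (induction m arbitrary: i)
  case 0
  then show ?case by (simp add: univ_poly_one)
next
  case (Suc m)
  let ?P = "\<Prod>k=1..m. [:xvar k, 1:]"
  have closed: "linear_product K (\<lambda>k. \<Phi> (- xvar k)) m \<in> carrier (poly_ring K)"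
    by (rule linear_product_closed) simp
  have prod: "(\<Prod>k=1..Suc m. [:xvar k, 1:]) = [:xvar (Suc m), 1:] * ?P"
    by (simp add: mult.commute)
  have lin: "\<ominus> \<Phi> (- xvar (Suc m)) = \<Phi> (xvar (Suc m))" by simp
  show ?case
  proof (cases i)
    case 0
    show ?thesis
      unfolding 0 linear_product.simps lin prod coeff_linear_mult(1)[OF \<Phi>_simps(5) closed] Suc.IH
      by simp
  next
    case (Suc i')
    show ?thesis
      unfolding Suc linear_product.simps lin prod coeff_linear_mult(2)[OF \<Phi>_simps(5) closed] Suc.IH
      by (simp add: coeff_pCons)
  qed
qed

text \<open>A list of length m + 1 is determined by its coefficients 0, ..., m. So a split
  polynomial is the image of the generic product and inherits the identities proved for it.\<close>

lemma (in zx_hom) linear_product_eq_image_list: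
  assumes "monic_of_degree K m (linear_product K (\<lambda>k. \<Phi> (- xvar k)) m)"
  shows "linear_product K (\<lambda>k. \<Phi> (- xvar k)) m = image_list m (\<Prod>k=1..m. [:xvar k, 1:])"
proof -
  let ?f = "linear_product K (\<lambda>k. \<Phi> (- xvar k)) m"
  have len: "length ?f = Suc m"
    using assms by (cases ?f) (auto simp: monic_of_degree_def)
  have "?f = map (coeff ?f) (rev [0..<Suc m])"
    using coeff_list[of ?f] by (simp only: len)
  also have "rev [0..<Suc m] = map (\<lambda>k. m - k) [0..<Suc m]"
    by (rule nth_equalityI) (simp_all add: rev_nth del: upt_Suc)
  finally show ?thesis
    by (simp only: image_list_def map_map o_def coeff_linear_product)
qed

text \<open>Subtracting a root from all the others is realised by composing with \<open>x\<^sub>k \<mapsto> x\<^sub>k - x\<^sub>n\<close>.\<close>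

lemma zero_of_casas_alvero:
  fixes L :: "'a ring" (structure)
  assumes L: "algebraically_closed L" and n: "n \<ge> 2" and f: "monic_of_degree L n f" "casas_alvero L f"
    and not_power: "\<not> (\<exists>b\<in>carrier L. f = [\<one>, \<ominus> b] [^]\<^bsub>poly_ring L\<^esub> n)"
  shows "\<exists>T\<in>TT n. \<exists>\<Phi>\<in>Ring.ring_hom ZX L. (\<forall>i\<in>{1..n - 1}. \<Phi> (GT n T i) = \<zero>) \<and>
    (\<exists>k\<in>{1..n - 1}. \<Phi> (xvar k) \<noteq> \<zero>)"
proof -
  interpret algebraically_closed L by (rule L)
  obtain r where r: "\<And>k. r k \<in> carrier L" "f = linear_product L r n"
    using monic_eq_linear_product[OF L f(1)] by blast
  \<comment> \<open>The generic factors are X + x_k, so the coordinates are the negatives of the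
    roots.\<close>
  define \<Psi> where "\<Psi> = zx_eval (\<lambda>k. \<ominus> r k)"
  have \<Psi>: "\<Psi> \<in> Ring.ring_hom ZX L" unfolding \<Psi>_def by (rule zx_eval_hom) (use r in simp)
  interpret \<Psi>: zx_hom L \<Psi> by unfold_locales (rule \<Psi>)
  have \<Psi>x: "\<Psi> (- xvar k) = r k" for k
    using zx_eval_xvar[of "\<lambda>k. \<ominus> r k" k] r(1) by (simp add: \<Psi>_def[symmetric])
  define F where "F = (\<Prod>k=1..n. [:xvar k, 1:])"
  have deg: "Polynomial.degree F \<le> n"
    using degree_prod_linear[of "{1..n}" xvar] by (simp add: F_def)
  have fF: "f = \<Psi>.image_list n F"
    using \<Psi>.linear_product_eq_image_list[of n] f(1) by (simp only: r(2) \<Psi>x F_def)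
  have n_f: "length f - 1 = n" using f(1) by (simp add: monic_of_degree_def)
  \<comment> \<open>A root of the common factor is one of the r_j; the j found for the Hasse
    derivative of order n - i becomes T i.\<close>
  have "\<exists>j\<in>{1..n}. \<Psi> (Polynomial.coeff (\<Prod>k=1..n. [:xvar k - xvar j, 1:]) (n - i)) = \<zero>"
    if i: "i \<in> {1..n - 1}" for i
  proof -
    have ni: "n - i \<in> {1..n - 1}" "n - i \<le> n" using i by auto
    then obtain g where g: "g \<in> carrier (poly_ring L)" "length g - 1 \<ge> 1" "g pdivides f"
      "g pdivides hasse L (n - i) f"
      using f(2) unfolding casas_alvero_def n_f by blast
    have "length g - 1 > 0" using g(2) by linarith
    from exists_root_of_degree_pos[OF g(1) this]
    obtain b where b: "b \<in> carrier L" "eval g b = \<zero>" by blast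
    have "eval f b = \<zero>" by (rule pdivides_imp_root_sharing[OF g(1,3) b])
    then obtain j where j: "j \<in> {1..n}" "b = r j"
      using eval_linear_product_zero[where r = r, OF r(1) b(1)] unfolding r(2) by blast
    have "eval (hasse L (n - i) f) b = \<zero>" by (rule pdivides_imp_root_sharing[OF g(1,4) b])
    then have "\<Psi> (Polynomial.coeff (pcompose F [:- xvar j, 1:]) (n - i)) = \<zero>"
      using \<Psi>.eval_hasse_image_list[OF deg ni(2), of "- xvar j"] by (simp only: fF \<Psi>x j(2))
    then show ?thesis using j(1) by (auto simp: F_def pcompose_prod_linear)
  qed
  then have "\<exists>t. \<forall>i\<in>{1..n - 1}. t i \<in> {1..n} \<and>
      \<Psi> (Polynomial.coeff (\<Prod>k=1..n. [:xvar k - xvar (t i), 1:]) (n - i)) = \<zero>"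
    by (intro bchoice) blast
  then obtain t where t: "\<And>i. i \<in> {1..n - 1} \<Longrightarrow> t i \<in> {1..n}"
    "\<And>i. i \<in> {1..n - 1} \<Longrightarrow> \<Psi> (Polynomial.coeff (\<Prod>k=1..n. [:xvar k - xvar (t i), 1:]) (n - i)) = \<zero>"
    by blast
  define T where "T = restrict t {1..n - 1}"
  have T: "T \<in> TT n" using t(1) by (auto simp: T_def TT_def)
  define \<rho> where "\<rho> = msubst (\<lambda>k. xvar k - xvar n)"
  have \<rho>_diff: "\<rho> (P - Q) = \<rho> P - \<rho> Q" for P Q
    using msubst_add[of _ "P - Q" Q] by (simp add: \<rho>_def eq_diff_eq)
  have \<rho>_sum: "\<rho> (sum h A) = (\<Sum>a\<in>A. \<rho> (h a))" for h and A :: "nat set set"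
    by (simp add: \<rho>_def msubst_sum)
  have \<rho>_prod: "\<rho> (prod h A) = (\<Prod>a\<in>A. \<rho> (h a))" for h and A :: "nat set"
    by (simp add: \<rho>_def msubst_prod)
  \<comment> \<open>For k = n both sides are 0, so one formula covers all k.\<close>
  have \<rho>y: "\<rho> (yvar n k) = xvar k - xvar n" for k
    using \<rho>_diff[of 0 0] by (simp add: yvar_def \<rho>_def msubst_xvar)
  have "\<Psi> \<circ> \<rho> \<in> Ring.ring_hom ZX L"
    by (rule ring_hom_memI) (simp_all add: \<rho>_def msubst_add msubst_mult msubst_one)
  moreover have "(\<Psi> \<circ> \<rho>) (GT n T i) = \<zero>" if i: "i \<in> {1..n - 1}" for i
  proof -
    have Ti: "T i = t i" "T i \<in> {1..n}" using t(1)[OF i] i by (auto simp: T_def)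
    \<comment> \<open>The translation by x_n cancels in the differences, so \<rho> turns the form
      into its version for the original roots.\<close>
    have "\<rho> (GT n T i) = (\<Sum>S | S \<subseteq> {1..n} \<and> card S = i. \<Prod>k\<in>S. xvar k - xvar (T i))"
      unfolding GT_eq_sum[where T = T, OF i Ti(2)]
      by (simp add: \<rho>_sum \<rho>_prod \<rho>_diff \<rho>y)
    also have "\<dots> = Polynomial.coeff (\<Prod>k=1..n. [:xvar k - xvar (T i), 1:]) (n - i)"
      using coeff_prod_linear[of "{1..n}" i "\<lambda>k. xvar k - xvar (T i)"] i by auto
    finally show ?thesis using t(2)[OF i] by (simp add: Ti(1))
  qed
  moreover have "\<exists>k\<in>{1..n - 1}. (\<Psi> \<circ> \<rho>) (xvar k) \<noteq> \<zero>"
  proof (rule ccontr)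
    assume "\<not> ?thesis"
    then have zero: "\<Psi> (xvar k - xvar n) = \<zero>" if "k \<in> {1..n - 1}" for k
      using that by (auto simp: \<rho>_def msubst_xvar)
    have "r k = r n" if k: "k \<in> {1..n}" for k
    proof (cases "k = n")
      case False
      then have "k \<in> {1..n - 1}" using k by auto
      have "\<Psi> (xvar k - xvar n) = r n \<ominus> r k"
        using \<Psi>.\<Phi>_diff[of "- xvar n" "- xvar k"] \<Psi>x by (simp only: \<Psi>x) (simp add: algebra_simps)
      then show ?thesis
        using zero[OF \<open>k \<in> {1..n - 1}\<close>] r_right_minus_eq[OF r(1) r(1), of n k] by simp
    qed simp
    then have "f = [\<one>, \<ominus> r n] [^]\<^bsub>poly_ring L\<^esub> n"
      unfolding r(2) by (rule linear_product_const[OF r(1)])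
    then show False using not_power r(1) by blast
  qed
  ultimately show ?thesis using T by blast
qed

text \<open>At the zero, the minor times x_k^d is 0 by \<open>minor_times_monomial\<close>; x_k is
  nonzero there, so the minor itself maps to 0 and is divisible by the characteristic.\<close>

lemma dvd_JT_of_zero:
  assumes n: "n \<ge> 2" and T: "T \<in> TT n" and p: "prime p"
    and K: "field K" "ring_char K = p" and \<Phi>: "\<Phi> \<in> Ring.ring_hom ZX K"
    and G: "\<And>i. i \<in> {1..n - 1} \<Longrightarrow> \<Phi> (GT n T i) = \<zero>\<^bsub>K\<^esub>"
    and k: "k \<in> {1..n - 1}" "\<Phi> (xvar k) \<noteq> \<zero>\<^bsub>K\<^esub>"
  shows "int p dvd JT n T"
  unfolding dvd_JT_iff
proof (intro allI impI, elim conjE)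
  fix I assume I: "I \<subseteq> {..<DD n}" "card I = CC n"
  let ?D = "det (submatrix (MT n T) I UNIV)"
  interpret field K by (rule K(1))
  interpret zx_hom K \<Phi> by unfold_locales (rule \<Phi>)
  have "Poly_Mapping.single k (dd n) \<in> exps n (dd n)"
    using k(1) by (auto simp: exps_def lookup_single when_def)
  from minor_times_monomial[OF n T I this]
  have "\<Phi> (Poly_Mapping.single (Poly_Mapping.single k (dd n)) ?D) = \<zero>\<^bsub>K\<^esub>"
    by (rule \<Phi>_span_zero[rotated]) (use G in auto)
  moreover have "Poly_Mapping.single (Poly_Mapping.single k (dd n)) ?D = zconst ?D * xvar k ^ dd n"
    by (simp add: xvar_power mult_single)
  ultimately have "\<Phi> (zconst ?D) \<otimes>\<^bsub>K\<^esub> \<Phi> (xvar k) [^]\<^bsub>K\<^esub> dd n = \<zero>\<^bsub>K\<^esub>" by simp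
  from integral[OF this] have "\<Phi> (zconst ?D) = \<zero>\<^bsub>K\<^esub>"
    using k(2) nat_pow_eq_zero[of "\<Phi> (xvar k)"] by auto
  then show "int p dvd ?D" by (rule ring_hom_ZX_zconst_dvd[OF K(1) \<Phi> p K(2)])
qed

lemma bad_prime_iff:
  fixes n p :: nat
  assumes inf: "infinite (UNIV :: 'a set)" and n: "n \<ge> 2" and p: "prime p"
  shows "bad_prime TYPE('a) n p \<longleftrightarrow> (\<exists>T\<in>TT n. int p dvd JT n T)"
proof
  assume "bad_prime TYPE('a) n p"
  then obtain K :: "'a ring" and f where K: "algebraically_closed K" "ring_char K = p"
    and f: "monic_of_degree K n f" "casas_alvero K f"
      "\<not> (\<exists>b\<in>carrier K. f = [\<one>\<^bsub>K\<^esub>, \<ominus>\<^bsub>K\<^esub> b] [^]\<^bsub>poly_ring K\<^esub> n)"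
    unfolding bad_prime_def CA_def by blast
  have field: "field K" using K(1) by (simp add: algebraically_closed_def)
  obtain T \<Phi> k where T: "T \<in> TT n" and \<Phi>: "\<Phi> \<in> Ring.ring_hom ZX K"
    and G: "\<And>i. i \<in> {1..n - 1} \<Longrightarrow> \<Phi> (GT n T i) = \<zero>\<^bsub>K\<^esub>"
    and k: "k \<in> {1..n - 1}" "\<Phi> (xvar k) \<noteq> \<zero>\<^bsub>K\<^esub>"
    using zero_of_casas_alvero[OF K(1) n f] by blast
  show "\<exists>T\<in>TT n. int p dvd JT n T"
    using dvd_JT_of_zero[OF n T p field K(2) \<Phi> G k] T by blast
next
  assume "\<exists>T\<in>TT n. int p dvd JT n T"
  then obtain T where T: "T \<in> TT n" and dvd: "int p dvd JT n T" by blast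
  have q: "\<not> int p dvd 1" using p prime_gt_1_nat[OF p] by simp
  have "\<exists>k\<in>{1..n - 1}. \<forall>N. xvar k ^ N \<notin> GT_ideal n T (int p)"
  proof (rule ccontr)
    assume "\<not> ?thesis"
    then have "\<exists>N. xvar k ^ N \<in> GT_ideal n T (int p)" if "k \<in> {1..n - 1}" for k using that by blast
    from monomials_in_GT_ideal[OF n T this] have "Poly_Mapping.single \<beta> 1 \<in> GT_ideal n T (int p)"
      if "\<beta> \<in> exps n (dd n)" for \<beta> using that by blast
    from exists_minor_not_dvd_MT[OF n T q this] show False
      using dvd unfolding dvd_JT_iff by blast
  qed
  then obtain k where k: "k \<in> {1..n - 1}" and nil: "\<And>N. xvar k ^ N \<notin> GT_ideal n T (int p)" by blast
  from exists_nontrivial_zero[OF inf p T k nil]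
  obtain K :: "'a ring" and \<Phi> where K: "algebraically_closed K" "ring_char K = p"
    and \<Phi>: "\<Phi> \<in> Ring.ring_hom ZX K" and G: "\<And>i. i \<in> {1..n - 1} \<Longrightarrow> \<Phi> (GT n T i) = \<zero>\<^bsub>K\<^esub>"
    and k1: "\<Phi> (xvar k) = \<one>\<^bsub>K\<^esub>"
    by blast
  interpret algebraically_closed K by (rule K(1))
  interpret zx_hom K \<Phi> by unfold_locales (rule \<Phi>)
  have "\<Phi> (xvar k) \<noteq> \<zero>\<^bsub>K\<^esub>" using k1 by simp
  from casas_alvero_of_zero[OF n T G k this] show "bad_prime TYPE('a) n p"
    unfolding bad_prime_def CA_def using p K by blast
qed

text \<open>The lcm divides the product, so Euclid's lemma applies inductively; a zero among the
  elements makes both sides true.\<close>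

lemma prime_dvd_Lcm_iff:
  fixes p :: int
  assumes p: "prime p" and A: "finite A"
  shows "p dvd Lcm A \<longleftrightarrow> (\<exists>a\<in>A. p dvd a)"
proof
  assume "p dvd Lcm A"
  with A show "\<exists>a\<in>A. p dvd a"
  proof (induction A rule: finite_induct)
    case empty
    then show ?case using p by (simp add: not_prime_unit)
  next
    case (insert a A)
    have "lcm a (Lcm A) dvd a * Lcm A" by (rule lcm_least) simp_all
    then have "p dvd a * Lcm A" using insert.prems by (simp add: dvd_trans)
    then show ?case using insert.IH prime_dvd_multD[OF p] by blast
  qed
qed (auto intro: dvd_trans dvd_Lcm)

theorem theorem3p1:
  fixes n p :: nat
  assumes "infinite (UNIV :: 'a set)"
    and "n \<ge> 2"
    and "prime p"
  shows "(bad_prime TYPE('a) n p \<longleftrightarrow> (\<exists>T\<in>TT n. int p dvd JT n T)) \<and>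
         (bad_prime TYPE('a) n p \<longleftrightarrow> int p dvd Lcm (JT n ` TT n))"
proof -
  have "finite (JT n ` TT n)" by (simp add: TT_def finite_PiE)
  moreover have "prime (int p)" using assms(3) by simp
  ultimately have "int p dvd Lcm (JT n ` TT n) \<longleftrightarrow> (\<exists>T\<in>TT n. int p dvd JT n T)"
    using prime_dvd_Lcm_iff by auto
  then show ?thesis using bad_prime_iff[OF assms] by simp
qed

end
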